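(* Let $\epsilon>0$. Then there exists a positive constant $c$, independent of $d$, such that for all sufficiently large $d$, the expected number of connected components of a Kostlan random real plane curve of degree $d$ which have length at least $$2\pi\sqrt{\frac{\log\left(\epsilon \log(d)/2^{11}\right)}{12d}}$$ is bounded below by $\displaystyle \frac{c\,d^{1-\epsilon}}{\log(\log d)}$.
   Context: Let $H_d$ be the complex vector space of homogeneous polynomials of degree $d$ in $X_0,X_1,X_2$, of dimension $N_d=\binom{d+2}{2}$. For $P\in H_d$ the pointwise Fubini-Study norm at $[X]\in\mathbb{C}P^2$ is $\|P\|_{FS}^2=|P(X)|^2/\|X\|^{2d}$; in the affine chart $z=(z_1,z_2)\leftrightarrow[1:z_1:z_2]$ it is $|P(1,z_1,z_2)|^2/(1+\|z\|^2)^d$. The Fubini-Study volume form is $dVol_{FS}=dVol/(1+\|z\|^2)^3$ in this chart ($dVol$ is Lebesgue measure on $\mathbb{C}^2$), so $Vol_{FS}(\mathbb{C}P^2)=\pi^2/2$. The $L^2$-norm is $\|P\|_2^2=\frac{1}{Vol_{FS}(\mathbb{C}P^2)}\int_{\mathbb{C}P^2}\|P(z)\|_{FS}^2\,dVol_{FS}$. A Kostlan random real polynomial of degree $d$ is a random element of the real vector space of real polynomials in $H_d$ with the Gaussian probability measure $\pi^{-N_d/2}e^{-\|P\|_2^2}\,dP$, where $dP$ is Lebesgue measure for the inner product inducing $\|\cdot\|_2$. A Kostlan random real plane curve of degree $d$ is the zero locus in $\mathbb{R}P^2$ of a Kostlan random real polynomial of degree $d$. Lengths are measured in the Riemannian metric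 on $\mathbb{R}P^2$ induced by the Fubini-Study metric, normalized so that $d_{FS}([X],[Y])=\arccos\frac{|\langle X,Y\rangle|}{\|X\|\,\|Y\|}$ (equivalently $\tan d_{FS}(0,z)=\|z\|$ in the affine chart). *)

theory Defs
  imports "HOL-Analysis.Analysis"
begin

section \<open>Homogeneous polynomials in three variables\<close>

text \<open>A homogeneous polynomial of degree \<open>d\<close> is given by its coefficients
  on the exponent vectors \<open>\<alpha>\<close> with \<open>\<alpha>\<^sub>1 + \<alpha>\<^sub>2 + \<alpha>\<^sub>3 = d\<close>; values of
  the coefficient function elsewhere are ignored.\<close>

definition exponents :: "nat \<Rightarrow> (nat^3) set" where
  "exponents d = {\<alpha>. (\<Sum>i\<in>UNIV. \<alpha> $ i) = d}"

definition monomial :: "nat^3 \<Rightarrow> 'a::comm_semiring_1 ^ 3 \<Rightarrow> 'a" where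
  "monomial \<alpha> X = (\<Prod>i\<in>UNIV. (X $ i) ^ (\<alpha> $ i))"

definition hpoly :: "nat \<Rightarrow> (nat^3 \<Rightarrow> 'a) \<Rightarrow> 'a::comm_semiring_1 ^ 3 \<Rightarrow> 'a" where
  "hpoly d a X = (\<Sum>\<alpha>\<in>exponents d. a \<alpha> * monomial \<alpha> X)"

definition complexify :: "(nat^3 \<Rightarrow> real) \<Rightarrow> nat^3 \<Rightarrow> complex" where
  "complexify a = (\<lambda>\<alpha>. complex_of_real (a \<alpha>))"

lemma finite_exponents [simp]: "finite (exponents d)"
proof -
  have "exponents d \<subseteq> vec_lambda ` (UNIV \<rightarrow>\<^sub>E {..d})"
  proof
    fix \<alpha> assume "\<alpha> \<in> exponents d"
    then have "(\<Sum>i\<in>UNIV. \<alpha> $ i) = d"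
      by (simp add: exponents_def)
    then have "\<alpha> $ i \<le> d" for i
      using member_le_sum[of i UNIV "\<lambda>i. \<alpha> $ i"] by simp
    then show "\<alpha> \<in> vec_lambda ` (UNIV \<rightarrow>\<^sub>E {..d})"
      by (intro image_eqI[of _ _ "vec_nth \<alpha>"]) auto
  qed
  then show ?thesis
    by (rule finite_subset) (intro finite_imageI finite_PiE; simp)
qed

lemma monomial_scale:
  assumes "\<alpha> \<in> exponents d"
  shows "monomial \<alpha> (c *s X) = c ^ d * monomial \<alpha> X"
  using assms
  by (auto simp: monomial_def exponents_def power_mult_distrib prod.distrib power_sum)

lemma hpoly_scale: "hpoly d a (c *s X) = c ^ d * hpoly d a X"
  by (simp add: hpoly_def monomial_scale sum_distrib_left mult.left_commute
      cong: sum.cong)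


section \<open>The Fubini-Study norm and the Kostlan measure\<close>

definition fs_norm_sq :: "nat \<Rightarrow> (nat^3 \<Rightarrow> complex) \<Rightarrow> complex^3 \<Rightarrow> real" where
  "fs_norm_sq d P X = (norm (hpoly d P X))\<^sup>2 / norm X ^ (2 * d)"

text \<open>The affine chart \<open>z \<leftrightarrow> [1 : z\<^sub>1 : z\<^sub>2]\<close> covers the complex projective
  plane up to a null set, so integrals over the projective plane are
  integrals over the chart.\<close>

definition chart :: "complex \<times> complex \<Rightarrow> complex^3" where
  "chart z = vector [1, fst z, snd z]"

definition fs_measure :: "(complex \<times> complex) measure" where
  "fs_measure = density lborel (\<lambda>z. ennreal (1 / (1 + (norm z)\<^sup>2) ^ 3))"

definition fs_volume :: real where
  "fs_volume = measure fs_measure UNIV"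

definition l2_norm_sq :: "nat \<Rightarrow> (nat^3 \<Rightarrow> complex) \<Rightarrow> real" where
  "l2_norm_sq d P =
     1 / fs_volume * (LINT z|fs_measure. fs_norm_sq d P (chart z))"

text \<open>The real inner product that induces the \<open>L\<^sup>2\<close>-norm.\<close>

definition l2_inner ::
    "nat \<Rightarrow> (nat^3 \<Rightarrow> complex) \<Rightarrow> (nat^3 \<Rightarrow> complex) \<Rightarrow> real" where
  "l2_inner d P Q =
     1 / fs_volume * (LINT z|fs_measure.
       Re (hpoly d P (chart z) * cnj (hpoly d Q (chart z))) / norm (chart z) ^ (2 * d))"

lemma l2_inner_self: "l2_inner d P P = l2_norm_sq d P"
  unfolding l2_inner_def l2_norm_sq_def fs_norm_sq_def complex_norm_square[symmetric]
  by simp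

definition unit_coeff :: "nat^3 \<Rightarrow> nat^3 \<Rightarrow> complex" where
  "unit_coeff \<alpha> = (\<lambda>\<beta>. if \<beta> = \<alpha> then 1 else 0)"

text \<open>Determinant, by the Leibniz formula, of the Gram matrix of the monomials
  of degree \<open>d\<close>. (The library's \<^const>\<open>det\<close> needs the index set to be a type.)\<close>

definition gram_det :: "nat \<Rightarrow> real" where
  "gram_det d =
     (\<Sum>p | p permutes exponents d.
        of_int (sign p) *
        (\<Prod>\<alpha>\<in>exponents d. l2_inner d (unit_coeff \<alpha>) (unit_coeff (p \<alpha>))))"

text \<open>Lebesgue measure of the Euclidean space of real polynomials of degree
  \<open>d\<close> with the inner product \<^const>\<open>l2_inner\<close>, in the coordinates given by the
  coefficients: the volume of the parallelepiped spanned by the monomials is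
  the square root of their Gram determinant.\<close>

definition l2_lebesgue :: "nat \<Rightarrow> (nat^3 \<Rightarrow> real) measure" where
  "l2_lebesgue d =
     density (Pi\<^sub>M (exponents d) (\<lambda>_. lborel)) (\<lambda>_. ennreal (sqrt (gram_det d)))"

definition kostlan :: "nat \<Rightarrow> (nat^3 \<Rightarrow> real) measure" where
  "kostlan d =
     density (l2_lebesgue d)
       (\<lambda>a. ennreal (pi powr (- real ((d + 2) choose 2) / 2) *
                     exp (- l2_norm_sq d (complexify a))))"


section \<open>The real projective plane\<close>

quotient_type rp2 = "real^3" / partial:
  "\<lambda>X Y. X \<noteq> 0 \<and> Y \<noteq> 0 \<and> (\<exists>c. c \<noteq> 0 \<and> Y = c *\<^sub>R X)"
proof (rule part_equivpI)
  show "\<exists>X::real^3. X \<noteq> 0 \<and> X \<noteq> 0 \<and> (\<exists>c. c \<noteq> 0 \<and> X = c *\<^sub>R X)"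
    by (intro exI[of _ "1::real^3"] conjI exI[of _ "1::real"]) auto
  show "symp (\<lambda>X Y::real^3. X \<noteq> 0 \<and> Y \<noteq> 0 \<and> (\<exists>c. c \<noteq> 0 \<and> Y = c *\<^sub>R X))"
  proof (rule sympI)
    fix X Y :: "real^3"
    assume "X \<noteq> 0 \<and> Y \<noteq> 0 \<and> (\<exists>c. c \<noteq> 0 \<and> Y = c *\<^sub>R X)"
    then obtain c where "X \<noteq> 0" "Y \<noteq> 0" "c \<noteq> 0" "Y = c *\<^sub>R X" by blast
    then show "Y \<noteq> 0 \<and> X \<noteq> 0 \<and> (\<exists>c. c \<noteq> 0 \<and> X = c *\<^sub>R Y)"
      by (auto intro!: exI[of _ "inverse c"])
  qed
  show "transp (\<lambda>X Y::real^3. X \<noteq> 0 \<and> Y \<noteq> 0 \<and> (\<exists>c. c \<noteq> 0 \<and> Y = c *\<^sub>R X))"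
  proof (rule transpI)
    fix X Y Z :: "real^3"
    assume "X \<noteq> 0 \<and> Y \<noteq> 0 \<and> (\<exists>c. c \<noteq> 0 \<and> Y = c *\<^sub>R X)"
      and "Y \<noteq> 0 \<and> Z \<noteq> 0 \<and> (\<exists>c. c \<noteq> 0 \<and> Z = c *\<^sub>R Y)"
    then obtain c e where "X \<noteq> 0" "Z \<noteq> 0" "c \<noteq> 0" "e \<noteq> 0" "Z = e *\<^sub>R c *\<^sub>R X" by blast
    then show "X \<noteq> 0 \<and> Z \<noteq> 0 \<and> (\<exists>c. c \<noteq> 0 \<and> Z = c *\<^sub>R X)"
      by (auto intro!: exI[of _ "e * c"])
  qed
qed

lift_definition fs_dist :: "rp2 \<Rightarrow> rp2 \<Rightarrow> real" is
  "\<lambda>X Y. arccos (\<bar>X \<bullet> Y\<bar> / (norm X * norm Y))"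
  by (auto simp: abs_mult)

lift_definition vanishes :: "nat \<Rightarrow> (nat^3 \<Rightarrow> real) \<Rightarrow> rp2 \<Rightarrow> bool" is
  "\<lambda>d a X. hpoly d a X = 0"
  by (auto simp: hpoly_scale simp flip: scalar_mult_eq_scaleR)

definition real_curve :: "nat \<Rightarrow> (nat^3 \<Rightarrow> real) \<Rightarrow> rp2 set" where
  "real_curve d a = {p. vanishes d a p}"

lemma abs_rp2_eqI:
  "X \<noteq> 0 \<Longrightarrow> Y \<noteq> 0 \<Longrightarrow> c \<noteq> 0 \<Longrightarrow> Y = c *\<^sub>R X \<Longrightarrow> abs_rp2 X = abs_rp2 Y"
  by (rule Quotient_rel_abs[OF Quotient_rp2]) auto

lemma rp2_unit_rep:
  obtains X where "norm X = 1" "p = abs_rp2 X"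
proof -
  have "\<exists>X. norm X = 1 \<and> p = abs_rp2 X"
  proof (induction p rule: rp2.abs_induct)
    fix X :: "real^3"
    assume "X \<noteq> 0 \<and> X \<noteq> 0 \<and> (\<exists>c. c \<noteq> 0 \<and> X = c *\<^sub>R X)"
    then have "X \<noteq> 0" by simp
    then have "abs_rp2 (X /\<^sub>R norm X) = abs_rp2 X"
      by (intro abs_rp2_eqI[of _ _ "norm X"]) auto
    then show "\<exists>Y. norm Y = 1 \<and> abs_rp2 X = abs_rp2 Y"
      using \<open>X \<noteq> 0\<close> by (intro exI[of _ "X /\<^sub>R norm X"]) simp
  qed
  then show ?thesis using that by blast
qed

lemma fs_dist_abs:
  assumes "X \<noteq> 0" "Y \<noteq> 0"
  shows "fs_dist (abs_rp2 X) (abs_rp2 Y) = arccos (\<bar>X \<bullet> Y\<bar> / (norm X * norm Y))"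
  using assms by (intro fs_dist.abs_eq) (auto intro: exI[of _ 1])

lemma arccos_inner_triangle:
  fixes X Y Z :: "'a::real_inner"
  assumes n: "norm X = 1" "norm Y = 1" "norm Z = 1"
    and p: "X \<bullet> Y \<ge> 0" "Y \<bullet> Z \<ge> 0"
  shows "arccos (X \<bullet> Z) \<le> arccos (X \<bullet> Y) + arccos (Y \<bullet> Z)"
proof -
  define a b where "a = X \<bullet> Y" and "b = Y \<bullet> Z"
  have ab: "0 \<le> a" "a \<le> 1" "0 \<le> b" "b \<le> 1"
    using p norm_cauchy_schwarz[of X Y] norm_cauchy_schwarz[of Y Z] n
    by (auto simp: a_def b_def)
  have self: "X \<bullet> X = 1" "Y \<bullet> Y = 1" "Z \<bullet> Z = 1"
    using n by (simp_all add: norm_eq_1)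
  have nX: "norm (X - a *\<^sub>R Y) = sqrt (1 - a\<^sup>2)"
    by (simp add: norm_eq_sqrt_inner inner_diff_left inner_diff_right self
        inner_commute[of Y X] a_def[symmetric] power2_eq_square)
  have nZ: "norm (Z - b *\<^sub>R Y) = sqrt (1 - b\<^sup>2)"
    by (simp add: norm_eq_sqrt_inner inner_diff_left inner_diff_right self
        inner_commute[of Z Y] b_def[symmetric] power2_eq_square)
  have "(X - a *\<^sub>R Y) \<bullet> (Z - b *\<^sub>R Y) = X \<bullet> Z - a * b"
    by (simp add: inner_diff_left inner_diff_right self a_def[symmetric] b_def[symmetric])
  then have "a * b - sqrt (1 - a\<^sup>2) * sqrt (1 - b\<^sup>2) \<le> X \<bullet> Z"
    using Cauchy_Schwarz_ineq2[of "X - a *\<^sub>R Y" "Z - b *\<^sub>R Y"] nX nZ by (simp add: abs_le_iff)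
  moreover have "cos (arccos a + arccos b) = a * b - sqrt (1 - a\<^sup>2) * sqrt (1 - b\<^sup>2)"
    using ab by (simp add: cos_add sin_arccos)
  ultimately have le: "cos (arccos a + arccos b) \<le> X \<bullet> Z" by simp
  have "arccos a \<le> pi / 2" "arccos b \<le> pi / 2" "0 \<le> arccos a" "0 \<le> arccos b"
    using ab arccos_le_pi2[of a] arccos_le_pi2[of b] arccos_lbound by auto
  then have r: "0 \<le> arccos a + arccos b" "arccos a + arccos b \<le> pi" by auto
  have "X \<bullet> Z \<le> 1" using norm_cauchy_schwarz[of X Z] n by simp
  then have "arccos (X \<bullet> Z) \<le> arccos (cos (arccos a + arccos b))"
    using le by (intro arccos_le_arccos) auto
  also have "\<dots> = arccos a + arccos b" using r by (rule arccos_cos)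
  finally show ?thesis by (simp add: a_def b_def)
qed

lemma fs_dist_triangle: "fs_dist p r \<le> fs_dist p q + fs_dist q r"
proof -
  obtain X Y Z where X: "norm X = 1" "p = abs_rp2 X" and Y: "norm Y = 1" "q = abs_rp2 Y"
    and Z: "norm Z = 1" "r = abs_rp2 Z"
    using rp2_unit_rep by metis
  have nz: "X \<noteq> 0" "Y \<noteq> 0" "Z \<noteq> 0" using X Y Z by auto
  define X' where "X' = (if X \<bullet> Y \<ge> 0 then X else - X)"
  define Z' where "Z' = (if Y \<bullet> Z \<ge> 0 then Z else - Z)"
  have n: "norm X' = 1" "norm Z' = 1" using X Z by (auto simp: X'_def Z'_def)
  have a: "X' \<bullet> Y = \<bar>X \<bullet> Y\<bar>" "Y \<bullet> Z' = \<bar>Y \<bullet> Z\<bar>" by (auto simp: X'_def Z'_def)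
  have b: "X' \<bullet> Z' \<le> \<bar>X \<bullet> Z\<bar>" by (auto simp: X'_def Z'_def)
  have "\<bar>X \<bullet> Z\<bar> \<le> 1" using Cauchy_Schwarz_ineq2[of X Z] X Z by simp
  moreover have "-1 \<le> X' \<bullet> Z'"
    using Cauchy_Schwarz_ineq2[of X' Z'] n by simp
  ultimately have "arccos \<bar>X \<bullet> Z\<bar> \<le> arccos (X' \<bullet> Z')"
    using b by (intro arccos_le_arccos) auto
  also have "\<dots> \<le> arccos (X' \<bullet> Y) + arccos (Y \<bullet> Z')"
    using n Y a by (intro arccos_inner_triangle) auto
  finally show ?thesis using X Y Z nz a by (simp add: fs_dist_abs)
qed

lemma fs_dist_eq_0: "fs_dist p q = 0 \<longleftrightarrow> p = q"
proof -
  obtain X Y where X: "norm X = 1" "p = abs_rp2 X" and Y: "norm Y = 1" "q = abs_rp2 Y"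
    using rp2_unit_rep by metis
  have nz: "X \<noteq> 0" "Y \<noteq> 0" using X Y by auto
  have le: "\<bar>X \<bullet> Y\<bar> \<le> 1" using Cauchy_Schwarz_ineq2[of X Y] X Y by simp
  show ?thesis
  proof
    assume "fs_dist p q = 0"
    then have "arccos \<bar>X \<bullet> Y\<bar> = 0" using X Y nz by (simp add: fs_dist_abs)
    then have "\<bar>X \<bullet> Y\<bar> = 1" using cos_arccos_abs[of "\<bar>X \<bullet> Y\<bar>"] le by simp
    then have "\<bar>X \<bullet> Y\<bar> = norm X * norm Y" using X Y by simp
    then have "Y = X \<or> Y = - X"
      using X Y by (subst (asm) norm_cauchy_schwarz_abs_eq) (auto simp: eq_neg_iff_add_eq_0 add.commute)
    then show "p = q" using X Y nz abs_rp2_eqI[of X Y 1] abs_rp2_eqI[of X Y "-1"] by auto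
  next
    assume "p = q"
    moreover have "X \<bullet> X = 1" using X by (simp add: norm_eq_1)
    ultimately show "fs_dist p q = 0" using X nz fs_dist_abs[of X X] by simp
  qed
qed

instantiation rp2 :: metric_space
begin

definition dist_rp2 :: "rp2 \<Rightarrow> rp2 \<Rightarrow> real" where
  "dist_rp2 = fs_dist"

definition uniformity_rp2 :: "(rp2 \<times> rp2) filter" where
  "uniformity_rp2 = (INF e\<in>{0<..}. principal {(x, y). dist x y < e})"

definition open_rp2 :: "rp2 set \<Rightarrow> bool" where
  "open_rp2 U \<longleftrightarrow> (\<forall>x\<in>U. eventually (\<lambda>(x', y). x' = x \<longrightarrow> y \<in> U) uniformity)"

instance
proof
  fix p q r :: rp2
  show "dist p q = 0 \<longleftrightarrow> p = q" by (simp add: dist_rp2_def fs_dist_eq_0)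
  have "fs_dist q r = fs_dist r q" by transfer (simp add: inner_commute mult.commute)
  then show "dist p q \<le> dist p r + dist q r"
    using fs_dist_triangle[of p q r] by (simp add: dist_rp2_def)
qed (rule uniformity_rp2_def open_rp2_def)+

end


section \<open>Length and the expected number of long components\<close>

text \<open>The length of a set is its one-dimensional Hausdorff measure.  There is no
  dimensional constant: in dimension one, covers are weighted by their diameters.\<close>

definition hausdorff1_pre :: "real \<Rightarrow> 'a::metric_space set \<Rightarrow> ennreal" where
  "hausdorff1_pre \<delta> A =
     (INF U\<in>{U. (\<forall>n. bounded (U n) \<and> diameter (U n) \<le> \<delta>) \<and> A \<subseteq> (\<Union>n. U n)}.
        \<Sum>n::nat. ennreal (diameter (U n)))"

definition curve_length :: "'a::metric_space set \<Rightarrow> ennreal" where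
  "curve_length A = (SUP \<delta>\<in>{0<..}. hausdorff1_pre \<delta> A)"

definition long_components :: "real \<Rightarrow> rp2 set \<Rightarrow> rp2 set set" where
  "long_components L Z = {C \<in> components Z. curve_length C \<ge> ennreal L}"

text \<open>Counting is by \<^const>\<open>count_space\<close>, because \<^const>\<open>card\<close> would send infinite
  sets to \<open>0\<close>.\<close>

definition expected_long_components :: "nat \<Rightarrow> real \<Rightarrow> ennreal" where
  "expected_long_components d L =
     (\<integral>\<^sup>+ a. emeasure (count_space UNIV) (long_components L (real_curve d a)) \<partial>kostlan d)"

end

theory Submission
  imports Defs "HOL-Probability.Probability" "HOL-Real_Asymp.Real_Asymp"
begin

text \<open>The lower bound comes from about \<open>d / (log log d)\<^sup>2\<close> disjoint disks of radius of order
\<open>sqrt (log log d / d)\<close>. Each of them contains a long component of the curve with probability at least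
\<open>d\<^bsup>-\<epsilon>/2\<^esup>\<close>, up to a constant. Adding these probabilities gives more than the claim, because \<open>d\<^bsup>\<epsilon>/2\<^esup>\<close>
exceeds every power of \<open>log log d\<close>.

For a single disk the argument is the barrier method. In the affine chart around the centre, rescaled by
\<open>sqrt d\<close>, consider the polynomial with values \<open>t (\<bar>w\<bar>\<^sup>2 / A - 1)\<close>, where \<open>A = 0.88 log log d\<close> and
\<open>t\<^sup>2 = (\<epsilon>/4) log d\<close>. Its coefficients with respect to the orthonormal basis of monomials have square sum
at most a constant times \<open>t\<^sup>2\<close>. Shifting the Gaussian measure by it therefore costs a factor of about
\<open>exp (- t\<^sup>2 - 4 t)\<close>, which is \<open>d\<close> to the power \<open>-\<epsilon>/4 - o(1)\<close>
(\<open>kostlan_cameron_martin\<close>, \<open>kostlan_window_probability\<close>). What remains is a centred Kostlan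
polynomial, the noise. With probability at least \<open>1/2\<close> none of its coefficients exceeds its standard
deviation by more than a factor that grows polynomially with the exponents, and then the noise at \<open>w\<close> is at most
\<open>C exp (1.05 \<bar>w\<bar>\<^sup>2 / 2)\<close> (\<open>noise_bound\<close>, \<open>weighted_exp_sum_bound\<close>). For \<open>\<bar>w\<bar>\<^sup>2 \<le> 0.9 log log d\<close> this is
\<open>C (log d)\<close> to the power \<open>0.4725\<close>, which is smaller than \<open>t\<close>. Hence the polynomial has the sign of the
barrier: negative for \<open>\<bar>w\<bar>\<^sup>2 \<le> 0.86 log log d\<close>, positive for \<open>\<bar>w\<bar>\<^sup>2 = 0.9 log log d\<close>.

A component of the zero set then separates the centre from the outer circle
(\<open>separating_zero_component\<close>). It meets two opposite radii outside the inner disk, so it contains two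
points at distance at least \<open>2 arctan (sqrt (0.86 log log d / d))\<close>, and the length of a connected set is
at least the distance between any two of its points (\<open>curve_length_ge_dist\<close>). This is enough because
\<open>\<pi>\<^sup>2 / 12 < 0.86\<close>.

The centre of the disk is arbitrary for the following reason. The covariance of a Kostlan
polynomial is a multiple of \<open>(X \<bullet> Y)\<^sup>d\<close>, which is invariant under rotations. Consequently the
coefficients of the rotated polynomial have the same second moments as the original ones
(\<open>orthogonal_coefficient_change\<close>), and Chebyshev's inequality asks for nothing else. The Gaussian
description itself rests on the orthogonality of the monomials and on their norms, which are
proportional to \<open>\<alpha>!\<close> (\<open>l2_inner_unit_coeff\<close>, \<open>kostlan_eq_PiM\<close>).\<close>

section \<open>Integrals of monomials over the affine chart\<close>

text \<open>Polar coordinates for radial integrands: the disk \<open>\<bar>z\<bar>\<^sup>2 \<le> x\<close> has area \<open>\<pi> x\<close>, so the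
squared modulus carries planar Lebesgue measure to \<open>\<pi>\<close> times the Lebesgue measure of the half-line.\<close>

lemma distr_cmod_power2:
  "distr lborel borel (\<lambda>z::complex. (cmod z)\<^sup>2)
      = density lborel (\<lambda>t. ennreal pi * indicator {0..} t)"
proof (rule measure_eqI_generator_eq[where E="range atMost" and \<Omega>=UNIV and A="\<lambda>n. {..real n}"])
  show "Int_stable (range atMost :: real set set)"
    by (auto simp: Int_stable_def)
  have *: "emeasure (distr lborel borel (\<lambda>z::complex. (cmod z)\<^sup>2)) {..x}
      = ennreal pi * ennreal (max 0 x)" for x
  proof (cases "x < 0")
    case True
    then have "(\<lambda>z::complex. (cmod z)\<^sup>2) -` {..x} = {}"
      by (auto simp: not_le) (meson not_le order_trans zero_le_power2)
    then show ?thesis using True by (simp add: emeasure_distr)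
  next
    case False
    have "(\<lambda>z::complex. (cmod z)\<^sup>2) -` {..x} = cball 0 (sqrt x)"
      using False by (auto simp: dist_norm real_le_rsqrt)
        (metis norm_ge_zero not_less real_sqrt_ge_0_iff real_sqrt_pow2 power_mono)
    then have "emeasure (distr lborel borel (\<lambda>z::complex. (cmod z)\<^sup>2)) {..x}
        = emeasure lborel (cball (0::complex) (sqrt x))"
      by (simp add: emeasure_distr)
    also have "\<dots> = ennreal (unit_ball_vol 2 * sqrt x ^ 2)"
      using False by (subst emeasure_cball) auto
    also have "\<dots> = ennreal pi * ennreal (max 0 x)"
      using False by (simp add: unit_ball_vol_2 ennreal_mult)
    finally show ?thesis .
  qed
  have **: "emeasure (density lborel (\<lambda>t. ennreal pi * indicator {0..} t)) {..x}
      = ennreal pi * ennreal (max 0 x)" for x :: real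
  proof -
    have "emeasure (density lborel (\<lambda>t. ennreal pi * indicator {0..} t)) {..x} =
       (\<integral>\<^sup>+t. ennreal pi * indicator {0..x} t \<partial>lborel)"
      by (subst emeasure_density) (auto intro!: nn_integral_cong split: split_indicator)
    also have "\<dots> = ennreal pi * ennreal (max 0 x)"
      by (subst nn_integral_cmult_indicator) (auto simp: emeasure_lborel_Icc_eq max_def)
    finally show ?thesis .
  qed
  show "emeasure (distr lborel borel (\<lambda>z::complex. (cmod z)\<^sup>2)) X
      = emeasure (density lborel (\<lambda>t. ennreal pi * indicator {0..} t)) X"
    if "X \<in> range atMost" for X
    using that by (auto simp: * ** )
  show "sets (distr lborel borel (\<lambda>z::complex. (cmod z)\<^sup>2)) = sigma_sets UNIV (range atMost)"
    by (simp add: borel_eq_atMost)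
  show "sets (density lborel (\<lambda>t. ennreal pi * indicator {0..} t))
      = sigma_sets UNIV (range (atMost :: real \<Rightarrow> _))"
    by (simp add: borel_eq_atMost)
  show "(\<Union>i. {..real i}) = UNIV"
    by (auto simp: real_arch_simple)
  show "emeasure (distr lborel borel (\<lambda>z::complex. (cmod z)\<^sup>2)) {..real i} \<noteq> \<infinity>" for i
    by (simp add: * ennreal_mult_eq_top_iff)
qed auto

lemma nn_integral_cmod_power2:
  assumes [measurable]: "F \<in> borel_measurable borel"
  shows "(\<integral>\<^sup>+z. F ((cmod z)\<^sup>2) \<partial>lborel) = ennreal pi * (\<integral>\<^sup>+t. F t * indicator {0..} t \<partial>lborel)"
proof -
  have "(\<integral>\<^sup>+z. F ((cmod z)\<^sup>2) \<partial>lborel) = (\<integral>\<^sup>+t. F t \<partial>distr lborel borel (\<lambda>z::complex. (cmod z)\<^sup>2))"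
    by (subst nn_integral_distr) auto
  also have "\<dots> = (\<integral>\<^sup>+t. ennreal pi * (F t * indicator {0..} t) \<partial>lborel)"
    unfolding distr_cmod_power2 by (subst nn_integral_density) (auto simp: mult_ac)
  finally show ?thesis by (simp add: nn_integral_cmult)
qed

text \<open>The Beta integral \<open>\<integral> t\<^sup>i / (A + t)\<^bsup>i+m+2\<^esup> dt\<close> over the half-line, in the form of an antiderivative
with known values at both ends. Differentiating \<open>t\<^bsup>i+1\<^esup> / (A + t)\<^bsup>i+m+2\<^esup>\<close> expresses the integrand
for \<open>i + 1\<close> through the one for \<open>i\<close>, and the boundary term vanishes at \<open>0\<close> and at infinity.\<close>

lemma beta_prime_antiderivative:
  fixes A :: real
  assumes "A > 0"
  shows "\<exists>F. (\<forall>t\<ge>0. (F has_field_derivative (t ^ i / (A + t) ^ (i + m + 2))) (at t)) \<and>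
            F 0 = - (fact i * fact m / (fact (i + m + 1) * A ^ (m + 1))) \<and> (F \<longlongrightarrow> 0) at_top"
proof (induction i)
  case 0
  let ?F = "\<lambda>t. - (1 / (real (m + 1) * (A + t) ^ (m + 1)))"
  have "(?F has_field_derivative (1 / (A + t) ^ (m + 2))) (at t)" if "t \<ge> 0" for t
  proof -
    have "A + t > 0" using that assms by auto
    then show ?thesis
      by (auto intro!: derivative_eq_intros simp: divide_simps simp del: power_Suc)
         (simp add: algebra_simps)?
  qed
  moreover have "(?F \<longlongrightarrow> 0) at_top"
    by real_asymp
  moreover have "?F 0 = - (fact 0 * fact m / (fact (0 + m + 1) * A ^ (m + 1)))"
  proof -
    have "fact (0 + m + 1) = real (m + 1) * fact m" by simp
    then show ?thesis by (simp del: of_nat_add power_Suc)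
  qed
  ultimately show ?case by (intro exI[of _ ?F]) auto
next
  case (Suc i)
  then obtain F where F: "\<And>t. t \<ge> 0 \<Longrightarrow> (F has_field_derivative (t ^ i / (A + t) ^ (i + m
      + 2))) (at t)"
    "F 0 = - (fact i * fact m / (fact (i + m + 1) * A ^ (m + 1)))" "(F \<longlongrightarrow> 0) at_top" by auto
  let ?G = "\<lambda>t. (real (i+1) * F t - t ^ (i+1) / (A + t) ^ (i + m + 2)) / real (i + m + 2)"
  have "(?G has_field_derivative (t ^ Suc i / (A + t) ^ (Suc i + m + 2))) (at t)" if "t \<ge> 0" for t
  proof -
    have p: "A + t > 0" using that assms by auto
    have 1: "((\<lambda>t. t ^ (i+1) / (A + t) ^ (i + m + 2)) has_field_derivative
       (real (i+1) * (t ^ i / (A + t) ^ (i + m + 2)) - real (i+m+2) * (t ^ Suc i / (A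
           + t) ^ (Suc i + m + 2)))) (at t)"
    proof -
      have d1: "((\<lambda>t. t ^ Suc i) has_field_derivative real (Suc i) * t ^ i) (at t)"
        using DERIV_pow[of "Suc i" t] by simp
      have d2: "((\<lambda>t. (A + t) ^ Suc (i+m+1)) has_field_derivative real (Suc (i+m+1))
          * (A + t) ^ (i+m+1)) (at t)"
      proof -
        have "((\<lambda>t. A + t) has_field_derivative 1) (at t)"
          by (auto intro!: derivative_eq_intros)
        from DERIV_power[OF this, of "Suc (i+m+1)"] show ?thesis
          by (simp del: power_Suc of_nat_Suc of_nat_add)
      qed
      define q where "q = (A + t) ^ (i + m + 1)"
      have q: "q > 0" using p by (simp add: q_def)
      have e: "(A + t) ^ (i + m + 2) = q * (A + t)" "(A + t) ^ (Suc i + m + 2)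
          = q * (A + t) * (A + t)"
        "(A + t) ^ Suc (i+m+1) = q * (A + t)"
        by (simp_all add: q_def)
      have "((\<lambda>t. t ^ Suc i / (A + t) ^ Suc (i+m+1)) has_field_derivative
          (real (Suc i) * t ^ i * (A + t) ^ Suc (i+m+1) - t ^ Suc i * (real (Suc (i+m+1)) * (A
              + t) ^ (i+m+1))) /
            ((A + t) ^ Suc (i+m+1) * (A + t) ^ Suc (i+m+1))) (at t)"
        using p by (intro DERIV_divide d1 d2) auto
      also have "(real (Suc i) * t ^ i * (A + t) ^ Suc (i+m+1) - t ^ Suc i
          * (real (Suc (i+m+1)) * (A + t) ^ (i+m+1))) /
            ((A + t) ^ Suc (i+m+1) * (A + t) ^ Suc (i+m+1)) =
          real (i+1) * (t ^ i / (A + t) ^ (i + m + 2)) - real (i+m+2) * (t ^ Suc i / (A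
              + t) ^ (Suc i + m + 2))"
      proof -
        have alg: "(a * u * (q * P) - v * (b * q)) / (q * P * (q * P))
            = a * (u / (q * P)) - b * (v / (q * P * P))"
          if "P > 0" for a b u v P
          using that q by (simp add: field_simps)
        show ?thesis unfolding e q_def[symmetric] using alg[OF p] by simp
      qed
      finally show ?thesis by simp
    qed
    have "(?G has_field_derivative ((real (i+1) * (t ^ i / (A + t) ^ (i + m + 2))
        - (real (i+1) * (t ^ i / (A + t) ^ (i + m + 2)) - real (i+m+2) * (t ^ Suc i / (A
        + t) ^ (Suc i + m + 2)))) / real (i+m+2))) (at t)"
      by (intro DERIV_cdivide DERIV_diff DERIV_cmult F 1 that)
    then show ?thesis by simp
  qed
  moreover have "(?G \<longlongrightarrow> 0) at_top"
  proof -
    have "((\<lambda>t. t ^ (i+1) / (A + t) ^ (i + m + 2)) \<longlongrightarrow> 0) at_top"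
    proof (rule tendsto_sandwich[of "\<lambda>_. 0" _ _ "\<lambda>t. 1 / t"])
      show "\<forall>\<^sub>F t in at_top. 0 \<le> t ^ (i+1) / (A + t) ^ (i + m + 2)"
        using eventually_ge_at_top[of 1] by eventually_elim (use assms in auto)
      show "\<forall>\<^sub>F t in at_top. t ^ (i+1) / (A + t) ^ (i + m + 2) \<le> 1 / t"
        using eventually_ge_at_top[of 1]
      proof eventually_elim
        case (elim t)
        have "t ^ (i + 2) \<le> (A + t) ^ (i + 2)" using elim assms by (intro power_mono) auto
        also have "\<dots> \<le> (A + t) ^ (i + m + 2)" using elim assms by (intro power_increasing) auto
        finally show ?case using elim assms by (simp add: divide_simps mult_ac)
      qed
      show "((\<lambda>t::real. 1 / t) \<longlongrightarrow> 0) at_top" by real_asymp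
    qed auto
    from tendsto_divide[OF tendsto_diff[OF tendsto_mult[OF tendsto_const F(3)] this]
        tendsto_const, of "real (i+m+2)" "real (i+1)"]
    show ?thesis by simp
  qed
  moreover have "?G 0 = - (fact (Suc i) * fact m / (fact (Suc i + m + 1) * A ^ (m + 1)))"
  proof -
    have *: "fact (Suc i) = real (i + 1) * fact i" "fact (Suc i + m + 1)
        = real (i + m + 2) * (fact (i + m + 1) :: real)"
      by (simp_all add: algebra_simps)
    show ?thesis unfolding * F(2) by (simp add: divide_simps del: fact_Suc of_nat_add)
  qed
  ultimately show ?case by (intro exI[of _ ?G]) blast
qed

lemma nn_integral_beta_prime:
  fixes A :: real
  assumes "A > 0"
  shows "(\<integral>\<^sup>+t. ennreal (t ^ i / (A + t) ^ (i + m + 2)) * indicator {0..} t \<partial>lborel) =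
    ennreal (fact i * fact m / fact (i + m + 1) / A ^ (m + 1))"
proof -
  obtain F where F: "\<And>t. t \<ge> 0 \<Longrightarrow> (F has_field_derivative (t ^ i / (A + t) ^ (i + m + 2))) (at t)"
    "F 0 = - (fact i * fact m / (fact (i + m + 1) * A ^ (m + 1)))" "(F \<longlongrightarrow> 0) at_top"
    using beta_prime_antiderivative[OF assms] by metis
  have "(\<integral>\<^sup>+t. ennreal (t ^ i / (A + t) ^ (i + m + 2)) * indicator {0..} t \<partial>lborel)
      = ennreal (0 - F 0)"
    using F assms by (intro nn_integral_FTC_atLeast) auto
  then show ?thesis using F(2) by simp
qed

text \<open>Each of the two complex variables enters through its squared modulus only, so this is an iterated
Beta integral, computed first in the second variable and then in the first.\<close>

lemma nn_integral_fs_monomial: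
  "(\<integral>\<^sup>+z. ennreal ((cmod (fst z))\<^sup>2 ^ i
      * (cmod (snd z))\<^sup>2 ^ j / (1 + (norm (z::complex \<times> complex))\<^sup>2) ^ (i + j + k + 3)) \<partial>lborel)
    = ennreal (pi\<^sup>2 * (fact i * fact j * fact k) / fact (i + j + k + 2))"
proof -
  have n: "1 + (norm (z::complex \<times> complex))\<^sup>2 = 1 + (cmod (fst z))\<^sup>2 + (cmod (snd z))\<^sup>2" for z
    by (simp add: norm_prod_def)
  define c where "c = fact j * fact (i+k+1) / (fact (i + j + k + 2) :: real)"
  have c0: "c \<ge> 0" by (simp add: c_def)
  have inner: "(\<integral>\<^sup>+w. ennreal ((cmod z)\<^sup>2 ^ i
      * (cmod w)\<^sup>2 ^ j / (1 + (cmod z)\<^sup>2 + (cmod w)\<^sup>2) ^ (i + j + k + 3)) \<partial>lborel)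
     = ennreal (pi * c) * ennreal ((cmod z)\<^sup>2 ^ i / (1 + (cmod z)\<^sup>2) ^ (i+k+2))" for z
  proof -
    let ?A = "1 + (cmod z)\<^sup>2"
    have e: "i + j + k + 3 = j + (i + k + 1) + 2" by simp
    have "(\<integral>\<^sup>+w. ennreal ((cmod z)\<^sup>2 ^ i
        * (cmod w)\<^sup>2 ^ j / (?A + (cmod w)\<^sup>2) ^ (i + j + k + 3)) \<partial>lborel)
      = ennreal pi * (\<integral>\<^sup>+t. ennreal ((cmod z)\<^sup>2 ^ i * t ^ j / (?A + t) ^ (i + j + k + 3))
          * indicator {0..} t \<partial>lborel)"
      by (rule nn_integral_cmod_power2) measurable
    also have "(\<integral>\<^sup>+t. ennreal ((cmod z)\<^sup>2 ^ i * t ^ j / (?A + t) ^ (i + j + k + 3))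
        * indicator {0..} t \<partial>lborel)
       = (\<integral>\<^sup>+t. ennreal ((cmod z)\<^sup>2 ^ i) * (ennreal (t ^ j / (?A + t) ^ (j + (i + k + 1) + 2))
           * indicator {0..} t) \<partial>lborel)"
      unfolding e by (rule nn_integral_cong) (simp add: ennreal_mult'[symmetric] del: power_Suc
          split: split_indicator)
    also have "\<dots> = ennreal ((cmod z)\<^sup>2 ^ i)
        * ennreal (fact j * fact (i+k+1) / fact (j + (i+k+1) + 1) / ?A ^ (i+k+1+1))"
      by (subst nn_integral_cmult, measurable, subst nn_integral_beta_prime) (auto intro:
          add_pos_nonneg)
    also have "ennreal pi * \<dots> = ennreal (pi * c) * ennreal ((cmod z)\<^sup>2 ^ i / ?A ^ (i+k+2))"
      by (simp add: ennreal_mult'[symmetric] ennreal_mult''[symmetric] c_def add_ac numeral_3_eq_3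
          del: fact_Suc)
    finally show ?thesis .
  qed
  have "(\<integral>\<^sup>+z. ennreal ((cmod (fst z))\<^sup>2 ^ i
      * (cmod (snd z))\<^sup>2 ^ j / (1 + (norm (z::complex \<times> complex))\<^sup>2) ^ (i + j + k + 3)) \<partial>lborel)
     = (\<integral>\<^sup>+z. \<integral>\<^sup>+w. ennreal ((cmod z)\<^sup>2 ^ i * (cmod w)\<^sup>2 ^ j / (1 + (cmod z)\<^sup>2 + (cmod w)\<^sup>2) ^ (i
         + j + k + 3)) \<partial>lborel \<partial>lborel)"
    unfolding n lborel_prod[symmetric]
        by (subst lborel.nn_integral_fst[symmetric]) (auto simp: split_beta')
  also have "\<dots> = (\<integral>\<^sup>+z. ennreal (pi * c)
      * ennreal ((cmod z)\<^sup>2 ^ i / (1 + (cmod z)\<^sup>2) ^ (i+k+2)) \<partial>lborel)"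
    by (simp only: inner)
  also have "\<dots> = ennreal (pi * c) * (\<integral>\<^sup>+z. ennreal ((cmod z)\<^sup>2 ^ i / (1
      + (cmod z)\<^sup>2) ^ (i+k+2)) \<partial>lborel)"
    by (rule nn_integral_cmult) measurable
  also have "(\<integral>\<^sup>+z. ennreal ((cmod z)\<^sup>2 ^ i / (1 + (cmod z)\<^sup>2) ^ (i+k+2)) \<partial>lborel)
     = ennreal pi * ennreal (fact i * fact k / fact (i + k + 1) / 1 ^ (k+1))"
    by (subst nn_integral_cmod_power2, measurable, subst nn_integral_beta_prime) auto
  also have "ennreal (pi * c) * \<dots> = ennreal (pi\<^sup>2
      * (fact i * fact j * fact k) / fact (i + j + k + 2))"
    using c0 by (simp add: ennreal_mult'[symmetric] ennreal_mult''[symmetric] c_def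
        power2_eq_square field_simps del: fact_Suc)
  finally show ?thesis .
qed

text \<open>Rotation invariance of Lebesgue measure on \<open>\<complex>\<close> is what makes distinct monomials orthogonal. It is
derived from the invariance of the Lebesgue measure of sets in \<open>\<real>\<^sup>n\<close> under orthogonal maps.\<close>

lemma orthogonal_transformation_distr_lborel:
  fixes f :: "real ^ 'n::{finite,wellorder} \<Rightarrow> real ^ 'n::{finite,wellorder}"
  assumes f: "orthogonal_transformation f"
  shows "distr lborel borel f = lborel"
proof (rule lborel_eqI[symmetric])
  fix l u :: "real ^ 'n::{finite,wellorder}" assume lu: "\<And>b. b \<in> Basis \<Longrightarrow> l \<bullet> b \<le> u \<bullet> b"
  have [measurable]: "f \<in> borel_measurable borel"
    using f by (intro borel_measurable_continuous_onI linear_continuous_on)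
      (simp add: orthogonal_transformation_def linear_conv_bounded_linear)
  define g where "g = inv f"
  have g: "orthogonal_transformation g"
    unfolding g_def by (rule orthogonal_transformation_inv[OF f])
  have bij: "bij f" using f by (rule orthogonal_transformation_bij)
  have "emeasure (distr lborel borel f) (box l u) = emeasure lborel (f -` box l u)"
    by (subst emeasure_distr) auto
  also have "f -` box l u = g ` box l u"
    unfolding g_def using bij by (simp add: bij_vimage_eq_inv_image)
  also have "emeasure lborel (g ` box l u) = emeasure lebesgue (g ` box l u)"
  proof -
    have "g ` box l u \<in> sets borel"
      unfolding \<open>f -` box l u = g ` box l u\<close>[symmetric]
      by (rule measurable_sets_borel[of f borel]) auto
    then show ?thesis by (simp add: emeasure_completion)
  qed
  also have "\<dots> = ennreal (measure lebesgue (g ` box l u))"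
    by (intro emeasure_eq_measure2 fmeasurableD2 measurable_orthogonal_image g) auto
  also have "\<dots> = ennreal (measure lebesgue (box l u))"
    using measure_orthogonal_image[OF g, of "box l u"] by simp
  also have "\<dots> = (\<Prod>b\<in>Basis. (u - l) \<bullet> b)"
    using lu by simp
  finally show "emeasure (distr lborel borel f) (box l u) = ennreal (\<Prod>b\<in>Basis. (u - l) \<bullet> b)" .
qed simp

lemma lborel_complex_eq_distr:
  "lborel = distr lborel borel (\<lambda>x::real^2. Complex (x $ 1) (x $ 2))"
proof (rule lborel_eqI)
  fix l u :: complex assume lu: "\<And>b. b \<in> Basis \<Longrightarrow> l \<bullet> b \<le> u \<bullet> b"
  have lu': "Re l \<le> Re u" "Im l \<le> Im u" using lu[of 1] lu[of \<i>] by (auto simp: Basis_complex_def)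
  have [measurable]: "(\<lambda>x::real^2. Complex (x $ 1) (x $ 2)) \<in> borel_measurable borel"
    by (intro borel_measurable_continuous_onI continuous_intros)
  let ?l = "vector [Re l, Im l] :: real^2" and ?u = "vector [Re u, Im u] :: real^2"
  have "(\<lambda>x::real^2. Complex (x $ 1) (x $ 2)) -` box l u = box ?l ?u"
    by (auto simp: in_box_complex_iff mem_box_cart forall_2)
  then have "emeasure (distr lborel borel (\<lambda>x::real^2. Complex (x $ 1) (x $ 2))) (box l u)
      = emeasure lborel (box ?l ?u)"
    by (subst emeasure_distr) auto
  also have "\<dots> = ennreal (\<Prod>b\<in>Basis. (?u - ?l) \<bullet> b)"
    using lu' by (intro emeasure_lborel_box) (auto simp: Basis_vec_def UNIV_2
        cart_eq_inner_axis[symmetric])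
  also have "(\<Prod>b\<in>Basis. (?u - ?l) \<bullet> b) = (Re u - Re l) * (Im u - Im l)"
    by (simp add: Basis_vec_def UNIV_2 cart_eq_inner_axis[symmetric] axis_eq_axis)
  also have "\<dots> = (\<Prod>b\<in>Basis. (u - l) \<bullet> b)"
    by (simp add: Basis_complex_def)
  finally show "emeasure (distr lborel borel (\<lambda>x::real^2. Complex (x $ 1) (x $ 2))) (box l u)
      = ennreal (\<Prod>b\<in>Basis. (u - l) \<bullet> b)" .
qed simp

lemma lborel_distr_rotate:
  fixes c :: complex
  assumes c: "cmod c = 1"
  shows "distr lborel borel (\<lambda>z. c * z) = lborel"
proof -
  let ?\<phi> = "\<lambda>x::real^2. Complex (x $ 1) (x $ 2)"
  define \<rho> where "\<rho> = (\<lambda>x::real^2. (vector [Re (c * ?\<phi> x), Im (c * ?\<phi> x)] :: real^2))"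
  have n: "norm x = cmod (?\<phi> x)" for x :: "real^2"
    by (simp add: norm_vec_def L2_set_def UNIV_2 cmod_def)
  have lin: "linear \<rho>"
    by (rule linearI) (auto simp: \<rho>_def vec_eq_iff forall_2 algebra_simps)
  have phi: "?\<phi> (\<rho> x) = c * ?\<phi> x" for x
    by (auto simp: \<rho>_def complex_eq_iff)
  have orth: "orthogonal_transformation \<rho>"
    unfolding orthogonal_transformation using lin
        by (auto simp: n phi norm_mult c simp del: complex_mult_cnj)
  have [measurable]: "\<rho> \<in> borel_measurable borel"
    using lin by (intro borel_measurable_continuous_onI linear_continuous_on) (simp add:
        linear_conv_bounded_linear)
  have [measurable]: "?\<phi> \<in> borel_measurable borel"
    by (intro borel_measurable_continuous_onI continuous_intros)
  have "distr lborel borel (\<lambda>z. c * z) = distr (distr lborel borel ?\<phi>) borel (\<lambda>z. c * z)"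
    using lborel_complex_eq_distr by simp
  also have "\<dots> = distr lborel borel (\<lambda>x. c * ?\<phi> x)"
    by (subst distr_distr) (auto simp: o_def)
  also have "\<dots> = distr (distr lborel borel \<rho>) borel ?\<phi>"
    by (subst distr_distr) (auto simp: o_def phi)
  also have "\<dots> = lborel"
    by (subst orthogonal_transformation_distr_lborel[OF orth]) (rule
        lborel_complex_eq_distr[symmetric])
  finally show ?thesis .
qed

lemma lborel_distr_rotate_prod:
  fixes b c :: complex
  assumes b: "cmod b = 1" and c: "cmod c = 1"
  shows "distr lborel borel (\<lambda>z. (b * fst z, c * snd z)) = (lborel :: (complex \<times> complex) measure)"
proof -
  have "(lborel :: (complex \<times> complex) measure)
      = distr lborel borel (\<lambda>z. b * z) \<Otimes>\<^sub>M distr lborel borel (\<lambda>z. c * z)"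
    by (simp add: lborel_distr_rotate b c lborel_prod)
  also have "\<dots> = distr (lborel \<Otimes>\<^sub>M lborel) (borel \<Otimes>\<^sub>M borel) (\<lambda>(x, y). (b * x, c * y))"
    by (rule pair_measure_distr) (auto simp: lborel_distr_rotate c
        lborel.sigma_finite_measure_axioms)
  also have "\<dots> = distr lborel borel (\<lambda>z. (b * fst z, c * snd z))"
    by (simp add: lborel_prod borel_prod split_beta')
  finally show ?thesis by simp
qed

section \<open>The norm of a polynomial in terms of its coefficients\<close>

text \<open>The squared \<open>L\<^sup>2\<close>-norm of a monomial.\<close>

definition fs_weight :: "nat \<Rightarrow> nat^3 \<Rightarrow> real" where
  "fs_weight d \<alpha> = 2 * (\<Prod>i\<in>UNIV. fact (\<alpha> $ i)) / fact (d + 2)"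

lemma prod_UNIV_3: "(\<Prod>i\<in>(UNIV::3 set). f i) = f 1 * f 2 * (f 3 :: 'a::comm_monoid_mult)"
  unfolding UNIV_3 by (simp add: mult.assoc)

lemma monomial_chart: "monomial \<alpha> (chart z) = fst z ^ (\<alpha> $ 2) * snd z ^ (\<alpha> $ 3)"
  unfolding monomial_def chart_def prod_UNIV_3 vector_3 by simp

lemma norm_chart: "(norm (chart z))\<^sup>2 = 1 + (norm z)\<^sup>2"
  unfolding chart_def norm_vec_def L2_set_def sum_3 vector_3 by (simp add: norm_prod_def)

lemma norm_chart_power: "norm (chart z) ^ (2 * d) = (1 + (norm z)\<^sup>2) ^ d"
  by (simp add: power_mult norm_chart)

lemma hpoly_unit_coeff: "\<alpha> \<in> exponents d \<Longrightarrow> hpoly d (unit_coeff \<alpha>) X = monomial \<alpha> X"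
proof -
  assume a: "\<alpha> \<in> exponents d"
  have "hpoly d (unit_coeff \<alpha>) X = (\<Sum>\<beta>\<in>exponents d. if \<beta> = \<alpha> then monomial \<beta> X else 0)"
    unfolding hpoly_def unit_coeff_def by (intro sum.cong) auto
  also have "\<dots> = monomial \<alpha> X" using a by (simp add: sum.delta)
  finally show ?thesis .
qed


text \<open>The integrand, with respect to Lebesgue measure, of the Hermitian inner product of two monomials. The
exponent \<open>d + 3\<close> collects \<open>d\<close> from the pointwise norm and \<open>3\<close> from the volume form.\<close>

definition moment :: "nat \<Rightarrow> nat^3 \<Rightarrow> nat^3 \<Rightarrow> complex \<times> complex \<Rightarrow> complex" where
  "moment d \<alpha> \<beta> z = monomial \<alpha> (chart z)
      * cnj (monomial \<beta> (chart z)) / of_real ((1 + (norm z)\<^sup>2) ^ (d + 3))"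

lemma Re_moment:
  "Re (moment d \<alpha> \<beta> z) =
     Re (monomial \<alpha> (chart z) * cnj (monomial \<beta> (chart z))) / (1 + (norm z)\<^sup>2) ^ d / (1
         + (norm z)\<^sup>2) ^ 3"
  unfolding moment_def Re_divide_of_real power_add by simp

lemma one_plus_norm_pos [simp]: "1 + (norm (z::'a::real_normed_vector))\<^sup>2 > 0"
  by (rule add_pos_nonneg) auto

lemma one_plus_norm_neq_0 [simp]: "1 + (norm (z::'a::real_normed_vector))\<^sup>2 \<noteq> 0"
  using one_plus_norm_pos[of z] by linarith

lemma moment_measurable [measurable]: "moment d \<alpha> \<beta> \<in> borel_measurable borel"
  unfolding moment_def[abs_def] monomial_chart
  by (intro borel_measurable_continuous_onI continuous_intros) (simp del: of_real_power of_real_add)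

lemma moment_diag:
  assumes "\<alpha> \<in> exponents d"
  shows "has_bochner_integral lborel (moment d \<alpha> \<alpha>) (of_real (pi\<^sup>2 / 2 * fs_weight d \<alpha>))"
proof -
  obtain i j k where ijk: "\<alpha> $ 1 = k" "\<alpha> $ 2 = i" "\<alpha> $ 3 = j" by auto
  have d: "i + j + k = d" using assms ijk by (simp add: exponents_def sum_3)
  let ?f = "\<lambda>z::complex\<times>complex. (cmod (fst z))\<^sup>2 ^ i
      * (cmod (snd z))\<^sup>2 ^ j / (1 + (norm z)\<^sup>2) ^ (i + j + k + 3)"
  have e: "moment d \<alpha> \<alpha> z = of_real (?f z)" for z
    unfolding moment_def monomial_chart complex_norm_square[symmetric] ijk d
    by (simp add: norm_mult norm_power power2_eq_square power_mult_distrib)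
  have [measurable]: "?f \<in> borel_measurable borel"
    by (intro borel_measurable_continuous_onI continuous_intros) simp
  have "has_bochner_integral lborel ?f (pi\<^sup>2 * (fact i * fact j * fact k) / fact (i + j + k + 2))"
    by (intro has_bochner_integral_nn_integral nn_integral_fs_monomial) auto
  then have "has_bochner_integral lborel (\<lambda>z. complex_of_real (?f z)) (of_real (pi\<^sup>2
      * (fact i * fact j * fact k) / fact (i + j + k + 2)))"
    by (rule has_bochner_integral_of_real)
  moreover have "pi\<^sup>2 * (fact i * fact j * fact k) / fact (i + j + k + 2)
      = pi\<^sup>2 / 2 * fs_weight d \<alpha>"
    by (simp add: fs_weight_def prod_UNIV_3 ijk d mult_ac)
  ultimately show ?thesis by (simp only: e[abs_def])
qed

lemma Re_integral_moment_diag: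
  "\<alpha> \<in> exponents d \<Longrightarrow> Re (integral\<^sup>L lborel (moment d \<alpha> \<alpha>)) = pi\<^sup>2 / 2 * fs_weight d \<alpha>"
  by (simp only: has_bochner_integral_integral_eq[OF moment_diag] Re_complex_of_real)

lemma moment_integrable:
  assumes "\<alpha> \<in> exponents d" "\<beta> \<in> exponents d"
  shows "integrable lborel (moment d \<alpha> \<beta>)"
proof (rule Bochner_Integration.integrable_bound)
  show "integrable lborel (\<lambda>z. moment d \<alpha> \<alpha> z + moment d \<beta> \<beta> z)"
    using moment_diag[OF assms(1)] moment_diag[OF assms(2)] by (auto simp: has_bochner_integral_iff)
  have *: "cmod (x * cnj y / of_real c) \<le> cmod (x * cnj x / of_real c + y * cnj y / of_real c)" if
      "c > 0" for x y and c :: real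
  proof -
    have "cmod x * cmod y \<le> (cmod x)\<^sup>2 + (cmod y)\<^sup>2"
      using sum_squares_bound[of "cmod x"
          "cmod y"] mult_nonneg_nonneg[OF norm_ge_zero[of x] norm_ge_zero[of y]]
      unfolding mult.assoc by linarith
    moreover have "x * cnj x / of_real c + y * cnj y / of_real c
        = of_real (((cmod x)\<^sup>2 + (cmod y)\<^sup>2) / c)"
      by (simp add: complex_norm_square[symmetric] add_divide_distrib)
    ultimately show ?thesis using that
      by (simp add: norm_divide norm_mult divide_right_mono del: of_real_add of_real_divide
          of_real_power)
  qed
  show "AE z in lborel. norm (moment d \<alpha> \<beta> z) \<le> norm (moment d \<alpha> \<alpha> z + moment d \<beta> \<beta> z)"
    unfolding moment_def by (intro AE_I2 * zero_less_power one_plus_norm_pos)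
qed simp

lemma exponents_neqD:
  assumes "\<alpha> \<in> exponents d" "\<beta> \<in> exponents d" "\<alpha> \<noteq> \<beta>"
  shows "\<alpha> $ 2 \<noteq> \<beta> $ 2 \<or> \<alpha> $ 3 \<noteq> \<beta> $ 3"
  using assms by (auto simp: exponents_def vec_eq_iff forall_3 sum_3)

lemma cis_rotation:
  assumes "a \<noteq> (b::nat)"
  shows "\<exists>c. cmod c = 1 \<and> c ^ a * cnj c ^ b = -1"
proof -
  define x where "x = pi / (real a - real b)"
  have "cis x ^ a * cnj (cis x) ^ b = cis (real a * x) * cis (- (real b * x))"
    using Complex.DeMoivre[of x a] Complex.DeMoivre[of "- x" b]
        by (simp only: cis_cnj minus_mult_right)
  also have "\<dots> = cis ((real a - real b) * x)"
    by (simp add: cis_mult algebra_simps)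
  also have "(real a - real b) * x = pi" using assms by (simp add: x_def)
  finally show ?thesis by (intro exI[of _ "cis x"]) auto
qed

text \<open>Two different exponent vectors of the same degree differ in one of the affine coordinates. A suitable
rotation of that coordinate changes the sign of the integrand, so the integral equals its own negative.\<close>

lemma moment_off_diag:
  assumes "\<alpha> \<in> exponents d" "\<beta> \<in> exponents d" "\<alpha> \<noteq> \<beta>"
  shows "integral\<^sup>L lborel (moment d \<alpha> \<beta>) = 0"
proof -
  have "\<exists>b c. cmod b = 1 \<and> cmod c = 1
      \<and> (b ^ (\<alpha> $ 2) * cnj b ^ (\<beta> $ 2)) * (c ^ (\<alpha> $ 3) * cnj c ^ (\<beta> $ 3)) = -1"
  proof (cases "\<alpha> $ 2 = \<beta> $ 2")
    case False
    then obtain b where "cmod b = 1" "b ^ (\<alpha> $ 2) * cnj b ^ (\<beta> $ 2) = -1" using cis_rotation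
        by blast
    then show ?thesis by (intro exI[of _ b] exI[of _ 1]) auto
  next
    case True
    then have "\<alpha> $ 3 \<noteq> \<beta> $ 3" using exponents_neqD[OF assms] by simp
    then obtain c where "cmod c = 1" "c ^ (\<alpha> $ 3) * cnj c ^ (\<beta> $ 3) = -1" using cis_rotation
        by blast
    then show ?thesis by (intro exI[of _ 1] exI[of _ c]) auto
  qed
  then obtain b c where bc: "cmod b = 1" "cmod c = 1"
    "(b ^ (\<alpha> $ 2) * cnj b ^ (\<beta> $ 2)) * (c ^ (\<alpha> $ 3) * cnj c ^ (\<beta> $ 3)) = -1" by blast
  have n: "norm (b * fst z, c * snd z) = norm z" for z
    by (simp add: norm_prod_def norm_mult bc)
  have eq: "moment d \<alpha> \<beta> (b * fst z, c * snd z) = - moment d \<alpha> \<beta> z" for z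
  proof -
    have "moment d \<alpha> \<beta> (b * fst z, c * snd z) =
      ((b ^ (\<alpha> $ 2) * cnj b ^ (\<beta> $ 2)) * (c ^ (\<alpha> $ 3) * cnj c ^ (\<beta> $ 3))) * moment d \<alpha> \<beta> z"
      unfolding moment_def n monomial_chart by (simp add: power_mult_distrib mult_ac)
    then show ?thesis by (simp add: bc)
  qed
  have "integral\<^sup>L lborel (moment d \<alpha> \<beta>)
      = integral\<^sup>L (distr lborel borel (\<lambda>z. (b * fst z, c * snd z))) (moment d \<alpha> \<beta>)"
    by (simp add: lborel_distr_rotate_prod bc)
  also have "\<dots> = - integral\<^sup>L lborel (moment d \<alpha> \<beta>)"
    by (subst integral_distr) (auto simp: eq intro!: borel_measurable_continuous_onI
        continuous_intros)
  finally show ?thesis by simp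
qed

lemma integral_fs_measure:
  fixes f :: "complex \<times> complex \<Rightarrow> real"
  assumes [measurable]: "f \<in> borel_measurable borel"
  shows "integral\<^sup>L fs_measure f = (LINT z|lborel. f z / (1 + (norm z)\<^sup>2) ^ 3)"
  unfolding fs_measure_def
  by (subst integral_real_density) (auto simp: less_imp_le)

lemma fs_volume_eq: "fs_volume = pi\<^sup>2 / 2"
proof -
  have "emeasure fs_measure UNIV = (\<integral>\<^sup>+z. ennreal (1 / (1
      + (norm (z::complex\<times>complex))\<^sup>2) ^ 3) \<partial>lborel)"
    unfolding fs_measure_def by (subst emeasure_density) auto
  also have "\<dots> = ennreal (pi\<^sup>2 / 2)"
    using nn_integral_fs_monomial[of 0 0 0] by simp
  finally show ?thesis by (simp add: fs_volume_def measure_def)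
qed

lemma l2_inner_unit_coeff:
  assumes "\<alpha> \<in> exponents d" "\<beta> \<in> exponents d"
  shows "l2_inner d (unit_coeff \<alpha>) (unit_coeff \<beta>) = (if \<alpha> = \<beta> then fs_weight d \<alpha> else 0)"
proof -
  have m: "(\<lambda>z. Re (hpoly d (unit_coeff \<alpha>) (chart z)
      * cnj (hpoly d (unit_coeff \<beta>) (chart z))) / norm (chart z) ^ (2 * d))
      \<in> borel_measurable borel"
    unfolding hpoly_unit_coeff[OF assms(1)] hpoly_unit_coeff[OF assms(2)] norm_chart_power
        monomial_chart
    by (intro borel_measurable_continuous_onI continuous_intros) simp
  have "l2_inner d (unit_coeff \<alpha>) (unit_coeff \<beta>) = 2 / pi\<^sup>2 * (LINT z|lborel. Re (moment d \<alpha> \<beta> z))"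
    unfolding l2_inner_def fs_volume_eq integral_fs_measure[OF m]
    by (simp only: hpoly_unit_coeff[OF assms(1)] hpoly_unit_coeff[OF assms(2)] norm_chart_power
        Re_moment) simp
  also have "(LINT z|lborel. Re (moment d \<alpha> \<beta> z)) = Re (integral\<^sup>L lborel (moment d \<alpha> \<beta>))"
    using moment_integrable[OF assms] by simp
  also have "\<dots> = (if \<alpha> = \<beta> then pi\<^sup>2 / 2 * fs_weight d \<alpha> else 0)"
    using Re_integral_moment_diag[OF assms(1)] moment_off_diag[OF assms] by auto
  finally show ?thesis by (auto simp: divide_simps)
qed

lemma hpoly_complexify_norm:
  "(cmod (hpoly d (complexify a) X))\<^sup>2
      = (\<Sum>\<alpha>\<in>exponents d. \<Sum>\<beta>\<in>exponents d. a \<alpha> * a \<beta> * Re (monomial \<alpha> X * cnj (monomial \<beta> X)))"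
proof -
  have "complex_of_real ((cmod (hpoly d (complexify a) X))\<^sup>2)
      = (\<Sum>\<alpha>\<in>exponents d. \<Sum>\<beta>\<in>exponents d. of_real (a \<alpha> * a \<beta>) * (monomial \<alpha> X * cnj (monomial \<beta> X)))"
    unfolding complex_norm_square hpoly_def cnj_sum sum_product complexify_def
    by (intro sum.cong refl) simp
  then have "Re (complex_of_real ((cmod (hpoly d (complexify a) X))\<^sup>2))
      = Re (\<Sum>\<alpha>\<in>exponents d. \<Sum>\<beta>\<in>exponents d. of_real (a \<alpha> * a \<beta>) * (monomial \<alpha> X
      * cnj (monomial \<beta> X)))"
    by simp
  then show ?thesis unfolding Re_sum Re_complex_of_real by simp
qed

lemma l2_norm_sq_complexify:
  "l2_norm_sq d (complexify a) = (\<Sum>\<alpha>\<in>exponents d. fs_weight d \<alpha> * (a \<alpha>)\<^sup>2)"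
proof -
  have m: "(\<lambda>z. fs_norm_sq d (complexify a) (chart z)) \<in> borel_measurable borel"
    unfolding fs_norm_sq_def hpoly_def monomial_chart norm_chart_power
    by (intro borel_measurable_continuous_onI continuous_intros) simp
  have "l2_norm_sq d (complexify a) = 2 / pi\<^sup>2
      * (LINT z|lborel. (\<Sum>\<alpha>\<in>exponents d. \<Sum>\<beta>\<in>exponents d. a \<alpha> * a \<beta> * Re (moment d \<alpha> \<beta> z)))"
    unfolding l2_norm_sq_def fs_volume_eq integral_fs_measure[OF m]
    unfolding fs_norm_sq_def norm_chart_power hpoly_complexify_norm
    by (simp only: Re_moment sum_divide_distrib times_divide_eq_right) simp
  also have "(LINT z|lborel. (\<Sum>\<alpha>\<in>exponents d. \<Sum>\<beta>\<in>exponents d. a \<alpha> * a \<beta> * Re (moment d \<alpha> \<beta> z)))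
     = (\<Sum>\<alpha>\<in>exponents d. \<Sum>\<beta>\<in>exponents d. a \<alpha> * a \<beta> * Re (integral\<^sup>L lborel (moment d \<alpha> \<beta>)))"
    by (simp add: moment_integrable)
  also have "\<dots> = (\<Sum>\<alpha>\<in>exponents d. \<Sum>\<beta>\<in>exponents d. (if \<alpha>
      = \<beta> then pi\<^sup>2 / 2 * fs_weight d \<alpha> * (a \<alpha>)\<^sup>2 else 0))"
  proof (intro sum.cong refl)
    fix \<alpha> \<beta> assume "\<alpha> \<in> exponents d" "\<beta> \<in> exponents d"
    then show "a \<alpha> * a \<beta> * Re (integral\<^sup>L lborel (moment d \<alpha> \<beta>))
        = (if \<alpha> = \<beta> then pi\<^sup>2 / 2 * fs_weight d \<alpha> * (a \<alpha>)\<^sup>2 else 0)"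
      using Re_integral_moment_diag[of \<alpha> d] moment_off_diag[of \<alpha> d \<beta>]
          by (auto simp: power2_eq_square)
  qed
  also have "\<dots> = (\<Sum>\<alpha>\<in>exponents d. pi\<^sup>2 / 2 * fs_weight d \<alpha> * (a \<alpha>)\<^sup>2)"
    by (simp add: sum.delta)
  finally show ?thesis by (simp add: sum_distrib_left divide_simps mult_ac)
qed

lemma fs_weight_pos: "fs_weight d \<alpha> > 0"
  by (simp add: fs_weight_def prod_pos)

text \<open>The monomials are orthogonal, so only the identity contributes to the Leibniz formula.\<close>

lemma gram_det_eq: "gram_det d = (\<Prod>\<alpha>\<in>exponents d. fs_weight d \<alpha>)"
proof -
  have "gram_det d = (\<Sum>p\<in>{id}. of_int (sign p) *
        (\<Prod>\<alpha>\<in>exponents d. l2_inner d (unit_coeff \<alpha>) (unit_coeff (p \<alpha>))))"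
    unfolding gram_det_def
  proof (rule sum.mono_neutral_right)
    show "finite {p. p permutes exponents d}" by (simp add: finite_permutations)
    show "{id} \<subseteq> {p. p permutes exponents d}" by (simp add: permutes_id)
    show "\<forall>p\<in>{p. p permutes exponents d} - {id}. of_int (sign p) *
        (\<Prod>\<alpha>\<in>exponents d. l2_inner d (unit_coeff \<alpha>) (unit_coeff (p \<alpha>))) = 0"
    proof
      fix p assume p: "p \<in> {p. p permutes exponents d} - {id}"
      then obtain \<alpha> where a: "p \<alpha> \<noteq> \<alpha>" by (auto simp: fun_eq_iff)
      with p have "\<alpha> \<in> exponents d" using permutes_not_in by fastforce
      moreover from this have "p \<alpha> \<in> exponents d" using p by (simp add: permutes_in_image)
      ultimately have "l2_inner d (unit_coeff \<alpha>) (unit_coeff (p \<alpha>)) = 0"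
        using a by (simp add: l2_inner_unit_coeff)
      with \<open>\<alpha> \<in> exponents d\<close> have "(\<Prod>\<alpha>\<in>exponents d. l2_inner d (unit_coeff \<alpha>) (unit_coeff (p \<alpha>)))
          = 0"
        by (intro prod_zero) auto
      then show "of_int (sign p) *
        (\<Prod>\<alpha>\<in>exponents d. l2_inner d (unit_coeff \<alpha>) (unit_coeff (p \<alpha>))) = 0" by simp
    qed
  qed
  then show ?thesis by (simp add: l2_inner_unit_coeff)
qed

section \<open>Kostlan polynomials have independent Gaussian coefficients\<close>

text \<open>Used for \<open>i + j \<le> d\<close> only, where the subtraction does not truncate.\<close>

definition expo :: "nat \<Rightarrow> nat \<Rightarrow> nat \<Rightarrow> nat^3" where
  "expo d i j = vector [d - i - j, i, j]"

lemma expo_nth [simp]: "expo d i j $ 1 = d - i - j" "expo d i j $ 2 = i" "expo d i j $ 3 = j"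
  by (simp_all only: expo_def vector_3)

text \<open>Sums over exponent vectors become double sums over the exponents of the two affine coordinates.\<close>

lemma bij_betw_expo:
  "bij_betw (\<lambda>(i,j). expo d i j) (SIGMA i:{..d}. {..d - i}) (exponents d)"
proof (rule bij_betwI[where g="\<lambda>\<alpha>. (\<alpha> $ 2, \<alpha> $ 3)"])
  show "(\<lambda>(i,j). expo d i j) \<in> (SIGMA i:{..d}. {..d - i}) \<rightarrow> exponents d"
    by (auto simp: exponents_def sum_3)
  show "(\<lambda>\<alpha>. (\<alpha> $ 2, \<alpha> $ 3)) \<in> exponents d \<rightarrow> (SIGMA i:{..d}. {..d - i})"
    by (auto simp: exponents_def sum_3)
  show "(case (\<alpha> $ 2, \<alpha> $ 3) of (i, j) \<Rightarrow> expo d i j) = \<alpha>" if "\<alpha> \<in> exponents d" for \<alpha>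
    using that by (auto simp: exponents_def sum_3 vec_eq_iff forall_3)
qed (auto simp del: One_nat_def)

lemma card_exponents: "card (exponents d) = (d + 2) choose 2"
proof -
  have "card (exponents d) = card (SIGMA i:{..d}. {..d - i})"
    using bij_betw_same_card[OF bij_betw_expo] by simp
  also have "\<dots> = (\<Sum>i\<le>d. d - i + 1)" by simp
  also have "\<dots> = (\<Sum>i\<le>d. i + 1)"
    by (rule sum.reindex_bij_witness[where i="\<lambda>i. d - i" and j="\<lambda>i. d - i"]) auto
  also have "\<dots> = (d + 2) choose 2"
    by (induction d) (simp_all add: numeral_2_eq_2)
  finally show ?thesis .
qed

definition coeff_sd :: "nat \<Rightarrow> nat^3 \<Rightarrow> real" where
  "coeff_sd d \<alpha> = 1 / sqrt (2 * fs_weight d \<alpha>)"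

definition coeff_measure :: "nat \<Rightarrow> nat^3 \<Rightarrow> real measure" where
  "coeff_measure d \<alpha> = density lborel (normal_density 0 (coeff_sd d \<alpha>))"

lemma coeff_sd_pos: "coeff_sd d \<alpha> > 0"
  by (simp add: coeff_sd_def fs_weight_pos)

lemma coeff_sd_power2: "(coeff_sd d \<alpha>)\<^sup>2 = 1 / (2 * fs_weight d \<alpha>)"
  using fs_weight_pos[of d \<alpha>] by (simp add: coeff_sd_def power_divide)

lemma normal_density_coeff_sd:
  "normal_density 0 (coeff_sd d \<alpha>) x = sqrt (fs_weight d \<alpha> / pi) * exp (- fs_weight d \<alpha> * x\<^sup>2)"
proof -
  have "normal_density 0 (coeff_sd d \<alpha>) x
      = 1 / sqrt (2 * pi * (coeff_sd d \<alpha>)\<^sup>2) * exp (- (x - 0)\<^sup>2 / (2 * (coeff_sd d \<alpha>)\<^sup>2))"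
    by (simp add: normal_density_def)
  then show ?thesis unfolding coeff_sd_power2 by (simp add: real_sqrt_divide)
qed

lemma sets_coeff_measure [simp, measurable_cong]: "sets (coeff_measure d \<alpha>) = sets borel"
  by (simp add: coeff_measure_def)

lemma space_coeff_measure [simp]: "space (coeff_measure d \<alpha>) = UNIV"
  by (simp add: coeff_measure_def)

lemma prob_space_coeff_measure: "prob_space (coeff_measure d \<alpha>)"
  unfolding coeff_measure_def by (intro prob_space_normal_density coeff_sd_pos)

definition l2_sq :: "nat \<Rightarrow> (nat^3 \<Rightarrow> real) \<Rightarrow> real" where
  "l2_sq d a = (\<Sum>\<alpha>\<in>exponents d. fs_weight d \<alpha> * (a \<alpha>)\<^sup>2)"

definition coeff_lebesgue :: "nat \<Rightarrow> (nat^3 \<Rightarrow> real) measure" where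
  "coeff_lebesgue d = Pi\<^sub>M (exponents d) (\<lambda>_. lborel)"

lemma sets_kostlan: "sets (kostlan d) = sets (coeff_lebesgue d)"
  by (simp add: kostlan_def l2_lebesgue_def coeff_lebesgue_def)

lemma space_kostlan: "space (kostlan d) = space (coeff_lebesgue d)"
  by (simp add: kostlan_def l2_lebesgue_def coeff_lebesgue_def)

lemma measurable_coeff [measurable]: "\<alpha> \<in> exponents d \<Longrightarrow> (\<lambda>a. a \<alpha>)
    \<in> borel_measurable (coeff_lebesgue d)"
  unfolding coeff_lebesgue_def by measurable

lemma measurable_l2_sq [measurable]: "l2_sq d \<in> borel_measurable (coeff_lebesgue d)"
  unfolding l2_sq_def[abs_def] by measurable

text \<open>The normalising constants agree: there are \<open>(d + 2) choose 2\<close> coefficients, and the Gram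
determinant is the product of the weights.\<close>

lemma prod_normal_density:
  "(\<Prod>\<alpha>\<in>exponents d. normal_density 0 (coeff_sd d \<alpha>) (a \<alpha>)) =
     sqrt (gram_det d) * (pi powr (- real ((d + 2) choose 2) / 2) * exp (- l2_sq d a))"
proof -
  have "(\<Prod>\<alpha>\<in>exponents d. normal_density 0 (coeff_sd d \<alpha>) (a \<alpha>)) =
    (\<Prod>\<alpha>\<in>exponents d. sqrt (fs_weight d \<alpha>)) * (1 / sqrt pi) ^ card (exponents d)
        * exp (\<Sum>\<alpha>\<in>exponents d. - fs_weight d \<alpha> * (a \<alpha>)\<^sup>2)"
    by (simp add: normal_density_coeff_sd prod.distrib exp_sum real_sqrt_divide prod_dividef
        power_divide)
  also have "(\<Prod>\<alpha>\<in>exponents d. sqrt (fs_weight d \<alpha>)) = sqrt (gram_det d)"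
  proof -
    have "(\<Prod>\<alpha>\<in>S. sqrt (fs_weight d \<alpha>)) = sqrt (prod (fs_weight d) S)" for S :: "(nat^3) set"
      by (induction S rule: infinite_finite_induct) (simp_all add: real_sqrt_mult)
    then show ?thesis by (simp only: gram_det_eq)
  qed
  also have "(1 / sqrt pi) ^ card (exponents d) = pi powr (- real ((d + 2) choose 2) / 2)"
  proof -
    have "1 / sqrt pi = pi powr (- 1 / 2)"
      using powr_minus[of pi "1 / 2"] by (simp add: powr_half_sqrt inverse_eq_divide)
    then have "(1 / sqrt pi) ^ n = pi powr (- real n / 2)" for n
      by (simp add: powr_realpow[symmetric] powr_powr)
    then show ?thesis unfolding card_exponents .
  qed
  finally show ?thesis by (simp add: l2_sq_def sum_negf mult_ac)
qed

lemma kostlan_density: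
  "kostlan d = density (coeff_lebesgue d) (\<lambda>a. ennreal (sqrt (gram_det d)
      * (pi powr (- real ((d + 2) choose 2) / 2) * exp (- l2_sq d a))))"
proof -
  have [measurable]: "(\<lambda>a. ennreal (pi powr (- real ((d + 2) choose 2) / 2) * exp (- l2_sq d a)))
      \<in> borel_measurable (coeff_lebesgue d)"
    by measurable
  have "kostlan d = density (density (coeff_lebesgue d) (\<lambda>_. ennreal (sqrt (gram_det d))))
     (\<lambda>a. ennreal (pi powr (- real ((d + 2) choose 2) / 2) * exp (- l2_sq d a)))"
    unfolding kostlan_def l2_lebesgue_def coeff_lebesgue_def l2_norm_sq_complexify l2_sq_def ..
  also have "\<dots> = density (coeff_lebesgue d) (\<lambda>a. ennreal (sqrt (gram_det d)
      * (pi powr (- real ((d + 2) choose 2) / 2) * exp (- l2_sq d a))))"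
    by (subst density_density_eq) (auto simp: ennreal_mult' ennreal_mult'' gram_det_eq prod_nonneg
        fs_weight_pos less_imp_le)
  finally show ?thesis .
qed

text \<open>Since the monomials are orthogonal, the coefficients of a Kostlan polynomial are independent centred
Gaussians. Both measures agree on boxes, where the integral of the product density factorises.\<close>

lemma kostlan_eq_PiM: "kostlan d = Pi\<^sub>M (exponents d) (coeff_measure d)"
proof -
  interpret product_sigma_finite "coeff_measure d"
    unfolding product_sigma_finite_def
        by (simp add: prob_space_coeff_measure prob_space_imp_sigma_finite)
  interpret L: product_sigma_finite "\<lambda>_::nat^3. lborel :: real measure"
    by standard
  show ?thesis
  proof (rule PiM_eqI)
    show "sets (kostlan d) = sets (Pi\<^sub>M (exponents d) (coeff_measure d))"
      unfolding sets_kostlan coeff_lebesgue_def by (intro sets_PiM_cong) auto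
    fix A assume A: "\<And>\<alpha>. \<alpha> \<in> exponents d \<Longrightarrow> A \<alpha> \<in> sets (coeff_measure d \<alpha>)"
    then have A': "\<And>\<alpha>. \<alpha> \<in> exponents d \<Longrightarrow> A \<alpha> \<in> sets borel" by simp
    have box: "Pi\<^sub>E (exponents d) A \<in> sets (coeff_lebesgue d)"
      unfolding coeff_lebesgue_def by (intro sets_PiM_I_finite) (auto simp: A')
    have "emeasure (kostlan d) (Pi\<^sub>E (exponents d) A) =
      (\<integral>\<^sup>+a. (\<Prod>\<alpha>\<in>exponents d. ennreal (normal_density 0 (coeff_sd d \<alpha>) (a \<alpha>)))
          * indicator (Pi\<^sub>E (exponents d) A) a \<partial>coeff_lebesgue d)"
      unfolding kostlan_density prod_normal_density[symmetric]
      using box by (subst emeasure_density) (auto simp: prod_ennreal prod_normal_density)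
    also have "\<dots> = (\<integral>\<^sup>+a. (\<Prod>\<alpha>\<in>exponents d. ennreal (normal_density 0 (coeff_sd d \<alpha>) (a \<alpha>))
        * indicator (A \<alpha>) (a \<alpha>)) \<partial>coeff_lebesgue d)"
    proof (rule nn_integral_cong)
      fix a assume "a \<in> space (coeff_lebesgue d)"
      then have ext: "a \<in> extensional (exponents d)"
          by (simp add: coeff_lebesgue_def space_PiM PiE_def)
      have "indicator (Pi\<^sub>E (exponents d) A) a = (\<Prod>\<alpha>\<in>exponents d. indicator (A \<alpha>) (a \<alpha>) :: ennreal)"
      proof (cases "a \<in> Pi\<^sub>E (exponents d) A")
        case True
        then have "\<And>\<alpha>. \<alpha> \<in> exponents d \<Longrightarrow> a \<alpha> \<in> A \<alpha>" by auto
        then show ?thesis using True by simp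
      next
        case False
        then obtain \<alpha> where "\<alpha> \<in> exponents d" "a \<alpha> \<notin> A \<alpha>" using ext by (auto simp: PiE_def)
        then have "(\<Prod>\<alpha>\<in>exponents d. indicator (A \<alpha>) (a \<alpha>) :: ennreal) = 0"
          by (intro prod_zero) (auto intro!: bexI[of _ \<alpha>])
        then show ?thesis using False by simp
      qed
      then show "(\<Prod>\<alpha>\<in>exponents d. ennreal (normal_density 0 (coeff_sd d \<alpha>) (a \<alpha>)))
          * indicator (Pi\<^sub>E (exponents d) A) a =
        (\<Prod>\<alpha>\<in>exponents d. ennreal (normal_density 0 (coeff_sd d \<alpha>) (a \<alpha>)) * indicator (A \<alpha>) (a \<alpha>))"
        by (simp add: prod.distrib)
    qed
    also have "\<dots> = (\<Prod>\<alpha>\<in>exponents d. \<integral>\<^sup>+x. ennreal (normal_density 0 (coeff_sd d \<alpha>) x)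
        * indicator (A \<alpha>) x \<partial>lborel)"
      unfolding coeff_lebesgue_def
      by (rule L.product_nn_integral_prod) (use A' in \<open>auto intro!: borel_measurable_times_ennreal
          borel_measurable_indicator\<close>)
    also have "\<dots> = (\<Prod>\<alpha>\<in>exponents d. emeasure (coeff_measure d \<alpha>) (A \<alpha>))"
      unfolding coeff_measure_def by (intro prod.cong refl, subst emeasure_density) (use A' in auto)
    finally show "emeasure (kostlan d) (Pi\<^sub>E (exponents d) A)
        = (\<Prod>\<alpha>\<in>exponents d. emeasure (coeff_measure d \<alpha>) (A \<alpha>))" .
  qed simp
qed

lemma prob_space_kostlan: "prob_space (kostlan d)"
  unfolding kostlan_eq_PiM by (intro prob_space_PiM prob_space_coeff_measure)

lemma coeff_measure_moments:
  "integrable (coeff_measure d \<alpha>) (\<lambda>x. x)" "integral\<^sup>L (coeff_measure d \<alpha>) (\<lambda>x. x) = 0"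
  "integrable (coeff_measure d \<alpha>) (\<lambda>x. x * x)" "integral\<^sup>L (coeff_measure d \<alpha>) (\<lambda>x. x * x)
      = 1 / (2 * fs_weight d \<alpha>)"
proof -
  note [simp] = coeff_sd_pos
  show "integrable (coeff_measure d \<alpha>) (\<lambda>x. x)"
    unfolding coeff_measure_def using integrable_normal_moment_nz_1[of "coeff_sd d \<alpha>" 0]
    by (subst integrable_density) auto
  show "integral\<^sup>L (coeff_measure d \<alpha>) (\<lambda>x. x) = 0"
    unfolding coeff_measure_def using integral_normal_moment_nz_1[of "coeff_sd d \<alpha>" 0]
    by (subst integral_density) auto
  show "integrable (coeff_measure d \<alpha>) (\<lambda>x. x * x)"
    unfolding coeff_measure_def using integrable_normal_moment[of "coeff_sd d \<alpha>" 0 2]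
    by (subst integrable_density) (auto simp: power2_eq_square)
  show "integral\<^sup>L (coeff_measure d \<alpha>) (\<lambda>x. x * x) = 1 / (2 * fs_weight d \<alpha>)"
    unfolding coeff_measure_def using integral_normal_moment_even[of "coeff_sd d \<alpha>" 0 1]
    by (subst integral_density) (auto simp: power2_eq_square coeff_sd_power2[unfolded
        power2_eq_square])
qed

lemma kostlan_covariance:
  assumes "\<alpha> \<in> exponents d" "\<beta> \<in> exponents d"
  shows "integrable (kostlan d) (\<lambda>a. a \<alpha> * a \<beta>)"
    and "integral\<^sup>L (kostlan d) (\<lambda>a. a \<alpha> * a \<beta>) = (if \<alpha> = \<beta> then 1 / (2 * fs_weight d \<alpha>) else 0)"
proof -
  interpret product_sigma_finite "coeff_measure d"
    unfolding product_sigma_finite_def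
        by (simp add: prob_space_coeff_measure prob_space_imp_sigma_finite)
  define f where "f = (\<lambda>\<gamma> x. (if \<gamma> = \<alpha> then x else 1) * (if \<gamma> = \<beta> then x else (1::real)))"
  have eq: "(\<lambda>a. a \<alpha> * a \<beta>) = (\<lambda>a. \<Prod>\<gamma>\<in>exponents d. f \<gamma> (a \<gamma>))"
    using assms by (simp add: f_def prod.distrib prod.delta fun_eq_iff)
  have int: "integrable (coeff_measure d \<gamma>) (f \<gamma>)" for \<gamma>
  proof -
    interpret C: prob_space "coeff_measure d \<gamma>" by (rule prob_space_coeff_measure)
    consider "\<gamma> = \<alpha>" "\<gamma> = \<beta>" | "\<gamma> = \<alpha>" "\<gamma> \<noteq> \<beta>" | "\<gamma> \<noteq> \<alpha>" "\<gamma> = \<beta>" | "\<gamma> \<noteq> \<alpha>" "\<gamma> \<noteq> \<beta>" by blast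
    then show ?thesis
      by cases (simp_all add: f_def coeff_measure_moments)
  qed
  show "integrable (kostlan d) (\<lambda>a. a \<alpha> * a \<beta>)"
    unfolding kostlan_eq_PiM eq by (intro product_integrable_prod int) auto
  have "integral\<^sup>L (kostlan d) (\<lambda>a. a \<alpha> * a \<beta>)
      = (\<Prod>\<gamma>\<in>exponents d. integral\<^sup>L (coeff_measure d \<gamma>) (f \<gamma>))"
    unfolding kostlan_eq_PiM eq by (intro product_integral_prod int) auto
  also have "\<dots> = (if \<alpha> = \<beta> then 1 / (2 * fs_weight d \<alpha>) else 0)"
  proof (cases "\<alpha> = \<beta>")
    case True
    have "integral\<^sup>L (coeff_measure d \<gamma>) (f \<gamma>) = (if \<gamma> = \<alpha> then 1 / (2 * fs_weight d \<alpha>) else 1)"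
        for \<gamma>
      using prob_space.prob_space[OF prob_space_coeff_measure[of d \<gamma>]]
      by (cases "\<gamma> = \<alpha>") (simp_all add: f_def True coeff_measure_moments)
    then show ?thesis using assms True by (simp add: prod.delta)
  next
    case False
    then have "integral\<^sup>L (coeff_measure d \<alpha>) (f \<alpha>) = 0"
      by (simp add: f_def coeff_measure_moments)
    then have "(\<Prod>\<gamma>\<in>exponents d. integral\<^sup>L (coeff_measure d \<gamma>) (f \<gamma>)) = 0"
      using assms by (intro prod_zero) auto
    then show ?thesis using False by simp
  qed
  finally show "integral\<^sup>L (kostlan d) (\<lambda>a. a \<alpha> * a \<beta>)
      = (if \<alpha> = \<beta> then 1 / (2 * fs_weight d \<alpha>) else 0)" .
qed

lemma kostlan_variance:
  "integrable (kostlan d) (\<lambda>a. (\<Sum>\<alpha>\<in>exponents d. c \<alpha> * a \<alpha>)\<^sup>2)"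
  "integral\<^sup>L (kostlan d) (\<lambda>a. (\<Sum>\<alpha>\<in>exponents d. c \<alpha> * a \<alpha>)\<^sup>2)
      = (\<Sum>\<alpha>\<in>exponents d. (c \<alpha>)\<^sup>2 / (2 * fs_weight d \<alpha>))"
proof -
  have eq: "(\<Sum>\<alpha>\<in>exponents d. c \<alpha> * a \<alpha>)\<^sup>2
      = (\<Sum>\<alpha>\<in>exponents d. \<Sum>\<beta>\<in>exponents d. c \<alpha> * c \<beta> * (a \<alpha> * a \<beta>))" for a
    unfolding power2_eq_square sum_product by (intro sum.cong refl) (simp add: mult_ac)
  show "integrable (kostlan d) (\<lambda>a. (\<Sum>\<alpha>\<in>exponents d. c \<alpha> * a \<alpha>)\<^sup>2)"
    unfolding eq by (intro Bochner_Integration.integrable_sum integrable_mult_right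
        kostlan_covariance)
  have "integral\<^sup>L (kostlan d) (\<lambda>a. (\<Sum>\<alpha>\<in>exponents d. c \<alpha> * a \<alpha>)\<^sup>2) =
     (\<Sum>\<alpha>\<in>exponents d. \<Sum>\<beta>\<in>exponents d. c \<alpha> * c \<beta> * integral\<^sup>L (kostlan d) (\<lambda>a. a \<alpha> * a \<beta>))"
    unfolding eq by (simp add: kostlan_covariance(1) Bochner_Integration.integral_sum)
  also have "\<dots> = (\<Sum>\<alpha>\<in>exponents d. \<Sum>\<beta>\<in>exponents d. if \<alpha>
      = \<beta> then (c \<alpha>)\<^sup>2 / (2 * fs_weight d \<alpha>) else 0)"
    by (intro sum.cong refl) (simp add: kostlan_covariance(2) power2_eq_square)
  finally show "integral\<^sup>L (kostlan d) (\<lambda>a. (\<Sum>\<alpha>\<in>exponents d. c \<alpha> * a \<alpha>)\<^sup>2)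
      = (\<Sum>\<alpha>\<in>exponents d. (c \<alpha>)\<^sup>2 / (2 * fs_weight d \<alpha>))"
    by (simp add: sum.delta)
qed

text \<open>Only second moments of linear functionals of the coefficients are needed in the sequel. This is what
makes the argument insensitive to the choice of coordinates: after a rotation, only the covariance of
the new coefficients has to be known.\<close>

lemma kostlan_chebyshev:
  assumes "s > 0"
  shows "measure (kostlan d) {a\<in>space (kostlan d). s \<le> \<bar>\<Sum>\<alpha>\<in>exponents d. c \<alpha> * a \<alpha>\<bar>}
     \<le> (\<Sum>\<alpha>\<in>exponents d. (c \<alpha>)\<^sup>2 / (2 * fs_weight d \<alpha>)) / s\<^sup>2"
proof -
  interpret prob_space "kostlan d" by (rule prob_space_kostlan)
  have "{a\<in>space (kostlan d). s \<le> \<bar>\<Sum>\<alpha>\<in>exponents d. c \<alpha> * a \<alpha>\<bar>}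
      = {a\<in>space (kostlan d). (\<Sum>\<alpha>\<in>exponents d. c \<alpha> * a \<alpha>)\<^sup>2 \<ge> s\<^sup>2}"
    using assms by (auto simp: abs_le_square_iff[symmetric])
  also have "measure (kostlan d) \<dots> \<le> integral\<^sup>L (kostlan d) (\<lambda>a. (\<Sum>\<alpha>\<in>exponents d. c \<alpha>
      * a \<alpha>)\<^sup>2) / s\<^sup>2"
    using assms by (intro integral_Markov_inequality_measure[where A="{}"] kostlan_variance(1)) auto
  finally show ?thesis by (simp only: kostlan_variance(2))
qed

lemma distr_PiM_lborel_shift:
  fixes h :: "'i \<Rightarrow> real"
  assumes [simp]: "finite I"
  shows "distr (Pi\<^sub>M I (\<lambda>_. lborel)) (Pi\<^sub>M I (\<lambda>_. lborel)) (\<lambda>a. \<lambda>i\<in>I. a i + h i)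
      = Pi\<^sub>M I (\<lambda>_. lborel)"
proof -
  interpret L: product_sigma_finite "\<lambda>_::'i. lborel :: real measure"
    by standard
  show ?thesis
  proof (rule L.PiM_eqI)
    fix A :: "'i \<Rightarrow> real set" assume A: "\<And>i. i \<in> I \<Longrightarrow> A i \<in> sets lborel"
    have [measurable]: "(\<lambda>a. \<lambda>i\<in>I. a i + h i) \<in> Pi\<^sub>M I (\<lambda>_. lborel) \<rightarrow>\<^sub>M Pi\<^sub>M I (\<lambda>_. lborel)"
      by measurable
    have m: "(\<lambda>x. x + h i) -` A i \<in> sets lborel" if "i \<in> I" for i
      using A[OF that] measurable_sets_borel[of "\<lambda>x. x + h i" borel "A i"] by auto
    have "(\<lambda>a. \<lambda>i\<in>I. a i + h i) -` Pi\<^sub>E I A \<inter> space (Pi\<^sub>M I (\<lambda>_. lborel))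
        = Pi\<^sub>E I (\<lambda>i. (\<lambda>x. x + h i) -` A i)"
      by (auto simp: space_PiM PiE_iff)
    then have "emeasure (distr (Pi\<^sub>M I (\<lambda>_. lborel)) (Pi\<^sub>M I (\<lambda>_. lborel)) (\<lambda>a. \<lambda>i\<in>I. a i
        + h i)) (Pi\<^sub>E I A)
        = emeasure (Pi\<^sub>M I (\<lambda>_. lborel)) (Pi\<^sub>E I (\<lambda>i. (\<lambda>x. x + h i) -` A i))"
      using A by (subst emeasure_distr) (auto intro!: sets_PiM_I_finite)
    also have "\<dots> = (\<Prod>i\<in>I. emeasure lborel ((\<lambda>x. x + h i) -` A i))"
      by (rule L.emeasure_PiM) (use m in auto)
    also have "\<dots> = (\<Prod>i\<in>I. emeasure lborel (A i))"
    proof (rule prod.cong)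
      fix i assume i: "i \<in> I"
      have "emeasure lborel (A i) = emeasure (distr lborel borel ((+) (h i))) (A i)"
        by (simp add: lborel_distr_plus)
      also have "\<dots> = emeasure lborel ((\<lambda>x. x + h i) -` A i)"
      proof -
        have "(+) (h i) = (\<lambda>x. x + h i)" by (auto simp: fun_eq_iff)
        then show ?thesis using A[OF i] by (subst emeasure_distr) auto
      qed
      finally show "emeasure lborel ((\<lambda>x. x + h i) -` A i) = emeasure lborel (A i)" by simp
    qed simp
    finally show "emeasure (distr (Pi\<^sub>M I (\<lambda>_. lborel)) (Pi\<^sub>M I (\<lambda>_. lborel)) (\<lambda>a. \<lambda>i\<in>I. a i
        + h i)) (Pi\<^sub>E I A)
       = (\<Prod>i\<in>I. emeasure lborel (A i))" .
  qed simp_all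
qed

text \<open>A shift by \<open>h\<close> changes the Gaussian density at \<open>a\<close> by the factor
\<open>exp (- \<parallel>h\<parallel>\<^sup>2 - 2 \<langle>a, h\<rangle>)\<close>. Restricting to the points where \<open>\<langle>a, h\<rangle> \<le> \<tau>\<close> bounds it from below.\<close>

lemma kostlan_cameron_martin:
  assumes B: "B \<in> sets (kostlan d)"
  shows "ennreal (exp (- l2_sq d h - 2 * \<tau>)) *
      emeasure (kostlan d) {a\<in>space (kostlan d). (\<lambda>\<alpha>\<in>exponents d. a \<alpha> + h \<alpha>) \<in> B
          \<and> (\<Sum>\<alpha>\<in>exponents d. fs_weight d \<alpha> * h \<alpha> * a \<alpha>) \<le> \<tau>}
    \<le> emeasure (kostlan d) B"
proof -
  define K where "K = sqrt (gram_det d) * pi powr (- real ((d + 2) choose 2) / 2)"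
  have K: "K \<ge> 0"
    unfolding K_def gram_det_eq by (intro mult_nonneg_nonneg real_sqrt_ge_zero prod_nonneg
        less_imp_le[OF fs_weight_pos]) auto
  define S where "S = (\<lambda>a. \<lambda>\<alpha>\<in>exponents d. a \<alpha> + h \<alpha>)"
  have S [measurable]: "S \<in> coeff_lebesgue d \<rightarrow>\<^sub>M coeff_lebesgue d"
    unfolding S_def coeff_lebesgue_def by measurable
  define C where "C = {a\<in>space (coeff_lebesgue d). S a \<in> B
      \<and> (\<Sum>\<alpha>\<in>exponents d. fs_weight d \<alpha> * h \<alpha> * a \<alpha>) \<le> \<tau>}"
  have [measurable]: "B \<in> sets (coeff_lebesgue d)" using B by (simp add: sets_kostlan)
  have C [measurable]: "C \<in> sets (coeff_lebesgue d)"
    unfolding C_def by measurable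
  have dens: "kostlan d = density (coeff_lebesgue d) (\<lambda>a. ennreal (K * exp (- l2_sq d a)))"
    unfolding kostlan_density K_def by (simp add: mult.assoc)
  have "ennreal (exp (- l2_sq d h - 2 * \<tau>)) * emeasure (kostlan d) C =
     ennreal (exp (- l2_sq d h - 2 * \<tau>)) * (\<integral>\<^sup>+a. ennreal (K * exp (- l2_sq d a))
         * indicator C a \<partial>coeff_lebesgue d)"
    unfolding dens by (subst emeasure_density) auto
  also have "\<dots> = (\<integral>\<^sup>+a. ennreal (exp (- l2_sq d h - 2 * \<tau>))
      * (ennreal (K * exp (- l2_sq d a)) * indicator C a) \<partial>coeff_lebesgue d)"
    by (subst nn_integral_cmult) auto
  also have "\<dots> \<le> (\<integral>\<^sup>+a. ennreal (K * exp (- l2_sq d (S a))) * indicator B (S a) \<partial>coeff_lebesgue d)"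
  proof (rule nn_integral_mono)
    fix a
    show "ennreal (exp (- l2_sq d h - 2 * \<tau>)) * (ennreal (K * exp (- l2_sq d a)) * indicator C a)
       \<le> ennreal (K * exp (- l2_sq d (S a))) * indicator B (S a)"
    proof (cases "a \<in> C")
      case True
      have "l2_sq d (S a) = l2_sq d a + 2 * (\<Sum>\<alpha>\<in>exponents d. fs_weight d \<alpha> * h \<alpha> * a \<alpha>) + l2_sq d h"
        unfolding l2_sq_def S_def by (simp add: sum_distrib_left sum.distrib[symmetric] power2_sum
            algebra_simps)
      also have "\<dots> \<le> l2_sq d a + 2 * \<tau> + l2_sq d h" using True by (simp add: C_def)
      finally have "exp (- l2_sq d h - 2 * \<tau>) * exp (- l2_sq d a) \<le> exp (- l2_sq d (S a))"
        by (simp add: exp_add[symmetric])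
      then have "exp (- l2_sq d h - 2 * \<tau>) * (K * exp (- l2_sq d a)) \<le> K * exp (- l2_sq d (S a))"
        using mult_left_mono[of _ _ K] K by (simp add: mult.left_commute)
      then show ?thesis using True by (simp add: C_def ennreal_mult'[symmetric] ennreal_leI)
    qed simp
  qed
  also have "\<dots> = (\<integral>\<^sup>+a. ennreal (K * exp (- l2_sq d a))
      * indicator B a \<partial>distr (coeff_lebesgue d) (coeff_lebesgue d) S)"
    by (subst nn_integral_distr) auto
  also have "distr (coeff_lebesgue d) (coeff_lebesgue d) S = coeff_lebesgue d"
    unfolding coeff_lebesgue_def S_def by (intro distr_PiM_lborel_shift) simp
  also have "(\<integral>\<^sup>+a. ennreal (K * exp (- l2_sq d a)) * indicator B a \<partial>coeff_lebesgue d)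
      = emeasure (kostlan d) B"
    unfolding dens by (subst emeasure_density) auto
  finally show ?thesis unfolding C_def S_def space_kostlan .
qed

section \<open>Orthogonal substitutions\<close>

lemma exponents_nth_le: "\<alpha> \<in> exponents d \<Longrightarrow> \<alpha> $ i \<le> d"
  using exhaust_3[of i] by (auto simp: exponents_def sum_3)

text \<open>Kronecker substitution: along the curve \<open>(1, t, t\<^bsup>d+1\<^esup>)\<close> distinct monomials of degree \<open>d\<close> become
distinct powers of \<open>t\<close>, and a univariate polynomial that vanishes everywhere is zero.\<close>

lemma hpoly_eq_0_imp_coeff_0:
  fixes a :: "nat^3 \<Rightarrow> real"
  assumes "\<And>X. hpoly d a X = 0" and "\<alpha> \<in> exponents d"
  shows "a \<alpha> = 0"
proof -
  \<comment> \<open>The exponents are at most \<open>d\<close>, so \<open>e\<close> reads them as digits in base \<open>d + 1\<close>.\<close>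
  define e where "e = (\<lambda>\<alpha>::nat^3. \<alpha> $ 2 + (d + 1) * \<alpha> $ 3)"
  have inj: "\<alpha> = \<beta>" if "\<alpha> \<in> exponents d" "\<beta> \<in> exponents d" "e \<alpha> = e \<beta>" for \<alpha> \<beta>
  proof -
    have lt: "\<alpha> $ 2 < d + 1" "\<beta> $ 2 < d + 1"
      using exponents_nth_le[OF that(1), of 2] exponents_nth_le[OF that(2), of 2] by auto
    have "(x + D * y) mod D = x \<and> (x + D * y) div D = y" if "x < D" for x y D :: nat
      using that by simp
    from this[OF lt(1)] this[OF lt(2)]
    have "e \<alpha> mod (d + 1) = \<alpha> $ 2" "e \<beta> mod (d + 1) = \<beta> $ 2" "e \<alpha> div (d + 1) = \<alpha> $ 3"
        "e \<beta> div (d + 1) = \<beta> $ 3"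
      unfolding e_def by blast+
    then have "\<alpha> $ 2 = \<beta> $ 2" "\<alpha> $ 3 = \<beta> $ 3" using that(3) by auto
    then show ?thesis using exponents_neqD[OF that(1,2)] by auto
  qed
  define p where "p = (\<Sum>\<beta>\<in>exponents d. monom (a \<beta>) (e \<beta>))"
  have "poly p t = hpoly d a (vector [1, t, t ^ (d + 1)])" for t
    unfolding p_def hpoly_def poly_sum monomial_def prod_UNIV_3 vector_3
    by (intro sum.cong refl) (simp add: poly_monom e_def power_add power_mult[symmetric] del:
        power_Suc mult_Suc)
  then have "p = 0" using assms(1) by (simp add: poly_all_0_iff_0[symmetric])
  then have "0 = coeff p (e \<alpha>)" by simp
  also have "\<dots> = (\<Sum>\<beta>\<in>exponents d. if \<beta> = \<alpha> then a \<beta> else 0)"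
    unfolding p_def coeff_sum using inj[OF _ assms(2)] by (intro sum.cong) auto
  also have "\<dots> = a \<alpha>" using assms(2) by simp
  finally show ?thesis by simp
qed

text \<open>Functions on \<open>\<real>\<^sup>3\<close> that are given by a homogeneous polynomial of degree \<open>m\<close>. The closure properties
below show that such functions remain so after a linear substitution, without any explicit
formula for the new coefficients.\<close>

definition is_form :: "nat \<Rightarrow> (real^3 \<Rightarrow> real) \<Rightarrow> bool" where
  "is_form m F \<longleftrightarrow> (\<exists>c. \<forall>X. F X = hpoly m c X)"

lemma is_form_add: "is_form m F \<Longrightarrow> is_form m G \<Longrightarrow> is_form m (\<lambda>X. F X + G X)"
proof -
  assume "is_form m F" "is_form m G"
  then obtain a b where "\<And>X. F X = hpoly m a X" "\<And>X. G X = hpoly m b X" unfolding is_form_def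
      by blast
  then show ?thesis unfolding is_form_def
    by (intro exI[of _ "\<lambda>\<alpha>. a \<alpha> + b \<alpha>"]) (simp add: hpoly_def algebra_simps sum.distrib)
qed

lemma is_form_cmult: "is_form m F \<Longrightarrow> is_form m (\<lambda>X. c * F X)"
proof -
  assume "is_form m F"
  then obtain a where "\<And>X. F X = hpoly m a X" unfolding is_form_def by blast
  then show ?thesis unfolding is_form_def
    by (intro exI[of _ "\<lambda>\<alpha>. c * a \<alpha>"]) (simp add: hpoly_def sum_distrib_left mult.assoc)
qed

lemma monomial_add: "monomial (\<alpha> + \<beta>) X = monomial \<alpha> X * monomial \<beta> X"
  by (simp add: monomial_def power_add prod.distrib)

lemma is_form_mult:
  assumes "is_form m F" "is_form n G"
  shows "is_form (m + n) (\<lambda>X. F X * G X)"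
proof -
  obtain a b where ab: "\<And>X. F X = hpoly m a X" "\<And>X. G X = hpoly n b X"
    using assms unfolding is_form_def by blast
  define c where "c = (\<lambda>\<gamma>. \<Sum>(\<alpha>, \<beta>)\<in>{p \<in> exponents m \<times> exponents n. fst p + snd p = \<gamma>}. a \<alpha> * b \<beta>)"
  have "F X * G X = hpoly (m + n) c X" for X
  proof -
    have "F X * G X = (\<Sum>p\<in>exponents m \<times> exponents n. a (fst p) * b (snd p)
        * monomial (fst p + snd p) X)"
      unfolding ab hpoly_def sum_product sum.cartesian_product
      by (intro sum.cong refl) (auto simp: monomial_add mult_ac)
    also have "\<dots> = (\<Sum>\<gamma>\<in>exponents (m + n). \<Sum>p\<in>{p \<in> exponents m \<times> exponents n. fst p + snd p
        = \<gamma>}. a (fst p) * b (snd p) * monomial (fst p + snd p) X)"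
      by (rule sum.group[symmetric]) (simp, simp, auto simp: exponents_def sum.distrib)
    also have "\<dots> = hpoly (m + n) c X"
      unfolding hpoly_def c_def sum_distrib_right by (intro sum.cong refl) auto
    finally show ?thesis .
  qed
  then show ?thesis unfolding is_form_def by blast
qed

lemma is_form_monomial: "\<alpha> \<in> exponents m \<Longrightarrow> is_form m (monomial \<alpha>)"
proof -
  assume a: "\<alpha> \<in> exponents m"
  have "hpoly m (\<lambda>\<beta>. if \<beta> = \<alpha> then 1 else 0) X = monomial \<alpha> X" for X :: "real^3"
  proof -
    have "hpoly m (\<lambda>\<beta>. if \<beta> = \<alpha> then 1 else 0) X
        = (\<Sum>\<beta>\<in>exponents m. if \<beta> = \<alpha> then monomial \<beta> X else 0)"
      unfolding hpoly_def by (intro sum.cong) auto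
    then show ?thesis using a by simp
  qed
  then show ?thesis unfolding is_form_def by metis
qed

lemma is_form_power:
  assumes "is_form 1 F"
  shows "is_form n (\<lambda>X. F X ^ n)"
proof (induction n)
  case 0
  have "is_form 0 (monomial 0)" by (rule is_form_monomial) (simp add: exponents_def)
  then show ?case by (simp add: monomial_def[abs_def])
next
  case (Suc n)
  then show ?case using is_form_mult[OF assms Suc] by simp
qed

lemma is_form_linear:
  fixes f :: "real^3 \<Rightarrow> real"
  assumes "linear f"
  shows "is_form 1 f"
proof -
  have coord: "is_form 1 (\<lambda>X. X $ j)" for j
  proof -
    define \<alpha> :: "nat^3" where "\<alpha> = (\<chi> i. if i = j then 1 else 0)"
    have "monomial \<alpha> X = (\<Prod>i\<in>UNIV. if i = j then X $ i else 1)" for X :: "real^3"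
      unfolding monomial_def \<alpha>_def by (intro prod.cong) auto
    then have "monomial \<alpha> = (\<lambda>X::real^3. X $ j)" by (simp add: fun_eq_iff)
    moreover have "is_form 1 (monomial \<alpha>)"
        by (rule is_form_monomial) (simp add: exponents_def \<alpha>_def)
    ultimately show ?thesis by simp
  qed
  have "f X = f (axis 1 1) * X $ 1 + f (axis 2 1) * X $ 2 + f (axis 3 1) * X $ 3" for X
  proof -
    have "X = (X $ 1) *\<^sub>R axis 1 1 + (X $ 2) *\<^sub>R axis 2 1 + (X $ 3) *\<^sub>R axis 3 1"
      by (auto simp: vec_eq_iff forall_3 axis_def)
    then have "f X = f ((X $ 1) *\<^sub>R axis 1 1 + (X $ 2) *\<^sub>R axis 2 1 + (X $ 3) *\<^sub>R axis 3 1)" by simp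
    also have "\<dots> = f (axis 1 1) * X $ 1 + f (axis 2 1) * X $ 2 + f (axis 3 1) * X $ 3"
      by (simp add: linear_add[OF assms] linear_cmul[OF assms] mult.commute)
    finally show ?thesis .
  qed
  then have "f = (\<lambda>X. f (axis 1 1) * X $ 1 + f (axis 2 1) * X $ 2 + f (axis 3 1) * X $ 3)"
      by (rule ext)
  moreover have "is_form 1 (\<lambda>X. f (axis 1 1) * X $ 1 + f (axis 2 1) * X $ 2 + f (axis 3 1) * X $ 3)"
    by (intro is_form_add is_form_cmult coord)
  ultimately show ?thesis by metis
qed

text \<open>A linear substitution turns a monomial into a product of powers of linear forms.\<close>

lemma is_form_monomial_linear:
  fixes R :: "real^3 \<Rightarrow> real^3"
  assumes "linear R" "\<beta> \<in> exponents d"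
  shows "is_form d (\<lambda>X. monomial \<beta> (R X))"
proof -
  have 1: "is_form 1 (\<lambda>X. R X $ i)" for i
  proof (rule is_form_linear)
    show "linear (\<lambda>X. R X $ i)"
      by (rule linearI) (simp_all add: linear_add[OF assms(1)] linear_cmul[OF assms(1)])
  qed
  have "is_form (\<beta> $ 1 + \<beta> $ 2 + \<beta> $ 3) (\<lambda>X. R X $ 1 ^ \<beta> $ 1 * R X $ 2 ^ \<beta> $ 2 * R X $ 3 ^ \<beta> $ 3)"
    by (intro is_form_mult is_form_power 1)
  then show ?thesis using assms(2) by (simp add: monomial_def prod_UNIV_3 exponents_def sum_3)
qed

definition multinom :: "nat \<Rightarrow> nat^3 \<Rightarrow> real" where
  "multinom d \<alpha> = fact d / (\<Prod>i\<in>UNIV. fact (\<alpha> $ i))"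

lemma multinom_pos: "multinom d \<alpha> > 0"
  by (simp add: multinom_def prod_pos)

text \<open>Up to a constant, \<open>(X \<bullet> Y)\<^sup>d\<close> is the covariance of the values of a Kostlan polynomial at \<open>X\<close> and
\<open>Y\<close>. The multinomial theorem is obtained by applying the binomial theorem twice.\<close>

lemma inner_power_eq_sum_multinom:
  fixes X Y :: "real^3"
  shows "(X \<bullet> Y) ^ d = (\<Sum>\<alpha>\<in>exponents d. multinom d \<alpha> * monomial \<alpha> X * monomial \<alpha> Y)"
proof -
  define x y z where "x = X $ 1 * Y $ 1" "y = X $ 2 * Y $ 2" "z = X $ 3 * Y $ 3"
  have "(\<Sum>\<alpha>\<in>exponents d. multinom d \<alpha> * monomial \<alpha> X * monomial \<alpha> Y)
     = (\<Sum>(i,j)\<in>(SIGMA i:{..d}. {..d - i}). multinom d (expo d i j) * monomial (expo d i j) X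
         * monomial (expo d i j) Y)"
    using sum.reindex_bij_betw[OF bij_betw_expo, of "\<lambda>\<alpha>. multinom d \<alpha> * monomial \<alpha> X
        * monomial \<alpha> Y"]
    by (simp add: split_beta')
  also have "\<dots> = (\<Sum>i\<le>d. \<Sum>j\<le>d-i. multinom d (expo d i j) * monomial (expo d i j) X
      * monomial (expo d i j) Y)"
    by (subst sum.Sigma) auto
  also have "\<dots> = (\<Sum>i\<le>d. \<Sum>j\<le>d-i. (of_nat (d choose i) * y ^ i)
      * (of_nat (d - i choose j) * z ^ j * x ^ (d - i - j)))"
  proof (intro sum.cong refl)
    fix i j assume ij: "i \<in> {..d}" "j \<in> {..d-i}"
    have "multinom d (expo d i j) = of_nat (d choose i) * of_nat (d - i choose j)"
      using ij by (simp add: multinom_def prod_UNIV_3 binomial_fact divide_simps del: One_nat_def)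
    then show "multinom d (expo d i j) * monomial (expo d i j) X * monomial (expo d i j) Y =
       (of_nat (d choose i) * y ^ i) * (of_nat (d - i choose j) * z ^ j * x ^ (d - i - j))"
      unfolding monomial_def prod_UNIV_3 expo_nth x_y_z_def power_mult_distrib
          by (simp only: mult_ac)
  qed
  also have "\<dots> = (\<Sum>i\<le>d. of_nat (d choose i) * y ^ i * (z + x) ^ (d - i))"
    by (simp only: binomial_ring sum_distrib_left)
  also have "\<dots> = (y + (z + x)) ^ d" by (simp only: binomial_ring[of y "z + x"])
  also have "y + (z + x) = X \<bullet> Y"
    by (simp add: inner_vec_def sum_3 x_y_z_def)
  finally show ?thesis by simp
qed

text \<open>The matrix \<open>T\<close> of the substitution \<open>X \<mapsto> R X\<close> preserves the covariance of the coefficients. Indeed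
the kernel \<open>(X \<bullet> Y)\<^sup>d\<close> is invariant under \<open>R\<close>; expanding both sides of \<open>(R Y \<bullet> R X)\<^sup>d = (Y \<bullet> X)\<^sup>d\<close> in
monomials and comparing coefficients, first in \<open>X\<close> and then in \<open>Y\<close>, gives the claim.\<close>

lemma orthogonal_coefficient_change:
  fixes R :: "real^3 \<Rightarrow> real^3"
  assumes R: "orthogonal_transformation R"
  shows "\<exists>T. (\<forall>a X. hpoly d a (R X) = hpoly d (\<lambda>\<gamma>. \<Sum>\<beta>\<in>exponents d. T \<gamma> \<beta> * a \<beta>) X) \<and>
     (\<forall>\<gamma>\<in>exponents d. \<forall>\<gamma>'\<in>exponents d. (\<Sum>\<beta>\<in>exponents d. multinom d \<beta> * T \<gamma> \<beta> * T \<gamma>' \<beta>) = (if \<gamma>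
         = \<gamma>' then multinom d \<gamma> else 0))"
proof -
  let ?E = "exponents d"
  have lin: "linear R" using R by (simp add: orthogonal_transformation_def)
  have "\<forall>\<beta>\<in>?E. \<exists>c. \<forall>X. monomial \<beta> (R X) = hpoly d c X"
    using is_form_monomial_linear[OF lin] unfolding is_form_def by blast
  then obtain U where U: "\<And>\<beta> X. \<beta> \<in> ?E \<Longrightarrow> monomial \<beta> (R X) = hpoly d (U \<beta>) X" by metis
  define T where "T = (\<lambda>\<gamma> \<beta>. U \<beta> \<gamma>)"
  have T: "monomial \<beta> (R X) = (\<Sum>\<gamma>\<in>?E. T \<gamma> \<beta> * monomial \<gamma> X)" if "\<beta> \<in> ?E" for \<beta> X
    using U[OF that] by (simp add: T_def hpoly_def)
  define G where "G = (\<lambda>\<gamma> \<gamma>'. \<Sum>\<beta>\<in>?E. multinom d \<beta> * T \<gamma> \<beta> * T \<gamma>' \<beta>)"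
  have kernel: "(\<Sum>\<gamma>\<in>?E. (\<Sum>\<gamma>'\<in>?E. G \<gamma> \<gamma>' * monomial \<gamma>' Y) * monomial \<gamma> X)
      = (\<Sum>\<gamma>\<in>?E. multinom d \<gamma> * monomial \<gamma> Y * monomial \<gamma> X)" for X Y
  proof -
    have "(\<Sum>\<gamma>\<in>?E. multinom d \<gamma> * monomial \<gamma> Y * monomial \<gamma> X) = (Y \<bullet> X) ^ d"
      by (simp add: inner_power_eq_sum_multinom)
    also have "\<dots> = (R Y \<bullet> R X) ^ d" using R by (simp add: orthogonal_transformation_def)
    also have "\<dots> = (\<Sum>\<beta>\<in>?E. multinom d \<beta> * (\<Sum>\<gamma>'\<in>?E. T \<gamma>' \<beta> * monomial \<gamma>' Y)
        * (\<Sum>\<gamma>\<in>?E. T \<gamma> \<beta> * monomial \<gamma> X))"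
      unfolding inner_power_eq_sum_multinom by (intro sum.cong refl) (simp add: T)
    also have "\<dots> = (\<Sum>\<beta>\<in>?E. \<Sum>\<gamma>\<in>?E. \<Sum>\<gamma>'\<in>?E. multinom d \<beta> * T \<gamma> \<beta> * T \<gamma>' \<beta> * monomial \<gamma>' Y
        * monomial \<gamma> X)"
    proof (intro sum.cong refl)
      fix \<beta>
      have "multinom d \<beta> * (\<Sum>\<gamma>'\<in>?E. T \<gamma>' \<beta> * monomial \<gamma>' Y) * (\<Sum>\<gamma>\<in>?E. T \<gamma> \<beta> * monomial \<gamma> X)
         = (\<Sum>\<gamma>'\<in>?E. \<Sum>\<gamma>\<in>?E. multinom d \<beta> * (T \<gamma>' \<beta> * monomial \<gamma>' Y) * (T \<gamma> \<beta> * monomial \<gamma> X))"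
        by (subst mult.assoc, subst sum_product) (simp only: sum_distrib_left mult.assoc)
      also have "\<dots> = (\<Sum>\<gamma>\<in>?E. \<Sum>\<gamma>'\<in>?E. multinom d \<beta> * (T \<gamma>' \<beta> * monomial \<gamma>' Y)
          * (T \<gamma> \<beta> * monomial \<gamma> X))"
        by (rule sum.swap)
      finally show "multinom d \<beta> * (\<Sum>\<gamma>'\<in>?E. T \<gamma>' \<beta> * monomial \<gamma>' Y) * (\<Sum>\<gamma>\<in>?E. T \<gamma> \<beta> * monomial \<gamma> X)
         = (\<Sum>\<gamma>\<in>?E. \<Sum>\<gamma>'\<in>?E. multinom d \<beta> * T \<gamma> \<beta> * T \<gamma>' \<beta> * monomial \<gamma>' Y * monomial \<gamma> X)"
        by (simp add: mult_ac)
    qed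
    also have "\<dots> = (\<Sum>\<gamma>\<in>?E. \<Sum>\<gamma>'\<in>?E. \<Sum>\<beta>\<in>?E. multinom d \<beta> * T \<gamma> \<beta> * T \<gamma>' \<beta> * monomial \<gamma>' Y
        * monomial \<gamma> X)"
      by (rule trans[OF sum.swap]) (intro sum.cong refl sum.swap)
    also have "\<dots> = (\<Sum>\<gamma>\<in>?E. (\<Sum>\<gamma>'\<in>?E. G \<gamma> \<gamma>' * monomial \<gamma>' Y) * monomial \<gamma> X)"
      by (simp add: G_def sum_distrib_right)
    finally show ?thesis by simp
  qed
  have row: "(\<Sum>\<gamma>'\<in>?E. G \<gamma> \<gamma>' * monomial \<gamma>' Y) = multinom d \<gamma> * monomial \<gamma> Y" if "\<gamma> \<in> ?E" for \<gamma> Y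
  proof -
    have "hpoly d (\<lambda>\<gamma>. (\<Sum>\<gamma>'\<in>?E. G \<gamma> \<gamma>' * monomial \<gamma>' Y) - multinom d \<gamma> * monomial \<gamma> Y) X = 0" for X
      using kernel[of Y X] by (simp add: hpoly_def left_diff_distrib sum_subtractf)
    from hpoly_eq_0_imp_coeff_0[OF this that] show ?thesis by simp
  qed
  have G: "G \<gamma> \<gamma>' = (if \<gamma> = \<gamma>' then multinom d \<gamma> else 0)" if "\<gamma> \<in> ?E" "\<gamma>' \<in> ?E" for \<gamma> \<gamma>'
  proof -
    have "hpoly d (\<lambda>\<gamma>'. G \<gamma> \<gamma>' - (if \<gamma>' = \<gamma> then multinom d \<gamma> else 0)) Y = 0" for Y
    proof -
      have "(\<Sum>\<gamma>'\<in>?E. (if \<gamma>' = \<gamma> then multinom d \<gamma> else 0) * monomial \<gamma>' Y)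
          = (\<Sum>\<gamma>'\<in>?E. if \<gamma>' = \<gamma> then multinom d \<gamma> * monomial \<gamma>' Y else 0)"
        by (intro sum.cong) auto
      then show ?thesis
        using row[OF that(1), of Y] that(1) by (simp add: hpoly_def left_diff_distrib sum_subtractf)
    qed
    from hpoly_eq_0_imp_coeff_0[OF this that(2)] show ?thesis by auto
  qed
  have "hpoly d a (R X) = hpoly d (\<lambda>\<gamma>. \<Sum>\<beta>\<in>?E. T \<gamma> \<beta> * a \<beta>) X" for a X
  proof -
    have "hpoly d a (R X) = (\<Sum>\<beta>\<in>?E. \<Sum>\<gamma>\<in>?E. T \<gamma> \<beta> * a \<beta> * monomial \<gamma> X)"
      unfolding hpoly_def by (intro sum.cong refl) (simp add: T sum_distrib_left mult_ac)
    also have "\<dots> = (\<Sum>\<gamma>\<in>?E. \<Sum>\<beta>\<in>?E. T \<gamma> \<beta> * a \<beta> * monomial \<gamma> X)" by (rule sum.swap)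
    finally show ?thesis by (simp add: hpoly_def sum_distrib_right)
  qed
  then show ?thesis using G unfolding G_def by (intro exI[of _ T]) blast
qed

section \<open>Polynomials close to a prescribed one\<close>

text \<open>The variance of the coefficient with exponent vector \<open>\<alpha>\<close> is \<open>coeff_scale d * multinom d \<alpha>\<close>.\<close>

definition coeff_scale :: "nat \<Rightarrow> real" where
  "coeff_scale d = real (d + 1) * real (d + 2) / 4"

lemma coeff_scale_pos: "coeff_scale d > 0"
  by (simp add: coeff_scale_def)

lemma fs_weight_eq: "fs_weight d \<alpha> = 1 / (2 * coeff_scale d * multinom d \<alpha>)"
proof -
  have "(\<Prod>i\<in>UNIV. fact (\<alpha> $ i) :: real) > 0" by (simp add: prod_pos)
  moreover define N where "N = real (d + 1) * real (d + 2)"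
  moreover have "fact (d + 2) = N * fact d" by (simp add: N_def algebra_simps)
  moreover have "N > 0" by (simp add: N_def del: of_nat_add)
  ultimately show ?thesis unfolding fs_weight_def coeff_scale_def multinom_def N_def[symmetric]
    by (simp add: field_simps del: fact_Suc)
qed

text \<open>The event is that the coefficients of \<open>P \<circ> R\<close> lie within \<open>r\<close> of prescribed values \<open>q\<close>. For \<open>q = 0\<close> it
has probability at least \<open>3/4\<close> by the union bound and Chebyshev's inequality, because the rotated
coefficients have the same variances as the original ones. In general, the polynomial \<open>h\<close> whose
rotation has coefficients \<open>q\<close> is obtained from the transpose of \<open>T\<close>; orthogonality of the rows of \<open>T\<close>
gives both \<open>T h = q\<close> and the norm of \<open>h\<close>, which determines the cost of the shift by \<open>h\<close>.\<close>

lemma kostlan_window_probability: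
  fixes T :: "nat^3 \<Rightarrow> nat^3 \<Rightarrow> real" and q r :: "nat^3 \<Rightarrow> real"
  assumes T: "\<And>\<gamma> \<gamma>'. \<gamma> \<in> exponents d \<Longrightarrow> \<gamma>' \<in> exponents d \<Longrightarrow>
        (\<Sum>\<beta>\<in>exponents d. multinom d \<beta> * T \<gamma> \<beta> * T \<gamma>' \<beta>) = (if \<gamma> = \<gamma>' then multinom d \<gamma> else 0)"
    and r: "\<And>\<gamma>. \<gamma> \<in> exponents d \<Longrightarrow> r \<gamma> > 0" "(\<Sum>\<gamma>\<in>exponents d. coeff_scale d
        * multinom d \<gamma> / (r \<gamma>)\<^sup>2) \<le> 1 / 4"
    and H: "(\<Sum>\<gamma>\<in>exponents d. (q \<gamma>)\<^sup>2 / (2 * coeff_scale d * multinom d \<gamma>)) \<le> H" "2 * H \<le> \<tau>\<^sup>2"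
        "\<tau> > 0"
  defines "B \<equiv> {a\<in>space (kostlan d). \<forall>\<gamma>\<in>exponents d. \<bar>(\<Sum>\<beta>\<in>exponents d. T \<gamma> \<beta> * a \<beta>) - q \<gamma>\<bar> < r \<gamma>}"
  shows "B \<in> sets (kostlan d)" "ennreal (exp (- H - 2 * \<tau>) / 2) \<le> emeasure (kostlan d) B"
proof -
  interpret prob_space "kostlan d" by (rule prob_space_kostlan)
  let ?E = "exponents d" and ?s = "coeff_scale d" and ?m = "multinom d"
  have pos [simp]: "?s > 0" "?m \<gamma> > 0" "?m \<gamma> \<noteq> 0" "?s \<noteq> 0" for \<gamma>
    using coeff_scale_pos[of d] multinom_pos[of d \<gamma>] by auto
  have meas [measurable]: "\<And>\<alpha>. \<alpha> \<in> ?E \<Longrightarrow> (\<lambda>a. a \<alpha>) \<in> borel_measurable (kostlan d)"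
    using measurable_coeff[of _ d] by (simp add: measurable_cong_sets[OF sets_kostlan refl])
  show B: "B \<in> sets (kostlan d)" unfolding B_def by measurable
  \<comment> \<open>The transpose of \<open>T\<close> with respect to the covariance, applied to \<open>q\<close>.\<close>
  define h where "h = (\<lambda>\<beta>. ?m \<beta> * (\<Sum>\<gamma>\<in>?E. T \<gamma> \<beta> * (q \<gamma> / ?m \<gamma>)))"
  have Th: "(\<Sum>\<beta>\<in>?E. T \<gamma> \<beta> * h \<beta>) = q \<gamma>" if g: "\<gamma> \<in> ?E" for \<gamma>
  proof -
    have "(\<Sum>\<beta>\<in>?E. T \<gamma> \<beta> * h \<beta>) = (\<Sum>\<beta>\<in>?E. \<Sum>\<gamma>'\<in>?E. (?m \<beta> * T \<gamma> \<beta> * T \<gamma>' \<beta>) * (q \<gamma>' / ?m \<gamma>'))"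
      unfolding h_def sum_distrib_left by (intro sum.cong refl) (simp add: mult_ac)
    also have "\<dots> = (\<Sum>\<gamma>'\<in>?E. (\<Sum>\<beta>\<in>?E. ?m \<beta> * T \<gamma> \<beta> * T \<gamma>' \<beta>) * (q \<gamma>' / ?m \<gamma>'))"
      by (subst sum.swap) (simp only: sum_distrib_right)
    also have "\<dots> = (\<Sum>\<gamma>'\<in>?E. if \<gamma>' = \<gamma> then q \<gamma>' else 0)"
      by (intro sum.cong refl) (auto simp: T g)
    also have "\<dots> = q \<gamma>" using g by simp
    finally show ?thesis .
  qed
  have lh: "l2_sq d h = (\<Sum>\<gamma>\<in>?E. (q \<gamma>)\<^sup>2 / (2 * ?s * ?m \<gamma>))"
  proof -
    have "l2_sq d h = (\<Sum>\<beta>\<in>?E. (\<Sum>\<gamma>\<in>?E. T \<gamma> \<beta> * (q \<gamma> / ?m \<gamma>)) * h \<beta> / (2 * ?s))"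
      unfolding l2_sq_def fs_weight_eq
      by (intro sum.cong refl) (simp add: h_def power2_eq_square)
    also have "\<dots> = (\<Sum>\<beta>\<in>?E. \<Sum>\<gamma>\<in>?E. (T \<gamma> \<beta> * h \<beta>) * (q \<gamma> / (2 * ?s * ?m \<gamma>)))"
      unfolding sum_distrib_right sum_divide_distrib by (intro sum.cong refl) (simp add: mult_ac)
    also have "\<dots> = (\<Sum>\<gamma>\<in>?E. (\<Sum>\<beta>\<in>?E. T \<gamma> \<beta> * h \<beta>) * (q \<gamma> / (2 * ?s * ?m \<gamma>)))"
      by (subst sum.swap) (simp only: sum_distrib_right)
    also have "\<dots> = (\<Sum>\<gamma>\<in>?E. (q \<gamma>)\<^sup>2 / (2 * ?s * ?m \<gamma>))"
      by (intro sum.cong refl) (simp add: Th power2_eq_square)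
    finally show ?thesis .
  qed
  define bad where "bad = (\<lambda>\<gamma>. {a\<in>space (kostlan d). r \<gamma> \<le> \<bar>\<Sum>\<beta>\<in>?E. T \<gamma> \<beta> * a \<beta>\<bar>})"
  define bad0 where "bad0 = {a\<in>space (kostlan d). \<tau> \<le> \<bar>\<Sum>\<alpha>\<in>?E. fs_weight d \<alpha> * h \<alpha> * a \<alpha>\<bar>}"
  have [measurable]: "bad \<gamma> \<in> events" "bad0 \<in> events" for \<gamma>
    unfolding bad_def bad0_def by measurable
  have bad: "prob (bad \<gamma>) \<le> ?s * ?m \<gamma> / (r \<gamma>)\<^sup>2" if g: "\<gamma> \<in> ?E" for \<gamma>
  proof -
    have "prob (bad \<gamma>) \<le> (\<Sum>\<beta>\<in>?E. (T \<gamma> \<beta>)\<^sup>2 / (2 * fs_weight d \<beta>)) / (r \<gamma>)\<^sup>2"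
      unfolding bad_def by (rule kostlan_chebyshev[OF r(1)[OF g]])
    also have "(\<Sum>\<beta>\<in>?E. (T \<gamma> \<beta>)\<^sup>2 / (2 * fs_weight d \<beta>)) = ?s * (\<Sum>\<beta>\<in>?E. ?m \<beta> * T \<gamma> \<beta> * T \<gamma> \<beta>)"
      unfolding sum_distrib_left by (intro sum.cong refl) (simp add: fs_weight_eq power2_eq_square)
    finally show ?thesis using T[OF g g] by simp
  qed
  have bad0: "prob bad0 \<le> 1 / 4"
  proof -
    have "prob bad0 \<le> (\<Sum>\<alpha>\<in>?E. (fs_weight d \<alpha> * h \<alpha>)\<^sup>2 / (2 * fs_weight d \<alpha>)) / \<tau>\<^sup>2"
      unfolding bad0_def by (rule kostlan_chebyshev[OF H(3)])
    also have "(\<Sum>\<alpha>\<in>?E. (fs_weight d \<alpha> * h \<alpha>)\<^sup>2 / (2 * fs_weight d \<alpha>)) = l2_sq d h / 2"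
      unfolding l2_sq_def sum_divide_distrib
      by (intro sum.cong refl) (use fs_weight_pos in \<open>simp add: power2_eq_square
          less_imp_neq[symmetric]\<close>)
    also have "l2_sq d h / 2 / \<tau>\<^sup>2 \<le> H / 2 / \<tau>\<^sup>2"
      using H by (intro divide_right_mono) (auto simp: lh)
    also have "\<dots> \<le> 1 / 4" using H by (simp add: divide_simps)
    finally show ?thesis .
  qed
  define C where "C = {a\<in>space (kostlan d). (\<lambda>\<alpha>\<in>?E. a \<alpha> + h \<alpha>) \<in> B
      \<and> (\<Sum>\<alpha>\<in>?E. fs_weight d \<alpha> * h \<alpha> * a \<alpha>) \<le> \<tau>}"
  have "(\<lambda>a. \<lambda>\<alpha>\<in>?E. a \<alpha> + h \<alpha>) \<in> kostlan d \<rightarrow>\<^sub>M kostlan d"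
    unfolding measurable_cong_sets[OF sets_kostlan sets_kostlan] coeff_lebesgue_def by measurable
  then have [measurable]: "C \<in> events" unfolding C_def using B by measurable
  \<comment> \<open>Outside the bad events, shifting by \<open>h\<close> leads into the window around \<open>q\<close>.\<close>
  have sub: "space (kostlan d) - ((\<Union>\<gamma>\<in>?E. bad \<gamma>) \<union> bad0) \<subseteq> C"
  proof
    fix a assume a: "a \<in> space (kostlan d) - ((\<Union>\<gamma>\<in>?E. bad \<gamma>) \<union> bad0)"
    have sp: "(\<lambda>\<alpha>\<in>?E. a \<alpha> + h \<alpha>) \<in> space (kostlan d)"
      by (simp add: space_kostlan coeff_lebesgue_def space_PiM)
    have "\<bar>(\<Sum>\<beta>\<in>?E. T \<gamma> \<beta> * (\<lambda>\<alpha>\<in>?E. a \<alpha> + h \<alpha>) \<beta>) - q \<gamma>\<bar> < r \<gamma>" if g: "\<gamma> \<in> ?E" for \<gamma>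
    proof -
      have "(\<Sum>\<beta>\<in>?E. T \<gamma> \<beta> * (\<lambda>\<alpha>\<in>?E. a \<alpha> + h \<alpha>) \<beta>) = (\<Sum>\<beta>\<in>?E. T \<gamma> \<beta> * a \<beta>) + q \<gamma>"
        by (simp add: distrib_left sum.distrib Th[OF g])
      moreover have "a \<notin> bad \<gamma>" using a g by auto
      ultimately show ?thesis using a by (auto simp: bad_def)
    qed
    moreover have "(\<Sum>\<alpha>\<in>?E. fs_weight d \<alpha> * h \<alpha> * a \<alpha>) \<le> \<tau>" using a by (auto simp: bad0_def)
    ultimately show "a \<in> C" using a sp unfolding C_def B_def by auto
  qed
  have "prob ((\<Union>\<gamma>\<in>?E. bad \<gamma>) \<union> bad0) \<le> prob (\<Union>\<gamma>\<in>?E. bad \<gamma>) + prob bad0"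
    by (intro measure_Un_le) auto
  also have "prob (\<Union>\<gamma>\<in>?E. bad \<gamma>) \<le> (\<Sum>\<gamma>\<in>?E. prob (bad \<gamma>))"
    by (intro measure_UNION_le) auto
  also have "\<dots> \<le> (\<Sum>\<gamma>\<in>?E. ?s * ?m \<gamma> / (r \<gamma>)\<^sup>2)" by (intro sum_mono bad)
  also have "\<dots> \<le> 1 / 4" by (rule r(2))
  finally have "prob ((\<Union>\<gamma>\<in>?E. bad \<gamma>) \<union> bad0) \<le> 1 / 2" using bad0 by linarith
  moreover have "prob (space (kostlan d) - ((\<Union>\<gamma>\<in>?E. bad \<gamma>) \<union> bad0))
      = 1 - prob ((\<Union>\<gamma>\<in>?E. bad \<gamma>) \<union> bad0)"
    by (intro prob_compl) auto
  moreover have "prob (space (kostlan d) - ((\<Union>\<gamma>\<in>?E. bad \<gamma>) \<union> bad0)) \<le> prob C"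
    by (intro finite_measure_mono sub) auto
  ultimately have C: "prob C \<ge> 1 / 2" by linarith
  have "exp (- H - 2 * \<tau>) / 2 \<le> exp (- l2_sq d h - 2 * \<tau>) * prob C"
    using C H(1) mult_mono[of "exp (- H - 2 * \<tau>)" "exp (- l2_sq d h - 2 * \<tau>)" "1/2" "prob C"]
        by (simp add: lh)
  then have "ennreal (exp (- H - 2 * \<tau>) / 2) \<le> ennreal (exp (- l2_sq d h - 2 * \<tau>) * prob C)"
    by (rule ennreal_leI)
  also have "\<dots> = ennreal (exp (- l2_sq d h - 2 * \<tau>)) * emeasure (kostlan d) C"
    by (simp add: ennreal_mult' emeasure_eq_measure)
  also have "\<dots> \<le> emeasure (kostlan d) B"
    unfolding C_def by (rule kostlan_cameron_martin[OF B])
  finally show "ennreal (exp (- H - 2 * \<tau>) / 2) \<le> emeasure (kostlan d) B" .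
qed

section \<open>The length of connected sets\<close>

text \<open>The function \<open>dist x\<close> does not increase distances and maps \<open>C\<close> onto a set that contains
\<open>[0, dist x y]\<close>. A cover of \<open>C\<close> therefore yields a cover of this interval by intervals whose lengths are
at most the diameters, and countable subadditivity of Lebesgue measure applies.\<close>

lemma curve_length_ge_dist:
  fixes C :: "'a::metric_space set"
  assumes C: "connected C" "x \<in> C" "y \<in> C"
  shows "ennreal (dist x y) \<le> curve_length C"
proof -
  let ?f = "\<lambda>z. dist x z"
  have conn: "connected (?f ` C)"
    by (intro connected_continuous_image C continuous_intros)
  have cover: "{0..dist x y} \<subseteq> ?f ` C"
    using C by (intro connected_contains_Icc[OF conn]) (auto intro: rev_image_eqI)
  have "ennreal (dist x y) \<le> (\<Sum>n. ennreal (diameter (U n)))"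
    if U: "\<And>n. bounded (U n)" "C \<subseteq> (\<Union>n. U n)" for U :: "nat \<Rightarrow> 'a set"
  proof -
    define J where "J = (\<lambda>n. if U n = {} then {} else {Inf (?f ` U n)..Sup (?f ` U n)})"
    have bdd: "bdd_above (?f ` U n)" "bdd_below (?f ` U n)" for n
    proof -
      have "bounded (?f ` U n)" using bounded_dist_comp[of "\<lambda>_. x" "U n" "\<lambda>z. z"] U(1)[of n]
        by (simp add: image_constant_conv)
      then show "bdd_above (?f ` U n)" "bdd_below (?f ` U n)"
        by (auto intro: bounded_imp_bdd_above bounded_imp_bdd_below)
    qed
    have sub: "?f ` U n \<subseteq> J n" for n
    proof
      fix v assume "v \<in> ?f ` U n"
      then show "v \<in> J n"
        using cInf_lower[OF _ bdd(2)[of n], of v] cSup_upper[OF _ bdd(1)[of n], of v]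
            by (auto simp: J_def)
    qed
    have len: "emeasure lborel (J n) \<le> ennreal (diameter (U n))" for n
    proof (cases "U n = {}")
      case False
      have "?f u \<le> ?f v + diameter (U n)" if "u \<in> U n" "v \<in> U n" for u v
        using dist_triangle[of x u v] diameter_bounded_bound[OF U(1) that(2) that(1)]
            by (simp add: dist_commute)
      then have "Sup (?f ` U n) \<le> ?f v + diameter (U n)" if "v \<in> U n" for v
        using that by (intro cSup_least) auto
      then have "Sup (?f ` U n) - diameter (U n) \<le> Inf (?f ` U n)"
        using False by (intro cInf_greatest) (auto simp only: image_is_empty diff_le_eq)
      moreover have "Inf (?f ` U n) \<le> Sup (?f ` U n)"
        using False bdd[of n] by (intro cInf_le_cSup) auto
      ultimately show ?thesis using False by (simp add: J_def ennreal_leI)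
    qed (simp add: J_def)
    have "ennreal (dist x y) = emeasure lborel {0..dist x y}"
      by (subst emeasure_lborel_Icc) auto
    also have "\<dots> \<le> emeasure lborel (\<Union>n. J n)"
    proof (rule emeasure_mono)
      have "?f ` C \<subseteq> (\<Union>n. ?f ` U n)" using U(2) by blast
      also have "\<dots> \<subseteq> (\<Union>n. J n)" by (rule UN_mono[OF subset_refl sub])
      finally show "{0..dist x y} \<subseteq> (\<Union>n. J n)" using cover by (rule subset_trans[rotated])
      show "(\<Union>n. J n) \<in> sets lborel" by (auto simp: J_def)
    qed
    also have "\<dots> \<le> (\<Sum>n. emeasure lborel (J n))"
      by (intro emeasure_subadditive_countably) (auto simp: J_def)
    also have "\<dots> \<le> (\<Sum>n. ennreal (diameter (U n)))" by (intro suminf_le len) auto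
    finally show ?thesis .
  qed
  then have "ennreal (dist x y) \<le> hausdorff1_pre 1 C"
    unfolding hausdorff1_pre_def by (intro INF_greatest) auto
  also have "\<dots> \<le> curve_length C" unfolding curve_length_def by (intro SUP_upper) auto
  finally show ?thesis .
qed

section \<open>Zero sets that separate a disk\<close>

text \<open>The zeros in the disk separate the centre from the boundary circle, by the intermediate value theorem.
In the plane, a closed set that separates two points has a component that separates them. That
component meets every radius, since otherwise the radius and the circle would join the two points
outside it.\<close>

lemma separating_zero_component:
  fixes F :: "complex \<Rightarrow> real"
  assumes F: "continuous_on UNIV F" and r: "0 \<le> r" "r < \<rho>"
    and neg: "\<And>w. cmod w \<le> r \<Longrightarrow> F w < 0" and pos: "\<And>w. cmod w = \<rho> \<Longrightarrow> F w > 0"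
  defines "S \<equiv> {w \<in> cball 0 \<rho>. F w = 0}"
  shows "\<exists>C\<in>components S. \<exists>s t. r < s \<and> s < \<rho> \<and> r < t \<and> t < \<rho> \<and> of_real s \<in> C \<and> of_real (- t) \<in> C"
proof -
  have cl: "closed {w. F w = 0}" "open {w. F w < 0}" "open {w. F w > 0}"
    using F by (auto intro!: closed_Collect_eq open_Collect_less continuous_on_const)
  have "S = cball 0 \<rho> \<inter> {w. F w = 0}" by (auto simp: S_def)
  then have "closed S" using cl by auto
  have sep: "\<not> connected_component (- S) 0 (of_real \<rho>)"
  proof
    assume "connected_component (- S) 0 (of_real \<rho>)"
    then obtain K where K: "connected K" "K \<subseteq> - S" "0 \<in> K" "of_real \<rho> \<in> K"
      by (auto simp: connected_component_def)
    \<comment> \<open>Where \<open>F\<close> does not vanish, its sign separates the centre from the circle.\<close>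
    define U V where "U = ball 0 \<rho> \<inter> {w. F w < 0}" and "V = - cball 0 \<rho> \<union> {w. F w > 0}"
    have "open U" "open V" using cl by (auto simp: U_def V_def)
    moreover have "K \<subseteq> U \<union> V"
    proof
      fix w assume "w \<in> K"
      then have "w \<notin> S" using K by auto
      then show "w \<in> U \<union> V" using pos[of w] by (fastforce simp: S_def U_def V_def)
    qed
    moreover have "U \<inter> V \<inter> K = {}" by (auto simp: U_def V_def)
    moreover have "0 \<in> U \<inter> K" using neg[of 0] r K by (auto simp: U_def)
    moreover have "of_real \<rho> \<in> V \<inter> K" using pos[of "of_real \<rho>"] r K by (auto simp: V_def)
    ultimately show False using connectedD[OF K(1), of U V] by blast
  qed
  from separation_by_component_closed_pointwise[OF \<open>closed S\<close> sep]
  obtain C where C: "C \<in> components S" "\<not> connected_component (- C) 0 (of_real \<rho>)" by auto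
  have CS: "C \<subseteq> S" using C in_components_subset by blast
  have circ: "connected (sphere (0::complex) \<rho>)" by (rule connected_sphere) simp
  have hit: "\<exists>s. r < s \<and> s < \<rho> \<and> of_real s * u \<in> C" if u: "cmod u = 1" for u
  proof (rule ccontr)
    assume no: "\<not> ?thesis"
    define L where "L = (\<lambda>s. of_real s * u) ` {0..\<rho>}"
    have "connected L" unfolding L_def
      by (intro connected_continuous_image continuous_intros connected_Icc)
    then have "connected (L \<union> sphere 0 \<rho>)"
    proof (rule connected_Un[OF _ circ])
      have "of_real \<rho> * u \<in> L \<inter> sphere 0 \<rho>" using r u by (auto simp: L_def norm_mult)
      then show "L \<inter> sphere 0 \<rho> \<noteq> {}" by blast
    qed
    moreover have "L \<union> sphere 0 \<rho> \<subseteq> - C"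
    proof
      fix w assume "w \<in> L \<union> sphere 0 \<rho>"
      then show "w \<in> - C"
      proof
        assume "w \<in> sphere 0 \<rho>"
        then show ?thesis using pos[of w] CS by (auto simp: S_def)
      next
        assume "w \<in> L"
        then obtain s where s: "0 \<le> s" "s \<le> \<rho>" "w = of_real s * u" by (auto simp: L_def)
        have cw: "cmod w = s" using s u by (simp add: norm_mult)
        show ?thesis
        proof
          assume "w \<in> C"
          then have "F w = 0" using CS by (auto simp: S_def)
          then have "r < s" "s \<noteq> \<rho>" using neg[of w] pos[of w] cw by force+
          then show False using no s \<open>w \<in> C\<close> by auto
        qed
      qed
    qed
    moreover have "0 \<in> L" using r by (auto simp: L_def intro!: image_eqI[of _ _ 0])
    moreover have "of_real \<rho> \<in> sphere (0::complex) \<rho>" using r by auto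
    ultimately have "connected_component (- C) 0 (of_real \<rho>)"
      unfolding connected_component_def by (intro exI[of _ "L \<union> sphere 0 \<rho>"]) auto
    with C show False by simp
  qed
  from hit[of 1] hit[of "-1"] obtain s t where "r < s" "s < \<rho>" "of_real s \<in> C" "r < t" "t < \<rho>"
      "of_real (- t) \<in> C" by auto
  with C show ?thesis by blast
qed

section \<open>Disks in the projective plane\<close>

text \<open>The affine chart around \<open>[1 : 0 : 0]\<close>, magnified by the factor \<open>1 / \<kappa>\<close>. With \<open>\<kappa> = 1 / sqrt d\<close> it
shows the polynomial at the scale of its typical features.\<close>

definition disk_vec :: "real \<Rightarrow> complex \<Rightarrow> real^3" where
  "disk_vec \<kappa> w = vector [1, \<kappa> * Re w, \<kappa> * Im w]"

lemma disk_vec_nth [simp]: "disk_vec \<kappa> w $ 1 = 1" "disk_vec \<kappa> w $ 2 = \<kappa> * Re w"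
    "disk_vec \<kappa> w $ 3 = \<kappa> * Im w"
  by (simp_all only: disk_vec_def vector_3)

lemma disk_vec_neq_0: "disk_vec \<kappa> w \<noteq> 0"
proof
  assume "disk_vec \<kappa> w = 0"
  then have "disk_vec \<kappa> w $ 1 = 0" by simp
  then show False by simp
qed

lemma inner_disk_vec: "disk_vec \<kappa> w \<bullet> disk_vec \<kappa> w' = 1 + \<kappa>\<^sup>2 * (Re w * Re w' + Im w * Im w')"
  by (simp add: inner_vec_def sum_3 power2_eq_square algebra_simps)

lemma norm_disk_vec: "norm (disk_vec \<kappa> w) = sqrt (1 + (\<kappa> * cmod w)\<^sup>2)"
proof -
  have "disk_vec \<kappa> w \<bullet> disk_vec \<kappa> w = 1 + (\<kappa> * cmod w)\<^sup>2"
    by (simp only: inner_disk_vec power_mult_distrib cmod_power2 power2_eq_square[of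
        "Re w"] power2_eq_square[of "Im w"])
  then show ?thesis by (simp add: norm_eq_sqrt_inner)
qed

lemma continuous_disk_vec: "continuous_on UNIV (disk_vec \<kappa>)"
proof -
  have "disk_vec \<kappa> w = axis 1 1 + (\<kappa> * Re w) *\<^sub>R axis 2 1 + (\<kappa> * Im w) *\<^sub>R axis 3 1" for w
    by (auto simp: vec_eq_iff forall_3 axis_def)
  then have "disk_vec \<kappa> = (\<lambda>w. axis 1 1 + (\<kappa> * Re w) *\<^sub>R axis 2 1 + (\<kappa> * Im w) *\<^sub>R axis 3 1)"
      by (rule ext)
  then show ?thesis by (simp only:) (intro continuous_intros)
qed

lemma continuous_hpoly: "continuous_on UNIV (hpoly d (a :: nat^3 \<Rightarrow> real))"
  unfolding hpoly_def[abs_def] monomial_def by (intro continuous_intros)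

lemma vanishes_abs_rp2: "X \<noteq> 0 \<Longrightarrow> vanishes d a (abs_rp2 X) \<longleftrightarrow> hpoly d a X = 0"
  by (intro vanishes.abs_eq) (auto intro: exI[of _ 1])

definition disk_map :: "(real^3 \<Rightarrow> real^3) \<Rightarrow> real \<Rightarrow> complex \<Rightarrow> rp2" where
  "disk_map R \<kappa> w = abs_rp2 (R (disk_vec \<kappa> w))"

context
  fixes R :: "real^3 \<Rightarrow> real^3" and \<kappa> :: real
  assumes R: "orthogonal_transformation R" and \<kappa>: "\<kappa> > 0"
begin

lemma R_disk_vec_neq_0: "R (disk_vec \<kappa> w) \<noteq> 0"
  using R disk_vec_neq_0[of \<kappa> w] by (metis norm_eq_zero orthogonal_transformation_norm)

lemma dist_disk_map:
  "dist (disk_map R \<kappa> w) (disk_map R \<kappa> w') =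
    arccos (\<bar>disk_vec \<kappa> w \<bullet> disk_vec \<kappa> w'\<bar> / (norm (disk_vec \<kappa> w) * norm (disk_vec \<kappa> w')))"
  unfolding disk_map_def dist_rp2_def fs_dist_abs[OF R_disk_vec_neq_0 R_disk_vec_neq_0]
  using R by (simp add: orthogonal_transformation_norm orthogonal_transformation_def)

text \<open>The distance of two image points is a continuous function of either argument that vanishes on the
diagonal.\<close>

lemma continuous_disk_map: "continuous_on UNIV (disk_map R \<kappa>)"
proof -
  have "((\<lambda>w. disk_map R \<kappa> w) \<longlongrightarrow> disk_map R \<kappa> v) (at v)" for v
  proof -
    let ?g = "\<lambda>w. \<bar>disk_vec \<kappa> w \<bullet> disk_vec \<kappa> v\<bar> / (norm (disk_vec \<kappa> w) * norm (disk_vec \<kappa> v))"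
    have "\<bar>?g w\<bar> \<le> 1" for w
      using Cauchy_Schwarz_ineq2[of "disk_vec \<kappa> w" "disk_vec \<kappa> v"] disk_vec_neq_0
      by (simp add: divide_le_eq_1 zero_less_mult_iff)
    then have b: "-1 \<le> ?g w \<and> ?g w \<le> 1" for w by (meson abs_le_D1 abs_le_D2 minus_le_iff)
    have "continuous_on UNIV (\<lambda>w. arccos (?g w))"
      using b by (intro continuous_on_arccos continuous_intros continuous_disk_vec) (auto simp:
          disk_vec_neq_0)
    then have "isCont (\<lambda>w. arccos (?g w)) v"
      unfolding continuous_on_eq_continuous_at[OF open_UNIV] by (rule bspec) simp
    then have "((\<lambda>w. arccos (?g w)) \<longlongrightarrow> arccos (?g v)) (at v)"
      by (simp only: isCont_def)
    moreover have "?g v = 1" using disk_vec_neq_0[of \<kappa> v]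
        by (simp add: dot_square_norm power2_eq_square)
    ultimately have "((\<lambda>w. dist (disk_map R \<kappa> w) (disk_map R \<kappa> v)) \<longlongrightarrow> 0) (at v)"
      by (simp only: dist_disk_map arccos_1)
    then show ?thesis by (rule tendsto_dist_iff[THEN iffD2])
  qed
  then show ?thesis by (simp add: continuous_on_eq_continuous_at isCont_def)
qed

text \<open>At distance \<open>0\<close> the Cauchy-Schwarz inequality is an equality, so the two vectors are proportional, and
their first coordinates are both \<open>1\<close>.\<close>

lemma inj_disk_map: "inj (disk_map R \<kappa>)"
proof (rule injI)
  fix w w' assume "disk_map R \<kappa> w = disk_map R \<kappa> w'"
  then have "dist (disk_map R \<kappa> w) (disk_map R \<kappa> w') = 0" by simp
  let ?v = "disk_vec \<kappa> w" and ?v' = "disk_vec \<kappa> w'"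
  have pos: "norm ?v > 0" "norm ?v' > 0" using disk_vec_neq_0 by auto
  define g where "g = \<bar>?v \<bullet> ?v'\<bar> / (norm ?v * norm ?v')"
  have "\<bar>g\<bar> \<le> 1"
    using Cauchy_Schwarz_ineq2[of ?v ?v'] pos by (simp add: g_def divide_le_eq_1 zero_less_mult_iff)
  moreover have "arccos g = 0"
    using \<open>dist _ _ = 0\<close> by (simp only: dist_disk_map g_def)
  ultimately have "g = 1" using cos_arccos_abs[of g] by simp
  then have "\<bar>?v \<bullet> ?v'\<bar> / (norm ?v * norm ?v') = 1" by (simp only: g_def)
  then have "\<bar>?v \<bullet> ?v'\<bar> = norm ?v * norm ?v'" using pos by (simp add: divide_eq_eq split: if_splits)
  then have "norm ?v *\<^sub>R ?v' = norm ?v' *\<^sub>R ?v \<or> norm ?v *\<^sub>R ?v' = - norm ?v' *\<^sub>R ?v"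
    by (simp add: norm_cauchy_schwarz_abs_eq)
  then have "\<exists>c. ?v' = c *\<^sub>R ?v"
  proof
    assume "norm ?v *\<^sub>R ?v' = norm ?v' *\<^sub>R ?v"
    then have "(1 / norm ?v) *\<^sub>R (norm ?v *\<^sub>R ?v') = (1 / norm ?v) *\<^sub>R (norm ?v' *\<^sub>R ?v)" by simp
    then show ?thesis using pos by auto
  next
    assume "norm ?v *\<^sub>R ?v' = - norm ?v' *\<^sub>R ?v"
    then have "(1 / norm ?v) *\<^sub>R (norm ?v *\<^sub>R ?v') = (1 / norm ?v) *\<^sub>R (- norm ?v' *\<^sub>R ?v)" by simp
    then show ?thesis using pos by (intro exI[of _ "- norm ?v' / norm ?v"]) auto
  qed
  then obtain c where c: "?v' = c *\<^sub>R ?v" by blast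
  have "?v' $ 1 = c * ?v $ 1" "?v' $ 2 = c * ?v $ 2" "?v' $ 3 = c * ?v $ 3" by (simp_all add: c)
  then show "w = w'" using \<kappa> by (simp add: complex_eq_iff)
qed

lemma dist_disk_map_0: "dist (disk_map R \<kappa> w) (disk_map R \<kappa> 0) = arctan (\<kappa> * cmod w)"
proof -
  have "dist (disk_map R \<kappa> w) (disk_map R \<kappa> 0) = arccos (cos (arctan (\<kappa> * cmod w)))"
    unfolding dist_disk_map inner_disk_vec norm_disk_vec by (simp add: cos_arctan)
  then show ?thesis using \<kappa> arctan_bounded[of "\<kappa>
      * cmod w"] by (simp add: arccos_cos zero_le_arctan_iff)
qed

text \<open>A Euclidean disk in the chart around \<open>R [1 : 0 : 0]\<close> is a Fubini-Study disk, in particular open: the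
distance to the centre is the arctangent of the affine radius.\<close>

lemma disk_map_image_ball:
  assumes "\<rho> > 0"
  shows "disk_map R \<kappa> ` ball 0 \<rho> = ball (disk_map R \<kappa> 0) (arctan (\<kappa> * \<rho>))"
proof
  show "disk_map R \<kappa> ` ball 0 \<rho> \<subseteq> ball (disk_map R \<kappa> 0) (arctan (\<kappa> * \<rho>))"
    using \<kappa> by (auto simp: dist_commute[of "disk_map R \<kappa> 0"] dist_disk_map_0 arctan_less_iff)
  show "ball (disk_map R \<kappa> 0) (arctan (\<kappa> * \<rho>)) \<subseteq> disk_map R \<kappa> ` ball 0 \<rho>"
  proof
    fix p assume p: "p \<in> ball (disk_map R \<kappa> 0) (arctan (\<kappa> * \<rho>))"
    obtain X where X: "norm X = 1" "p = abs_rp2 X" by (rule rp2_unit_rep)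
    then have X0: "X \<noteq> 0" by auto
    have "surj R" using orthogonal_transformation_surj[OF R] .
    then obtain Y where Y: "X = R Y" unfolding surj_def by blast
    have nY: "norm Y = 1" using X Y R by (simp add: orthogonal_transformation_norm)
    have sq: "(Y $ 1)\<^sup>2 + (Y $ 2)\<^sup>2 + (Y $ 3)\<^sup>2 = 1"
      using nY by (simp add: norm_vec_def L2_set_def sum_3 real_sqrt_eq_1_iff)
    have "dist (disk_map R \<kappa> 0) p = arccos \<bar>Y $ 1\<bar>"
    proof -
      have "R (disk_vec \<kappa> 0) \<bullet> X = disk_vec \<kappa> 0 \<bullet> Y" using R
          by (simp add: Y orthogonal_transformation_def)
      also have "\<dots> = Y $ 1" by (simp add: inner_vec_def sum_3)
      finally show ?thesis unfolding disk_map_def X(2) dist_rp2_def fs_dist_abs[OF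
          R_disk_vec_neq_0 X0]
        using X R by (simp add: orthogonal_transformation_norm norm_disk_vec)
    qed
    with p have lt: "arccos \<bar>Y $ 1\<bar> < arctan (\<kappa> * \<rho>)" by simp
    have "(Y $ 1)\<^sup>2 \<le> 1" using sq zero_le_power2[of "Y $ 2"] zero_le_power2[of "Y $ 3"] by linarith
    then have Y1: "\<bar>Y $ 1\<bar> \<le> 1" by (simp add: abs_square_le_1)
    have "cos (arctan (\<kappa> * \<rho>)) < cos (arccos \<bar>Y $ 1\<bar>)"
      using lt arccos_lbound[of "\<bar>Y $ 1\<bar>"] Y1 arctan_ubound[of "\<kappa> * \<rho>"] pi_gt_zero
      by (intro cos_monotone_0_pi) linarith+
    then have lt2: "1 / sqrt (1 + (\<kappa> * \<rho>)\<^sup>2) < \<bar>Y $ 1\<bar>" using Y1 by (simp add: cos_arctan)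
    moreover have s1: "sqrt (1 + (\<kappa> * \<rho>)\<^sup>2) > 0" by (simp add: add_pos_nonneg)
    ultimately have Y10: "Y $ 1 \<noteq> 0" by (metis abs_zero less_asym zero_less_divide_1_iff)
    define w where "w = Complex (Y $ 2 / Y $ 1 / \<kappa>) (Y $ 3 / Y $ 1 / \<kappa>)"
    have vec: "disk_vec \<kappa> w = (1 / Y $ 1) *\<^sub>R Y"
      using \<kappa> Y10 by (auto simp: vec_eq_iff forall_3 w_def)
    have "1 < \<bar>Y $ 1\<bar> * sqrt (1 + (\<kappa> * \<rho>)\<^sup>2)" using lt2 s1 by (simp add: divide_less_eq)
    then have "1\<^sup>2 < (\<bar>Y $ 1\<bar> * sqrt (1 + (\<kappa> * \<rho>)\<^sup>2))\<^sup>2" by (intro power_strict_mono) auto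
    then have "1 < (Y $ 1)\<^sup>2 * (1 + (\<kappa> * \<rho>)\<^sup>2)" by (simp add: power_mult_distrib)
    then have k: "(Y $ 2)\<^sup>2 + (Y $ 3)\<^sup>2 < (Y $ 1)\<^sup>2 * (\<kappa> * \<rho>)\<^sup>2" using sq
        by (simp add: distrib_left)
    have "(cmod w)\<^sup>2 = ((Y $ 2)\<^sup>2 + (Y $ 3)\<^sup>2) / ((Y $ 1)\<^sup>2 * \<kappa>\<^sup>2)"
      by (simp add: cmod_power2 w_def power_divide power_mult_distrib add_divide_distrib)
    also have "\<dots> < \<rho>\<^sup>2" using k \<kappa> Y10 by (simp add: divide_less_eq power_mult_distrib mult_ac)
    finally have "cmod w < \<rho>" using assms by (simp add: power_less_imp_less_base)
    moreover have "disk_map R \<kappa> w = p"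
    proof -
      have "R (disk_vec \<kappa> w) = (1 / Y $ 1) *\<^sub>R X"
        unfolding vec Y using R by (simp add: orthogonal_transformation_def linear_cmul)
      then show ?thesis unfolding disk_map_def X(2) using R_disk_vec_neq_0[of w] X0 Y10
        by (intro abs_rp2_eqI[of _ _ "Y $ 1"]) auto
    qed
    ultimately show "p \<in> disk_map R \<kappa> ` ball 0 \<rho>" by (auto intro!: image_eqI[of _ _ w])
  qed
qed

text \<open>The curve avoids the boundary of the disk, so a connected part of it that meets the disk stays inside.
There the chart is a homeomorphism, by compactness, and components correspond to components.\<close>

lemma disk_map_component:
  assumes \<rho>: "\<rho> > 0" and C: "C \<in> components {w \<in> cball 0 \<rho>. disk_map R \<kappa> w \<in> Z}"
    and bd: "\<And>w. cmod w = \<rho> \<Longrightarrow> disk_map R \<kappa> w \<notin> Z"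
  shows "disk_map R \<kappa> ` C \<in> components Z" "disk_map R \<kappa> ` C
      \<subseteq> ball (disk_map R \<kappa> 0) (arctan (\<kappa> * \<rho>))"
proof -
  let ?\<Phi> = "disk_map R \<kappa>" and ?S = "{w \<in> cball 0 \<rho>. disk_map R \<kappa> w \<in> Z}"
  have CS: "C \<subseteq> ?S" "connected C" "C \<noteq> {}"
      using in_components_subset[OF C] in_components_connected[OF C] in_components_nonempty[OF C]
      by auto
  have "C \<subseteq> ball 0 \<rho>" using CS(1) bd by force
  then show sub: "?\<Phi> ` C \<subseteq> ball (?\<Phi> 0) (arctan (\<kappa> * \<rho>))"
    unfolding disk_map_image_ball[OF \<rho>, symmetric] by auto
  have cont: "continuous_on A ?\<Phi>" for A using continuous_disk_map continuous_on_subset by blast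
  have closed: "closed (?\<Phi> ` cball 0 \<rho>)"
    by (intro compact_imp_closed compact_continuous_image cont) auto
  have max: "K \<subseteq> ?\<Phi> ` C" if K: "connected K" "?\<Phi> ` C \<subseteq> K" "K \<subseteq> Z" for K
  proof -
    let ?D = "ball (?\<Phi> 0) (arctan (\<kappa> * \<rho>))"
    have split: "?\<Phi> ` cball 0 \<rho> \<inter> Z \<subseteq> ?D"
      unfolding disk_map_image_ball[OF \<rho>, symmetric] using bd by (force simp: less_le)
    have D: "?D \<subseteq> ?\<Phi> ` cball 0 \<rho>" unfolding disk_map_image_ball[OF \<rho>, symmetric]
        by (intro image_mono) auto
    have "K \<subseteq> ?D \<union> - (?\<Phi> ` cball 0 \<rho>)" using K split by blast
    moreover have "?D \<inter> - (?\<Phi> ` cball 0 \<rho>) \<inter> K = {}" using D by blast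
    moreover have "?D \<inter> K \<noteq> {}" using sub K CS by blast
    ultimately have "- (?\<Phi> ` cball 0 \<rho>) \<inter> K = {}"
      using connectedD[OF K(1), of ?D "- (?\<Phi> ` cball 0 \<rho>)"] closed by auto
    then have KD: "K \<subseteq> ?\<Phi> ` cball 0 \<rho>" by blast
    define g where "g = inv ?\<Phi>"
    have g: "g (?\<Phi> w) = w" for w unfolding g_def by (rule inv_f_f[OF inj_disk_map])
    have "continuous_on (?\<Phi> ` cball 0 \<rho>) g"
      by (rule continuous_on_inv[OF cont]) (auto simp: g)
    then have "connected (g ` K)" using KD K
        by (intro connected_continuous_image) (auto intro: continuous_on_subset)
    moreover have "g ` K \<subseteq> ?S" using KD K by (force simp: g)
    moreover have "C \<inter> g ` K \<noteq> {}"
    proof -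
      obtain c where "c \<in> C" using CS by blast
      then have "c \<in> g ` K" using K(2) by (intro image_eqI[of _ _ "?\<Phi> c"]) (auto simp: g)
      then show ?thesis using \<open>c \<in> C\<close> by blast
    qed
    ultimately have "g ` K \<subseteq> C" using components_maximal[OF C] by blast
    moreover have "K \<subseteq> ?\<Phi> ` (g ` K)" using KD by (force simp: g)
    ultimately show ?thesis by blast
  qed
  have "connected (?\<Phi> ` C)" by (intro connected_continuous_image cont CS)
  moreover have "?\<Phi> ` C \<subseteq> Z" using CS(1) by blast
  moreover have "K = ?\<Phi> ` C" if "K \<noteq> {} \<and> ?\<Phi> ` C \<subseteq> K \<and> K \<subseteq> Z \<and> connected K" for K
    using max[of K] that by (intro subset_antisym) simp_all
  ultimately show "?\<Phi> ` C \<in> components Z"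
    unfolding in_components_maximal using CS(3) by simp
qed

text \<open>Two points on opposite rays from the centre lie on a geodesic through it, so their distances to the
centre add up. The bounds on \<open>s\<close> and \<open>t\<close> keep the sum at most \<open>\<pi> / 2\<close>, the diameter of the projective
plane.\<close>

lemma dist_disk_map_opposite:
  assumes "0 \<le> s" "0 \<le> t" "\<kappa> * s \<le> 1" "\<kappa> * t \<le> 1"
  shows "dist (disk_map R \<kappa> (of_real s)) (disk_map R \<kappa> (of_real (- t)))
      = arctan (\<kappa> * s) + arctan (\<kappa> * t)"
proof -
  define x y where "x = \<kappa> * s" and "y = \<kappa> * t"
  have xy: "0 \<le> x" "x \<le> 1" "0 \<le> y" "y \<le> 1" using assms \<kappa> by (auto simp: x_def y_def)
  have p: "x * y \<le> 1" using mult_mono[of x 1 y 1] xy by simp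
  have "dist (disk_map R \<kappa> (of_real s)) (disk_map R \<kappa> (of_real (- t))) =
    arccos ((1 - x * y) / (sqrt (1 + x\<^sup>2) * sqrt (1 + y\<^sup>2)))"
    unfolding dist_disk_map inner_disk_vec norm_disk_vec using assms p
    by (simp add: x_def y_def power2_eq_square algebra_simps)
  also have "(1 - x * y) / (sqrt (1 + x\<^sup>2) * sqrt (1 + y\<^sup>2)) = cos (arctan x + arctan y)"
    by (simp add: cos_add cos_arctan sin_arctan diff_divide_distrib)
  also have "arccos \<dots> = arctan x + arctan y"
    using xy arctan_ubound[of x] arctan_ubound[of y]
        by (intro arccos_cos) (auto simp: zero_le_arctan_iff)
  finally show ?thesis by (simp add: x_def y_def)
qed

text \<open>The length is estimated by the distance between the points in which the component meets two opposite
radii. This loses a factor \<open>\<pi>\<close> against the circumference of the inner disk, which the final choice of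
radii can afford.\<close>

lemma long_component_in_disk:
  fixes a :: "nat^3 \<Rightarrow> real"
  assumes r: "0 \<le> r" "r < \<rho>" "\<kappa> * \<rho> \<le> 1"
    and neg: "\<And>w. cmod w \<le> r \<Longrightarrow> hpoly d a (R (disk_vec \<kappa> w)) < 0"
    and pos: "\<And>w. cmod w = \<rho> \<Longrightarrow> hpoly d a (R (disk_vec \<kappa> w)) > 0"
  shows "\<exists>C\<in>components (real_curve d a). C \<subseteq> ball (disk_map R \<kappa> 0) (arctan (\<kappa> * \<rho>))
      \<and> ennreal (2 * arctan (\<kappa> * r)) \<le> curve_length C"
proof -
  let ?F = "\<lambda>w. hpoly d a (R (disk_vec \<kappa> w))"
  have "linear R" using R by (simp add: orthogonal_transformation_def)
  then have "continuous_on UNIV R" by (intro linear_continuous_on) (simp add: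
      linear_conv_bounded_linear)
  then have contF: "continuous_on UNIV ?F"
    by (intro continuous_on_compose2[OF continuous_hpoly] continuous_on_compose2[OF _
        continuous_disk_vec]) auto
  have zero: "disk_map R \<kappa> w \<in> real_curve d a \<longleftrightarrow> ?F w = 0" for w
    by (simp add: real_curve_def disk_map_def vanishes_abs_rp2 R_disk_vec_neq_0)
  obtain C s t where C: "C \<in> components {w \<in> cball 0 \<rho>. ?F w = 0}" and st: "r < s" "s < \<rho>" "r < t"
      "t < \<rho>"
    "of_real s \<in> C" "of_real (- t) \<in> C"
    using separating_zero_component[OF contF r(1,2) neg pos] by blast
  have \<rho>: "\<rho> > 0" using r by linarith
  have C': "C \<in> components {w \<in> cball 0 \<rho>. disk_map R \<kappa> w \<in> real_curve d a}" using C
      by (simp add: zero)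
  have bd: "disk_map R \<kappa> w \<notin> real_curve d a" if "cmod w = \<rho>" for w using pos[OF that]
      by (simp add: zero)
  note comp = disk_map_component[OF \<rho> C' bd]
  have le: "\<kappa> * s \<le> 1" "\<kappa> * t \<le> 1" "\<kappa> * r \<le> \<kappa> * s" "\<kappa> * r \<le> \<kappa> * t"
    using order_trans[OF mult_left_mono[of s \<rho> \<kappa>] r(3)] order_trans[OF mult_left_mono[of t \<rho> \<kappa>]
        r(3)] st \<kappa> by auto
  have "2 * arctan (\<kappa> * r) \<le> arctan (\<kappa> * s) + arctan (\<kappa> * t)"
    using le arctan_le_iff[of "\<kappa> * r" "\<kappa> * s"] arctan_le_iff[of "\<kappa> * r" "\<kappa> * t"] by linarith
  also have "\<dots> = dist (disk_map R \<kappa> (of_real s)) (disk_map R \<kappa> (of_real (- t)))"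
    using st r le by (intro dist_disk_map_opposite[symmetric]) auto
  finally have "ennreal (2 * arctan (\<kappa> * r))
      \<le> ennreal (dist (disk_map R \<kappa> (of_real s)) (disk_map R \<kappa> (of_real (- t))))"
    by (rule ennreal_leI)
  also have "\<dots> \<le> curve_length (disk_map R \<kappa> ` C)"
    using st comp(1) in_components_connected by (intro curve_length_ge_dist) auto
  finally show ?thesis using comp by blast
qed

end

section \<open>The size of the noise\<close>

lemma sum_inverse_squares_le: "(\<Sum>i\<le>n. 1 / (1 + real i)\<^sup>2) \<le> 2"
proof -
  have "(\<Sum>i\<le>n. 1 / (1 + real i)\<^sup>2) \<le> 2 - 1 / (1 + real n)"
  proof (induction n)
    case (Suc n)
    define x where "x = 1 + real n"
    have x: "x > 0" by (simp add: x_def)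
    have "1 / (x + 1)\<^sup>2 \<le> 1 / (x * (x + 1))"
      using x by (intro divide_left_mono) (auto simp: power2_eq_square)
    also have "\<dots> = 1 / x - 1 / (x + 1)" using x by (simp add: field_simps)
    finally show ?case using Suc by (simp add: x_def add_ac)
  qed simp
  also have "\<dots> \<le> 2" by simp
  finally show ?thesis .
qed

text \<open>An upper bound, up to constants, for the contribution of one affine variable to the noise. The factor
\<open>1 + i\<close> comes from the admitted size of the coefficients.\<close>

definition weighted_exp_sum :: "nat \<Rightarrow> real \<Rightarrow> real" where
  "weighted_exp_sum n x = (\<Sum>i\<le>n. (1 + real i) * \<bar>x\<bar> ^ i / sqrt (fact i))"

text \<open>By the Cauchy-Schwarz inequality, applied to \<open>(1 + i) \<theta>\<^bsup>-i/2\<^esup>\<close> and \<open>(sqrt \<theta> * \<bar>x\<bar>)\<^sup>i / sqrt (i!)\<close>,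
replacing the sum of absolute values by \<open>exp (x\<^sup>2 / 2)\<close> costs a constant factor and an arbitrarily small
loss in the exponent.\<close>

lemma weighted_exp_sum_bound:
  fixes \<theta> :: real
  assumes \<theta>: "\<theta> > 1"
  shows "\<exists>C>0. \<forall>n x. (weighted_exp_sum n x)\<^sup>2 \<le> C * exp (\<theta> * x\<^sup>2)"
proof -
  define u where "u = (\<lambda>i::nat. (1 + real i)\<^sup>2 * (1 / \<theta>) ^ i)"
  have "summable u"
  proof -
    define \<beta> where "\<beta> = (1 + 1 / \<theta>) / 2"
    have \<beta>: "\<beta> < 1" "\<beta> * \<theta> > 1" using \<theta> by (auto simp: \<beta>_def field_simps)
    have "\<forall>\<^sub>F i in sequentially. (2 + real i)\<^sup>2 \<le> (\<beta> * \<theta>) * (1 + real i)\<^sup>2"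
      using \<beta>(2) by real_asymp
    then obtain N where N: "\<And>i. i \<ge> N \<Longrightarrow> (2 + real i)\<^sup>2 \<le> (\<beta> * \<theta>) * (1 + real i)\<^sup>2"
      unfolding eventually_sequentially by blast
    show ?thesis
    proof (rule summable_ratio_test[OF \<beta>(1)])
      fix i assume "i \<ge> N"
      have p: "(1 / \<theta>) ^ Suc i \<ge> 0" using \<theta> by simp
      have nu: "norm (u k) = u k" for k using \<theta> by (simp add: u_def)
      have "norm (u (Suc i)) = (2 + real i)\<^sup>2 * (1 / \<theta>) ^ Suc i"
        unfolding nu by (simp add: u_def add_ac)
      also have "\<dots> \<le> (\<beta> * \<theta>) * (1 + real i)\<^sup>2 * (1 / \<theta>) ^ Suc i"
        by (intro mult_right_mono N \<open>i \<ge> N\<close> p)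
      also have "\<dots> = \<beta> * norm (u i)" unfolding nu using \<theta> by (simp add: u_def)
      finally show "norm (u (Suc i)) \<le> \<beta> * norm (u i)" .
    qed
  qed
  have u0: "u i \<ge> 0" for i using \<theta> by (simp add: u_def)
  define C where "C = suminf u + 1"
  have "suminf u \<ge> 0" using \<open>summable u\<close> u0 by (rule suminf_nonneg)
  then have C: "C > 0" by (simp add: C_def)
  have "(weighted_exp_sum n x)\<^sup>2 \<le> C * exp (\<theta> * x\<^sup>2)" for n x
  proof -
    have s\<theta>: "sqrt \<theta> > 0" using \<theta> by simp
    have "weighted_exp_sum n x = (\<Sum>i\<le>n. ((1 + real i) * (1 / sqrt \<theta>) ^ i)
        * ((sqrt \<theta> * \<bar>x\<bar>) ^ i / sqrt (fact i)))"
      unfolding weighted_exp_sum_def using s\<theta>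
          by (intro sum.cong refl) (simp add: power_mult_distrib power_divide)
    then have "(weighted_exp_sum n x)\<^sup>2
        \<le> (\<Sum>i\<le>n. ((1 + real i) * (1 / sqrt \<theta>) ^ i)\<^sup>2) * (\<Sum>i\<le>n. ((sqrt \<theta>
        * \<bar>x\<bar>) ^ i / sqrt (fact i))\<^sup>2)"
      by (simp only: Cauchy_Schwarz_ineq_sum)
    also have "(\<Sum>i\<le>n. ((1 + real i) * (1 / sqrt \<theta>) ^ i)\<^sup>2) = (\<Sum>i\<le>n. u i)"
    proof (intro sum.cong refl)
      fix i
      have "((1 / sqrt \<theta>) ^ i)\<^sup>2 = ((1 / sqrt \<theta>)\<^sup>2) ^ i"
          by (simp add: power_mult[symmetric] mult.commute)
      also have "(1 / sqrt \<theta>)\<^sup>2 = 1 / \<theta>" using \<theta> by (simp add: power_divide)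
      finally show "((1 + real i) * (1 / sqrt \<theta>) ^ i)\<^sup>2 = u i"
          by (simp add: u_def power_mult_distrib)
    qed
    also have "(\<Sum>i\<le>n. ((sqrt \<theta> * \<bar>x\<bar>) ^ i / sqrt (fact i))\<^sup>2) = (\<Sum>i\<le>n. (\<theta> * x\<^sup>2) ^ i / fact i)"
    proof (intro sum.cong refl)
      fix i
      have "((sqrt \<theta> * \<bar>x\<bar>) ^ i)\<^sup>2 = ((sqrt \<theta> * \<bar>x\<bar>)\<^sup>2) ^ i"
          by (simp add: power_mult[symmetric] mult.commute)
      also have "(sqrt \<theta> * \<bar>x\<bar>)\<^sup>2 = \<theta> * x\<^sup>2" using \<theta> by (simp add: power_mult_distrib)
      finally show "((sqrt \<theta> * \<bar>x\<bar>) ^ i / sqrt (fact i))\<^sup>2 = (\<theta> * x\<^sup>2) ^ i / fact i"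
          by (simp add: power_divide)
    qed
    also have "(\<Sum>i\<le>n. u i) * (\<Sum>i\<le>n. (\<theta> * x\<^sup>2) ^ i / fact i) \<le> C * exp (\<theta> * x\<^sup>2)"
    proof (intro mult_mono)
      show "(\<Sum>i\<le>n. u i) \<le> C"
        using sum_le_suminf[OF \<open>summable u\<close>, of "{..n}"] u0 by (simp add: C_def add_increasing2)
      show "(\<Sum>i\<le>n. (\<theta> * x\<^sup>2) ^ i / fact i) \<le> exp (\<theta> * x\<^sup>2)"
      proof -
        have "(\<lambda>i. (\<theta> * x\<^sup>2) ^ i / fact i) sums exp (\<theta> * x\<^sup>2)"
          using exp_converges[of "\<theta> * x\<^sup>2"] by (simp add: divide_inverse mult.commute)
        then show ?thesis using \<theta> by (intro sum_le_suminf[of _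
            "{..n}", THEN order_trans]) (auto simp: sums_iff)
      qed
      show "0 \<le> (\<Sum>i\<le>n. (\<theta> * x\<^sup>2) ^ i / fact i)" using \<theta> by (intro sum_nonneg) auto
    qed (use C in auto)
    finally show ?thesis .
  qed
  with C show ?thesis by blast
qed

lemma sum_exponents_le_product:
  fixes g :: "nat^3 \<Rightarrow> real"
  assumes "\<And>i j. i + j \<le> d \<Longrightarrow> g (expo d i j) \<le> u i * v j" "\<And>i. u i \<ge> 0" "\<And>j. v j \<ge> 0"
  shows "(\<Sum>\<gamma>\<in>exponents d. g \<gamma>) \<le> (\<Sum>i\<le>d. u i) * (\<Sum>j\<le>d. v j)"
proof -
  have "(\<Sum>\<gamma>\<in>exponents d. g \<gamma>) = (\<Sum>(i,j)\<in>(SIGMA i:{..d}. {..d - i}). g (expo d i j))"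
    using sum.reindex_bij_betw[OF bij_betw_expo, of g] by (simp add: split_beta')
  also have "\<dots> \<le> (\<Sum>(i,j)\<in>(SIGMA i:{..d}. {..d - i}). u i * v j)"
    by (intro sum_mono) (auto intro: assms(1))
  also have "\<dots> \<le> (\<Sum>(i,j)\<in>{..d} \<times> {..d}. u i * v j)"
    by (intro sum_mono2) (auto simp: assms)
  also have "\<dots> = (\<Sum>i\<le>d. u i) * (\<Sum>j\<le>d. v j)"
    by (simp add: sum_product sum.cartesian_product)
  finally show ?thesis .
qed

lemma multinom_expo: "i + j \<le> d \<Longrightarrow> multinom d (expo d i j)
    = fact d / (fact (d - i - j) * fact i * fact j)"
  by (simp add: multinom_def prod_UNIV_3)

lemma multinom_expo_le:
  assumes "i + j \<le> d"
  shows "multinom d (expo d i j) \<le> real d ^ (i + j) / (fact i * fact j)"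
proof -
  have "fact d div fact (d - (i + j)) \<le> (d ^ (i + j) :: nat)"
      by (rule fact_div_fact_le_pow[OF assms])
  moreover have "(fact (d - (i + j)) :: nat) dvd fact d" by (intro fact_dvd) auto
  ultimately have "fact d / fact (d - (i + j)) \<le> real d ^ (i + j)"
    by (metis of_nat_fact of_nat_le_iff of_nat_power real_of_nat_div)
  then have "fact d / fact (d - (i + j)) / (fact i * fact j) \<le> real d ^ (i + j) / (fact i * fact j)"
    by (intro divide_right_mono) auto
  then show ?thesis using assms by (simp add: multinom_expo mult.assoc)
qed

text \<open>Four times \<open>(1 + i) (1 + j)\<close> standard deviations of the coefficient of \<open>x\<^sup>i y\<^sup>j\<close>. The growth in \<open>i\<close> and \<open>j\<close>
makes the Chebyshev bounds summable uniformly in \<open>d\<close>, and is still slow enough to have no effect on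
the exponential order of the noise.\<close>

definition noise_radius :: "nat \<Rightarrow> nat^3 \<Rightarrow> real" where
  "noise_radius d \<gamma> = 4 * sqrt (coeff_scale d * multinom d \<gamma>)
      * ((1 + real (\<gamma> $ 2)) * (1 + real (\<gamma> $ 3)))"

lemma noise_radius_pos: "noise_radius d \<gamma> > 0"
  using coeff_scale_pos[of d] multinom_pos[of d \<gamma>] by (simp add: noise_radius_def add_pos_nonneg)

lemma noise_radius_sum: "(\<Sum>\<gamma>\<in>exponents d. coeff_scale d * multinom d \<gamma> / (noise_radius d \<gamma>)\<^sup>2)
    \<le> 1 / 4"
proof -
  have "coeff_scale d * multinom d \<gamma> / (noise_radius d \<gamma>)\<^sup>2
      = (1 / 16) * (1 / (1 + real (\<gamma> $ 2))\<^sup>2) * (1 / (1 + real (\<gamma> $ 3))\<^sup>2)" for \<gamma>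
    using coeff_scale_pos[of d] multinom_pos[of d \<gamma>]
        by (simp add: noise_radius_def power_mult_distrib)
  then have "(\<Sum>\<gamma>\<in>exponents d. coeff_scale d * multinom d \<gamma> / (noise_radius d \<gamma>)\<^sup>2)
     \<le> (\<Sum>i\<le>d. (1 / 16) * (1 / (1 + real i)\<^sup>2)) * (\<Sum>j\<le>d. 1 / (1 + real j)\<^sup>2)"
    by (intro sum_exponents_le_product) auto
  also have "\<dots> = (1 / 16) * (\<Sum>i\<le>d. 1 / (1 + real i)\<^sup>2) * (\<Sum>j\<le>d. 1 / (1 + real j)\<^sup>2)"
    by (simp only: sum_distrib_left)
  also have "\<dots> \<le> (1 / 16 * 2) * 2"
    by (intro mult_mono sum_inverse_squares_le mult_left_mono sum_nonneg) auto
  finally show ?thesis by simp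
qed

text \<open>The multinomial coefficient is at most \<open>d\<^bsup>i+j\<^esup> / (i! j!)\<close>. The power of \<open>d\<close> is cancelled by the
magnification of the chart, and the remaining double sum factorises.\<close>

lemma noise_bound:
  fixes e :: "nat^3 \<Rightarrow> real"
  assumes d: "d > 0" and e: "\<And>\<gamma>. \<gamma> \<in> exponents d \<Longrightarrow> \<bar>e \<gamma>\<bar> \<le> noise_radius d \<gamma>"
  shows "\<bar>hpoly d e (disk_vec (1 / sqrt d) w)\<bar> \<le>
    4 * sqrt (coeff_scale d) * (weighted_exp_sum d (Re w) * weighted_exp_sum d (Im w))"
proof -
  let ?k = "1 / sqrt (real d)" and ?s = "coeff_scale d"
  have "\<bar>hpoly d e (disk_vec ?k w)\<bar> \<le> (\<Sum>\<gamma>\<in>exponents d. noise_radius d \<gamma>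
      * \<bar>monomial \<gamma> (disk_vec ?k w)\<bar>)"
    unfolding hpoly_def by (rule order_trans[OF sum_abs]) (auto intro!: sum_mono mult_right_mono e
        simp: abs_mult)
  also have "\<dots> \<le> (\<Sum>i\<le>d. 4 * sqrt ?s * ((1 + real i) * \<bar>Re w\<bar> ^ i / sqrt (fact i)))
      * (\<Sum>j\<le>d. (1 + real j) * \<bar>Im w\<bar> ^ j / sqrt (fact j))"
  proof (rule sum_exponents_le_product)
    fix i j assume ij: "i + j \<le> d"
    let ?m = "multinom d (expo d i j)"
    have "sqrt ?m \<le> sqrt (real d ^ (i + j) / (fact i * fact j))"
      by (intro real_sqrt_le_mono multinom_expo_le ij)
    also have "\<dots> = sqrt d ^ (i + j) / (sqrt (fact i) * sqrt (fact j))"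
      by (simp add: real_sqrt_divide real_sqrt_mult real_sqrt_power)
    finally have "sqrt ?m * ?k ^ (i + j)
        \<le> sqrt d ^ (i + j) / (sqrt (fact i) * sqrt (fact j)) * ?k ^ (i + j)"
      by (intro mult_right_mono) auto
    also have "\<dots> = 1 / (sqrt (fact i) * sqrt (fact j))"
      using d by (simp add: power_divide)
    finally have m: "sqrt ?m * ?k ^ (i + j) \<le> 1 / (sqrt (fact i) * sqrt (fact j))" .
    have mono: "\<bar>monomial (expo d i j) (disk_vec ?k w)\<bar> = ?k ^ (i + j) * (\<bar>Re w\<bar> ^ i * \<bar>Im w\<bar> ^ j)"
      unfolding monomial_def prod_UNIV_3 expo_nth disk_vec_nth
      by (simp add: abs_mult power_abs power_mult_distrib power_add power_divide)
    have "noise_radius d (expo d i j) * \<bar>monomial (expo d i j) (disk_vec ?k w)\<bar> =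
      (4 * sqrt ?s * ((1 + real i) * (1 + real j)) * (\<bar>Re w\<bar> ^ i * \<bar>Im w\<bar> ^ j)) * (sqrt ?m
          * ?k ^ (i + j))"
      unfolding mono noise_radius_def by (simp add: real_sqrt_mult mult_ac)
    also have "\<dots> \<le> (4 * sqrt ?s * ((1 + real i) * (1 + real j)) * (\<bar>Re w\<bar> ^ i * \<bar>Im w\<bar> ^ j))
        * (1 / (sqrt (fact i) * sqrt (fact j)))"
      using coeff_scale_pos[of d] by (intro mult_left_mono m) (auto intro!: mult_nonneg_nonneg)
    also have "\<dots> = (4 * sqrt ?s * ((1 + real i) * \<bar>Re w\<bar> ^ i / sqrt (fact i)))
        * ((1 + real j) * \<bar>Im w\<bar> ^ j / sqrt (fact j))"
      by (simp add: mult_ac)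
    finally show "noise_radius d (expo d i j) * \<bar>monomial (expo d i j) (disk_vec ?k w)\<bar> \<le> \<dots>" .
  qed (use coeff_scale_pos[of d] in auto)
  also have "\<dots> = 4 * sqrt ?s * (weighted_exp_sum d (Re w) * weighted_exp_sum d (Im w))"
    by (simp only: weighted_exp_sum_def sum_distrib_left[symmetric] mult.assoc)
  finally show ?thesis .
qed

section \<open>The barrier\<close>

text \<open>The coefficients of the polynomial whose values in the rescaled chart are proportional to
\<open>t (\<bar>w\<bar>\<^sup>2 / A - 1)\<close>: it is negative in a disk and positive outside.\<close>

definition barrier :: "nat \<Rightarrow> real \<Rightarrow> real \<Rightarrow> nat^3 \<Rightarrow> real" where
  "barrier d t A \<gamma> = sqrt (coeff_scale d) * t
      * (if \<gamma> = expo d 0 0 then -1 else if \<gamma> = expo d 2 0 \<or> \<gamma> = expo d 0 2 then d / A else 0)"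

lemma expo_eq_iff: "i + j \<le> d \<Longrightarrow> i' + j' \<le> d \<Longrightarrow> expo d i j = expo d i' j' \<longleftrightarrow> i = i' \<and> j = j'"
  by (auto simp: vec_eq_iff forall_3)

lemma sum_barrier_support:
  assumes "d \<ge> 2" "\<And>\<gamma>. barrier d t A \<gamma> = 0 \<Longrightarrow> g \<gamma> = (0::real)"
  shows "(\<Sum>\<gamma>\<in>exponents d. g \<gamma>) = g (expo d 0 0) + g (expo d 2 0) + g (expo d 0 2)"
proof -
  have "(\<Sum>\<gamma>\<in>exponents d. g \<gamma>) = (\<Sum>\<gamma>\<in>{expo d 0 0, expo d 2 0, expo d 0 2}. g \<gamma>)"
  proof (intro sum.mono_neutral_right ballI)
    show "{expo d 0 0, expo d 2 0, expo d 0 2} \<subseteq> exponents d"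
      using assms(1) by (simp add: exponents_def sum_3)
    show "g \<gamma> = 0" if "\<gamma> \<in> exponents d - {expo d 0 0, expo d 2 0, expo d 0 2}" for \<gamma>
      using that by (intro assms(2)) (simp add: barrier_def)
  qed simp
  then show ?thesis using assms(1) by (simp add: expo_eq_iff)
qed

lemma barrier_value:
  assumes "d \<ge> 2"
  shows "hpoly d (barrier d t A) (disk_vec (1 / sqrt d) w)
      = sqrt (coeff_scale d) * t * ((cmod w)\<^sup>2 / A - 1)"
proof -
  have "hpoly d (barrier d t A) (disk_vec (1 / sqrt d) w) =
    sqrt (coeff_scale d) * t * (- 1 + d / A * ((1 / sqrt d) * Re w)\<^sup>2 + d / A * ((1 / sqrt d)
        * Im w)\<^sup>2)"
    unfolding hpoly_def using assms
    by (subst sum_barrier_support[of _ t A])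
      (auto simp: barrier_def expo_eq_iff monomial_def prod_UNIV_3 algebra_simps simp del:
          One_nat_def)
  also have "- 1 + d / A * ((1 / sqrt d) * Re w)\<^sup>2 + d / A * ((1 / sqrt d) * Im w)\<^sup>2
      = (cmod w)\<^sup>2 / A - 1"
    using assms by (simp add: power_mult_distrib power_divide cmod_power2 add_divide_distrib)
  finally show ?thesis .
qed

text \<open>The constant term alone contributes \<open>t\<^sup>2 / 2\<close>, and the quadratic terms at most as much once \<open>A\<close> is not
too small.\<close>

lemma barrier_cost:
  assumes d: "d \<ge> 2" and A: "A\<^sup>2 \<ge> 8"
  shows "(\<Sum>\<gamma>\<in>exponents d. (barrier d t A \<gamma>)\<^sup>2 / (2 * coeff_scale d * multinom d \<gamma>)) \<le> t\<^sup>2"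
proof -
  let ?s = "coeff_scale d"
  have s: "?s > 0" by (rule coeff_scale_pos)
  have "A \<noteq> 0" using A by auto
  have "(fact d :: real) = real d * (real d - 1) * fact (d - 2)"
    using d by (cases d; cases "d - 1") (auto simp: algebra_simps)
  then have m2: "multinom d (expo d 2 0) = real d * (real d - 1) / 2"
      "multinom d (expo d 0 2) = real d * (real d - 1) / 2"
    using d by (simp_all add: multinom_expo)
  have m0: "multinom d (expo d 0 0) = 1" by (simp add: multinom_expo)
  have "(\<Sum>\<gamma>\<in>exponents d. (barrier d t A \<gamma>)\<^sup>2 / (2 * ?s * multinom d \<gamma>)) =
     (sqrt ?s * t)\<^sup>2 / (2 * ?s) + 2 * ((sqrt ?s * t * (d / A))\<^sup>2 / (2 * ?s * (real d * (real d
         - 1) / 2)))"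
    using d by (subst sum_barrier_support[of _ t A]) (auto simp: barrier_def expo_eq_iff m0 m2)
  also have "\<dots> = t\<^sup>2 / 2 + t\<^sup>2 * (2 * real d / ((real d - 1) * A\<^sup>2))"
    using s d \<open>A \<noteq> 0\<close> by (simp add: power_mult_distrib power_divide field_simps power2_eq_square)
  also have "\<dots> \<le> t\<^sup>2 / 2 + t\<^sup>2 * (1 / 2)"
  proof (intro add_left_mono mult_left_mono)
    have "2 * real d * 2 \<le> (real d - 1) * 8" using d by simp
    also have "\<dots> \<le> (real d - 1) * A\<^sup>2" using d A by (intro mult_left_mono) auto
    finally show "2 * real d / ((real d - 1) * A\<^sup>2) \<le> 1 / 2" using d \<open>A \<noteq> 0\<close>
        by (simp add: divide_simps)
  qed auto
  finally show ?thesis by simp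
qed

text \<open>The radii are chosen as follows, with \<open>l\<close> in the role of \<open>ln (ln d)\<close>. The zero set of the barrier is the
circle \<open>\<bar>w\<bar>\<^sup>2 = 0.88 l\<close>, and its values on \<open>\<bar>w\<bar>\<^sup>2 \<le> 0.86 l\<close> and on \<open>\<bar>w\<bar>\<^sup>2 = 0.9 l\<close> are at least \<open>t / 44\<close> in
absolute value, because \<open>0.02 / 0.88 = 1 / 44\<close>. The noise there is at most \<open>4 C exp (1.05 / 2 * 0.9 l)\<close>,
where \<open>1.05 / 2 * 0.9 = 0.4725\<close>. The barrier wins if \<open>t\<close> exceeds \<open>176 C exp (0.4725 l)\<close>; for
\<open>l = ln (ln d)\<close> and \<open>t\<close> of order \<open>sqrt (ln d)\<close> this holds because \<open>0.4725 < 1/2\<close>. On the other hand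
\<open>0.86 > \<pi>\<^sup>2 / 12\<close>, which makes the diameter of the inner disk larger than the required length.\<close>

lemma long_component_event:
  "\<exists>C>0. \<forall>d R t l. d \<ge> 2 \<longrightarrow> orthogonal_transformation R \<longrightarrow> t > 0 \<longrightarrow> l \<ge> 4 \<longrightarrow> l \<le> real d
      \<longrightarrow> C * exp (0.4725 * l) < t \<longrightarrow>
    (\<exists>B\<in>sets (kostlan d). ennreal (exp (- t\<^sup>2 - 4 * t) / 2) \<le> emeasure (kostlan d) B \<and>
      (\<forall>a\<in>B. \<exists>K\<in>components (real_curve d a). K
          \<subseteq> ball (disk_map R (1 / sqrt d) 0) (arctan (sqrt (0.9 * l / d))) \<and>
         ennreal (2 * arctan (sqrt (0.86 * l / d))) \<le> curve_length K))"
proof -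
  obtain C where C: "C > 0" "\<And>n x. (weighted_exp_sum n x)\<^sup>2 \<le> C * exp (1.05 * x\<^sup>2)"
    using weighted_exp_sum_bound[of "1.05"] by auto
  have prod: "weighted_exp_sum n (Re w) * weighted_exp_sum n (Im w)
      \<le> C * exp (1.05 / 2 * (cmod w)\<^sup>2)" for n w
  proof (rule power2_le_imp_le)
    have "(weighted_exp_sum n (Re w) * weighted_exp_sum n (Im w))\<^sup>2
        \<le> (C * exp (1.05 * (Re w)\<^sup>2)) * (C * exp (1.05 * (Im w)\<^sup>2))"
      unfolding power_mult_distrib using C by (intro mult_mono) auto
    also have "\<dots> = (C * exp (1.05 / 2 * (cmod w)\<^sup>2))\<^sup>2"
      by (simp add: power_mult_distrib exp_double[symmetric] cmod_power2 exp_add[symmetric]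
          power2_eq_square[of C] algebra_simps)
    finally show "(weighted_exp_sum n (Re w) * weighted_exp_sum n (Im w))\<^sup>2 \<le> \<dots>" .
  qed (use C in auto)
  have main: "\<exists>B\<in>sets (kostlan d). ennreal (exp (- t\<^sup>2 - 4 * t) / 2) \<le> emeasure (kostlan d) B \<and>
      (\<forall>a\<in>B. \<exists>K\<in>components (real_curve d a). K
          \<subseteq> ball (disk_map R (1 / sqrt d) 0) (arctan (sqrt (0.9 * l / d))) \<and>
         ennreal (2 * arctan (sqrt (0.86 * l / d))) \<le> curve_length K)"
    if d: "d \<ge> 2" and R: "orthogonal_transformation R" and t: "t > 0" and l: "l \<ge> 4" "l \<le> real d"
      and big: "176 * C * exp (0.4725 * l) < t" for d R t l
  proof -
    obtain T where T: "\<And>a X. hpoly d a (R X) = hpoly d (\<lambda>\<gamma>. \<Sum>\<beta>\<in>exponents d. T \<gamma> \<beta> * a \<beta>) X"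
      "\<And>\<gamma> \<gamma>'. \<gamma> \<in> exponents d \<Longrightarrow> \<gamma>' \<in> exponents d \<Longrightarrow> (\<Sum>\<beta>\<in>exponents d. multinom d \<beta> * T \<gamma> \<beta> * T \<gamma>' \<beta>)
          = (if \<gamma> = \<gamma>' then multinom d \<gamma> else 0)"
      using orthogonal_coefficient_change[OF R, of d] by blast
    define A where "A = 0.88 * l"
    have A: "A\<^sup>2 \<ge> 8"
    proof -
      have "3\<^sup>2 \<le> A\<^sup>2" using l by (intro power_mono) (auto simp: A_def)
      then show ?thesis by simp
    qed
    define q where "q = barrier d t A"
    define B where "B = {a\<in>space (kostlan d). \<forall>\<gamma>\<in>exponents d. \<bar>(\<Sum>\<beta>\<in>exponents d. T \<gamma> \<beta> * a \<beta>)
        - q \<gamma>\<bar> < noise_radius d \<gamma>}"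
    \<comment> \<open>The shift costs \<open>H = t\<^sup>2\<close>, and \<open>\<tau> = 2 t\<close> is a deviation of at least two standard deviations.\<close>
    have "2 * t\<^sup>2 \<le> (2 * t)\<^sup>2" by (simp add: power2_eq_square)
    note window = kostlan_window_probability[where T=T and q=q and r="noise_radius d" and H="t\<^sup>2"
        and \<tau>="2 * t", OF T(2) noise_radius_pos noise_radius_sum
        barrier_cost[OF d A, of t, folded q_def] this, folded B_def]
    have B: "B \<in> sets (kostlan d)" "ennreal (exp (- t\<^sup>2 - 4 * t) / 2) \<le> emeasure (kostlan d) B"
      using window t by simp_all
    have comp: "\<exists>K\<in>components (real_curve d a). K
        \<subseteq> ball (disk_map R (1 / sqrt d) 0) (arctan (sqrt (0.9 * l / d))) \<and>
         ennreal (2 * arctan (sqrt (0.86 * l / d))) \<le> curve_length K" if a: "a \<in> B" for a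
    proof -
      define b where "b = (\<lambda>\<gamma>. \<Sum>\<beta>\<in>exponents d. T \<gamma> \<beta> * a \<beta>)"
      let ?s = "sqrt (coeff_scale d)" and ?k = "1 / sqrt (real d)"
      have s: "?s > 0" using coeff_scale_pos by simp
      have close: "\<bar>hpoly d a (R (disk_vec ?k w)) - ?s * t * ((cmod w)\<^sup>2 / A - 1)\<bar>
          \<le> ?s * (4 * C * exp (1.05 / 2 * (cmod w)\<^sup>2))" for w
      proof -
        have "hpoly d a (R (disk_vec ?k w)) - ?s * t * ((cmod w)\<^sup>2 / A - 1)
            = hpoly d (\<lambda>\<gamma>. b \<gamma> - q \<gamma>) (disk_vec ?k w)"
          unfolding barrier_value[OF d, symmetric] T(1) b_def[symmetric] q_def[symmetric]
          by (simp add: hpoly_def left_diff_distrib sum_subtractf)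
        also have "\<bar>\<dots>\<bar> \<le> 4 * ?s * (weighted_exp_sum d (Re w) * weighted_exp_sum d (Im w))"
          using a d by (intro noise_bound) (auto simp: B_def b_def less_imp_le)
        also have "\<dots> \<le> 4 * ?s * (C * exp (1.05 / 2 * (cmod w)\<^sup>2))"
          using s by (intro mult_left_mono prod) auto
        finally show ?thesis by (simp add: mult_ac)
      qed
      have small: "4 * C * exp (1.05 / 2 * x) < t / 44" if "x \<le> 0.9 * l" for x
      proof -
        have "4 * C * exp (1.05 / 2 * x) \<le> 4 * C * exp (0.4725 * l)"
          using C that by (intro mult_left_mono) auto
        also have "\<dots> < t / 44" using big by simp
        finally show ?thesis .
      qed
      define r \<rho> where "r = sqrt (0.86 * l)" and "\<rho> = sqrt (0.9 * l)"
      have r: "0 \<le> r" "r < \<rho>" using l by (auto simp: r_def \<rho>_def)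
      have sq: "r\<^sup>2 = 0.86 * l" "\<rho>\<^sup>2 = 0.9 * l" using l by (auto simp: r_def \<rho>_def)
      have ratio: "(0.86 * l) / A = 1 - 1 / 44" "(0.9 * l) / A = 1 + 1 / 44" using l
          by (auto simp: A_def field_simps)
      have k: "?k * r = sqrt (0.86 * l / d)" "?k * \<rho> = sqrt (0.9 * l / d)"
        unfolding r_def \<rho>_def real_sqrt_divide by (simp_all only: times_divide_eq_left mult_1)
      have k1: "?k * \<rho> \<le> 1" unfolding k using l d by (simp add: divide_le_eq)
      have A0: "A > 0" using l by (simp add: A_def)
      have neg: "hpoly d a (R (disk_vec ?k w)) < 0" if "cmod w \<le> r" for w
      proof -
        have w2: "(cmod w)\<^sup>2 \<le> 0.86 * l" unfolding sq(1)[symmetric] using that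
            by (intro power_mono) auto
        have "(cmod w)\<^sup>2 / A \<le> 1 - 1 / 44" unfolding ratio[symmetric] using A0 w2
            by (intro divide_right_mono) auto
        then have "(cmod w)\<^sup>2 / A - 1 \<le> - (1 / 44)" by linarith
        then have "t * ((cmod w)\<^sup>2 / A - 1) \<le> t * (- (1 / 44))" using t
            by (intro mult_left_mono) simp_all
        moreover have "4 * C * exp (1.05 / 2 * (cmod w)\<^sup>2) < t / 44" using w2 l
            by (intro small) auto
        ultimately have "t * ((cmod w)\<^sup>2 / A - 1) + 4 * C * exp (1.05 / 2 * (cmod w)\<^sup>2) < 0" by simp
        then have "?s * (t * ((cmod w)\<^sup>2 / A - 1) + 4 * C * exp (1.05 / 2 * (cmod w)\<^sup>2)) < 0"
            using s by (rule mult_pos_neg[rotated])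
        then show ?thesis using close[of w] by (simp add: distrib_left mult.assoc abs_le_iff)
      qed
      have pos: "hpoly d a (R (disk_vec ?k w)) > 0" if "cmod w = \<rho>" for w
      proof -
        have w2: "(cmod w)\<^sup>2 = 0.9 * l" unfolding that sq(2) ..
        have "(cmod w)\<^sup>2 / A = 1 + 1 / 44" unfolding ratio[symmetric] w2 ..
        then have "t * ((cmod w)\<^sup>2 / A - 1) = t / 44" by simp
        moreover have "4 * C * exp (1.05 / 2 * (cmod w)\<^sup>2) < t / 44" using w2 l
            by (intro small) auto
        ultimately have "t * ((cmod w)\<^sup>2 / A - 1) - 4 * C * exp (1.05 / 2 * (cmod w)\<^sup>2) > 0"
            by linarith
        then have "?s * (t * ((cmod w)\<^sup>2 / A - 1) - 4 * C * exp (1.05 / 2 * (cmod w)\<^sup>2)) > 0"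
            using s by simp
        then show ?thesis using close[of w] by (simp add: right_diff_distrib mult.assoc abs_le_iff)
      qed
      have "?k > 0" using d by simp
      from long_component_in_disk[OF R this r k1 neg pos] show ?thesis unfolding k .
    qed
    show ?thesis using B comp by blast
  qed
  show ?thesis using main C(1) by (intro exI[of _ "176 * C"]) auto
qed

section \<open>Counting over disjoint disks\<close>

text \<open>Components inside disjoint disks are distinct, so the number of long components dominates the number
of those events \<open>B i\<close> that occur. The expectation of the latter is the sum of the probabilities.\<close>

lemma expected_long_components_ge:
  assumes I: "finite I" and B: "\<And>i. i \<in> I \<Longrightarrow> B i \<in> sets (kostlan d)"
      "\<And>i. i \<in> I \<Longrightarrow> p \<le> emeasure (kostlan d) (B i)"
    and comp: "\<And>i a. i \<in> I \<Longrightarrow> a \<in> B i \<Longrightarrow> \<exists>C\<in>components (real_curve d a). C \<subseteq> D i \<and> ennreal L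
        \<le> curve_length C"
    and disj: "disjoint_family_on D I"
  shows "of_nat (card I) * p \<le> expected_long_components d L"
proof -
  have "of_nat (card I) * p = (\<Sum>i\<in>I. p)" by simp
  also have "\<dots> \<le> (\<Sum>i\<in>I. emeasure (kostlan d) (B i))" by (intro sum_mono B)
  also have "\<dots> = (\<Sum>i\<in>I. \<integral>\<^sup>+a. indicator (B i) a \<partial>kostlan d)" using B by simp
  also have "\<dots> = (\<integral>\<^sup>+a. (\<Sum>i\<in>I. indicator (B i) a) \<partial>kostlan d)"
    using B by (intro nn_integral_sum[symmetric]) auto
  also have "\<dots> \<le> expected_long_components d L"
    unfolding expected_long_components_def
  proof (rule nn_integral_mono)
    fix a
    define J where "J = {i\<in>I. a \<in> B i}"
    have J: "finite J" using I by (simp add: J_def)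
    have "\<forall>i\<in>J. \<exists>C. C \<in> long_components L (real_curve d a) \<and> C \<subseteq> D i \<and> C \<noteq> {}"
    proof
      fix i assume "i \<in> J"
      then obtain C where C: "C \<in> components (real_curve d a)" "C \<subseteq> D i"
          "ennreal L \<le> curve_length C"
        using comp[of i a] by (auto simp: J_def)
      then show "\<exists>C. C \<in> long_components L (real_curve d a) \<and> C \<subseteq> D i \<and> C \<noteq> {}"
        using in_components_nonempty[OF C(1)] by (intro exI[of _ C]) (simp add: long_components_def)
    qed
    then obtain K where K: "\<And>i. i \<in> J \<Longrightarrow> K i \<in> long_components L (real_curve d a) \<and> K i \<subseteq> D i
        \<and> K i \<noteq> {}"
      by metis
    have inj: "inj_on K J"
    proof (rule inj_onI)
      fix i j assume ij: "i \<in> J" "j \<in> J" "K i = K j"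
      then have "D i \<inter> D j \<noteq> {}" using K[of i] K[of j] by blast
      then show "i = j" using disj ij unfolding disjoint_family_on_def J_def by blast
    qed
    have "(\<Sum>i\<in>I. indicator (B i) a) = (\<Sum>i\<in>J. 1 :: ennreal)"
      unfolding J_def using I by (intro sum.mono_neutral_cong_right) auto
    also have "\<dots> = of_nat (card (K ` J))" using card_image[OF inj] by simp
    also have "\<dots> = emeasure (count_space UNIV) (K ` J)" using J
        by (simp add: emeasure_count_space_finite)
    also have "\<dots> \<le> emeasure (count_space UNIV) (long_components L (real_curve d a))"
      using K by (intro emeasure_mono) auto
    finally show "(\<Sum>i\<in>I. indicator (B i) a)
        \<le> emeasure (count_space UNIV) (long_components L (real_curve d a))" .
  qed
  finally show ?thesis .
qed

text \<open>Lagrange's identity bounds \<open>\<bar>X\<bar>\<^sup>2 \<bar>Y\<bar>\<^sup>2 sin\<^sup>2\<close> of the angle between \<open>X\<close> and \<open>Y\<close> from below by the squared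
Euclidean distance of the affine points; the constant \<open>3\<close> bounds \<open>\<bar>X\<bar> \<bar>Y\<bar>\<close> over the unit square.\<close>

lemma fs_dist_affine_ge:
  fixes u v u' v' :: real
  assumes uv: "0 \<le> u" "u \<le> 1" "0 \<le> v" "v \<le> 1" "0 \<le> u'" "u' \<le> 1" "0 \<le> v'" "v' \<le> 1"
  shows "sqrt ((u - u')\<^sup>2 + (v - v')\<^sup>2) / 3
      \<le> fs_dist (abs_rp2 (vector [1, u, v])) (abs_rp2 (vector [1, u', v']))"
proof -
  define X Y :: "real^3" where "X = vector [1, u, v]" and "Y = vector [1, u', v']"
  have X [simp]: "X $ 1 = 1" "X $ 2 = u" "X $ 3 = v" and Y [simp]: "Y $ 1 = 1" "Y $ 2 = u'"
      "Y $ 3 = v'"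
    by (simp_all only: X_def Y_def vector_3)
  have nz: "X \<noteq> 0" "Y \<noteq> 0" using X(1) Y(1) by fastforce+
  have XY: "X \<bullet> Y = 1 + u * u' + v * v'" by (simp add: inner_vec_def sum_3)
  have XX: "(norm X)\<^sup>2 = 1 + u * u + v * v" by (simp add: power2_norm_eq_inner inner_vec_def sum_3)
  have YY: "(norm Y)\<^sup>2 = 1 + u' * u' + v'
      * v'" by (simp add: power2_norm_eq_inner inner_vec_def sum_3)
  have bound: "1 + x * x + y * y \<le> 3" if "0 \<le> x" "x \<le> 1" "0 \<le> y" "y \<le> 1" for x y :: real
    using mult_mono[of x 1 x 1] mult_mono[of y 1 y 1] that by simp
  have nn: "(norm X)\<^sup>2 * (norm Y)\<^sup>2 \<le> 3\<^sup>2"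
    unfolding XX YY power2_eq_square[of 3] using uv
        by (intro mult_mono bound) (auto intro!: add_nonneg_nonneg)
  define g where "g = \<bar>X \<bullet> Y\<bar> / (norm X * norm Y)"
  have pos: "norm X * norm Y > 0" using nz by simp
  have g: "0 \<le> g" "g \<le> 1"
    using Cauchy_Schwarz_ineq2[of X Y] pos by (auto simp: g_def divide_le_eq_1)
  have "(u - u')\<^sup>2 + (v - v')\<^sup>2 \<le> (u - u')\<^sup>2 + (v - v')\<^sup>2 + (u * v' - v * u')\<^sup>2" by simp
  also have "\<dots> = (norm X)\<^sup>2 * (norm Y)\<^sup>2 - (X \<bullet> Y)\<^sup>2"
    unfolding XX YY XY by (simp add: power2_eq_square algebra_simps)
  also have "\<dots> = (norm X)\<^sup>2 * (norm Y)\<^sup>2 * (1 - g\<^sup>2)"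
    using nz by (simp add: g_def power_divide power_mult_distrib right_diff_distrib)
  also have "\<dots> \<le> 3\<^sup>2 * (1 - g\<^sup>2)"
    using nn g by (intro mult_right_mono) (auto simp: power_le_one)
  finally have "sqrt ((u - u')\<^sup>2 + (v - v')\<^sup>2) \<le> sqrt (3\<^sup>2 * (1 - g\<^sup>2))" by (rule real_sqrt_le_mono)
  also have "\<dots> = 3 * sqrt (1 - g\<^sup>2)" unfolding real_sqrt_mult by simp
  also have "sqrt (1 - g\<^sup>2) = sin (arccos g)" using g by (intro sin_arccos[symmetric]) auto
  also have "\<dots> \<le> arccos g" using g by (intro sin_x_le_x arccos_lbound) auto
  finally have "sqrt ((u - u')\<^sup>2 + (v - v')\<^sup>2) / 3 \<le> arccos g" by simp
  then show ?thesis unfolding X_def[symmetric] Y_def[symmetric] fs_dist_abs[OF nz] g_def .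
qed

lemma grid_separation:
  fixes i j i' j' n :: nat
  assumes "i < n" "j < n" "i' < n" "j' < n" "(i, j) \<noteq> (i', j')"
  shows "1 / (3 * real n) \<le> fs_dist (abs_rp2 (vector [1, i / n, j / n])) (abs_rp2 (vector [1, i' /
      n, j' / n]))"
proof -
  have n: "real n > 0" using assms by simp
  have one: "1 \<le> (real a - real b)\<^sup>2" if "a \<noteq> b" for a b :: nat
  proof -
    have "1 \<le> \<bar>real a - real b\<bar>" using that by linarith
    then have "1\<^sup>2 \<le> \<bar>real a - real b\<bar>\<^sup>2" by (intro power_mono) auto
    then show ?thesis by simp
  qed
  have "1 \<le> (real i - real i')\<^sup>2 + (real j - real j')\<^sup>2"
  proof (cases "i = i'")
    case True
    then show ?thesis using assms one[of j j'] by simp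
  next
    case False
    then show ?thesis using one[of i i'] zero_le_power2[of "real j - real j'"] by linarith
  qed
  then have "(1 / real n)\<^sup>2 \<le> ((real i - real i')\<^sup>2 + (real j - real j')\<^sup>2) / (real n)\<^sup>2"
    using n by (simp add: power_divide divide_right_mono)
  also have "\<dots> = (i / n - i' / n)\<^sup>2 + (j / n - j' / n)\<^sup>2"
    by (simp add: diff_divide_distrib[symmetric] power_divide add_divide_distrib)
  finally have "1 / n \<le> sqrt ((i / n - i' / n)\<^sup>2 + (j / n - j' / n)\<^sup>2)" by (rule real_le_rsqrt)
  also have "\<dots> / 3 \<le> fs_dist (abs_rp2 (vector [1, i / n, j / n])) (abs_rp2 (vector [1, i' / n, j'
      / n]))"
    using assms by (intro fs_dist_affine_ge) auto
  finally show ?thesis by simp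
qed

text \<open>Every point of the projective plane is the centre of a disk of the kind considered above.\<close>

lemma exists_rotation_to:
  assumes "X \<noteq> 0"
  shows "\<exists>R. orthogonal_transformation R \<and> disk_map R \<kappa> 0 = abs_rp2 X"
proof -
  have "norm (axis 1 1 :: real^3) = 1" "norm (X /\<^sub>R norm X) = 1" using assms by auto
  then have "\<exists>R. orthogonal_transformation R \<and> R (axis 1 1 :: real^3) = X /\<^sub>R norm X"
    by (rule orthogonal_transformation_exists_1) blast
  then obtain R where R: "orthogonal_transformation R" "R (axis 1 1 :: real^3) = X /\<^sub>R norm X"
    by blast
  have "disk_vec \<kappa> 0 = axis 1 1" by (auto simp: vec_eq_iff forall_3 axis_def)
  then have "disk_map R \<kappa> 0 = abs_rp2 (X /\<^sub>R norm X)" by (simp add: disk_map_def R)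
  also have "\<dots> = abs_rp2 X" using assms by (intro abs_rp2_eqI[of _ _ "norm X"]) auto
  finally show ?thesis using R by blast
qed

text \<open>The disks are centred at the points of an \<open>n\<close> by \<open>n\<close> grid in an affine chart, whose mutual distances are
at least \<open>1 / (3 n)\<close>; hence disks of radius at most \<open>1 / (6 n)\<close> are disjoint.\<close>

lemma expected_long_components_lower_bound:
  "\<exists>C>0. \<forall>d n t l. d \<ge> 2 \<longrightarrow> t > 0 \<longrightarrow> l \<ge> 4 \<longrightarrow> l \<le> real d \<longrightarrow> C * exp (0.4725 * l) < t \<longrightarrow>
    6 * real n * sqrt (0.9 * l / d) \<le> 1 \<longrightarrow>
    ennreal ((real n)\<^sup>2 * (exp (- t\<^sup>2 - 4 * t) / 2)) \<le> expected_long_components d (2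
        * arctan (sqrt (0.86 * l / d)))"
proof -
  obtain C where C: "C > 0" and event: "\<And>d R t l. d \<ge> 2 \<Longrightarrow> orthogonal_transformation R \<Longrightarrow> t > 0
      \<Longrightarrow> l \<ge> 4 \<Longrightarrow> l \<le> real d \<Longrightarrow> C * exp (0.4725 * l) < t \<Longrightarrow>
    (\<exists>B\<in>sets (kostlan d). ennreal (exp (- t\<^sup>2 - 4 * t) / 2) \<le> emeasure (kostlan d) B \<and>
      (\<forall>a\<in>B. \<exists>K\<in>components (real_curve d a). K
          \<subseteq> ball (disk_map R (1 / sqrt d) 0) (arctan (sqrt (0.9 * l / d))) \<and>
         ennreal (2 * arctan (sqrt (0.86 * l / d))) \<le> curve_length K))"
    using long_component_event by blast
  have main: "ennreal ((real n)\<^sup>2 * (exp (- t\<^sup>2 - 4 * t) / 2))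
      \<le> expected_long_components d (2 * arctan (sqrt (0.86 * l / d)))"
    if h: "d \<ge> 2" "t > 0" "l \<ge> 4" "l \<le> real d" "C * exp (0.4725 * l) < t" and n:
        "6 * real n * sqrt (0.9 * l / d) \<le> 1" for d n t l
  proof -
    define I where "I = {..<n} \<times> {..<n}"
    define P where "P = (\<lambda>i. abs_rp2 (vector [1, real (fst i) / n, real (snd i) / n]))"
    define D where "D = (\<lambda>i. ball (P i) (arctan (sqrt (0.9 * l / d))))"
    have "\<exists>B\<in>sets (kostlan d). ennreal (exp (- t\<^sup>2 - 4 * t) / 2) \<le> emeasure (kostlan d) B \<and>
      (\<forall>a\<in>B. \<exists>K\<in>components (real_curve d a). K \<subseteq> D i \<and> ennreal (2 * arctan (sqrt (0.86 * l / d)))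
          \<le> curve_length K)" for i
    proof -
      let ?X = "vector [1, real (fst i) / n, real (snd i) / n] :: real^3"
      have "?X $ 1 = 1" by (simp only: vector_3)
      then have "?X \<noteq> 0" by fastforce
      from exists_rotation_to[OF this, of "1 / sqrt d"] obtain R where R:
          "orthogonal_transformation R" "disk_map R (1 / sqrt d) 0 = P i"
        unfolding P_def by blast
      from event[OF h(1) R(1) h(2-5)] show ?thesis unfolding R(2) D_def .
    qed
    then obtain B where B: "\<And>i. B i \<in> sets (kostlan d)" "\<And>i. ennreal (exp (- t\<^sup>2 - 4 * t) / 2)
        \<le> emeasure (kostlan d) (B i)"
      "\<And>i a. a \<in> B i \<Longrightarrow> \<exists>K\<in>components (real_curve d a). K \<subseteq> D i
          \<and> ennreal (2 * arctan (sqrt (0.86 * l / d))) \<le> curve_length K"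
      by metis
    have disj: "disjoint_family_on D I"
      unfolding disjoint_family_on_def
    proof (intro ballI impI)
      fix i j assume ij: "i \<in> I" "j \<in> I" "i \<noteq> j"
      then have n0: "real n > 0" by (auto simp: I_def)
      have sep: "1 / (3 * real n) \<le> dist (P i) (P j)"
        unfolding P_def dist_rp2_def using ij
            by (intro grid_separation) (auto simp: I_def prod_eq_iff)
      have "arctan (sqrt (0.9 * l / d)) \<le> sqrt (0.9 * l / d)" using h by (intro arctan_le_self) auto
      also have "\<dots> \<le> 1 / (6 * real n)" using n n0 by (simp add: field_simps)
      finally have small: "arctan (sqrt (0.9 * l / d)) \<le> 1 / (6 * real n)" .
      show "D i \<inter> D j = {}"
      proof (rule ccontr)
        assume "D i \<inter> D j \<noteq> {}"
        then obtain p where p: "dist (P i) p < arctan (sqrt (0.9 * l / d))"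
            "dist (P j) p < arctan (sqrt (0.9 * l / d))"
          by (auto simp: D_def)
        have "dist (P i) (P j) \<le> dist (P i) p + dist (P j) p" by (rule dist_triangle2)
        also have "\<dots> < 1 / (6 * real n) + 1 / (6 * real n)" using p small by linarith
        also have "\<dots> = 1 / (3 * real n)" by simp
        finally show False using sep by simp
      qed
    qed
    have "of_nat (card I) * ennreal (exp (- t\<^sup>2 - 4 * t) / 2)
        \<le> expected_long_components d (2 * arctan (sqrt (0.86 * l / d)))"
      by (rule expected_long_components_ge[of I B d _ D]) (use B disj in \<open>auto simp: I_def\<close>)
    also have "of_nat (card I) * ennreal (exp (- t\<^sup>2 - 4 * t) / 2)
        = ennreal ((real n)\<^sup>2 * (exp (- t\<^sup>2 - 4 * t) / 2))"
    proof -
      have "real (card I) = (real n)\<^sup>2" by (simp add: I_def power2_eq_square)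
      then show ?thesis unfolding ennreal_of_nat_eq_real_of_nat
          by (simp only: ennreal_mult'[OF zero_le_power2])
    qed
    finally show ?thesis .
  qed
  show ?thesis
  proof (rule exI[of _ C], rule conjI[OF C], intro allI impI)
    fix d n :: nat and t l :: real
    assume "d \<ge> 2" "t > 0" "l \<ge> 4" "l \<le> real d" "C * exp (0.4725 * l) < t"
        "6 * real n * sqrt (0.9 * l / d) \<le> 1"
    then show "ennreal ((real n)\<^sup>2 * (exp (- t\<^sup>2 - 4 * t) / 2))
        \<le> expected_long_components d (2 * arctan (sqrt (0.86 * l / d)))"
      by (rule main)
  qed
qed

section \<open>Asymptotics\<close>

lemma expected_long_components_antimono:
  assumes "L \<le> L'"
  shows "expected_long_components d L' \<le> expected_long_components d L"
  unfolding expected_long_components_def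
proof (intro nn_integral_mono emeasure_mono)
  fix a
  show "long_components L' (real_curve d a) \<subseteq> long_components L (real_curve d a)"
  proof
    fix K assume "K \<in> long_components L' (real_curve d a)"
    then have K: "K \<in> components (real_curve d a)" "ennreal L' \<le> curve_length K"
        by (simp_all add: long_components_def)
    from K(1) order_trans[OF ennreal_leI[OF assms] K(2)] show
        "K \<in> long_components L (real_curve d a)"
      by (simp add: long_components_def)
  qed
qed simp

text \<open>The additive constant \<open>ln (\<epsilon> / 2\<^sup>1\<^sup>1)\<close> and the difference between \<open>arctan y\<close> and \<open>y\<close> are absorbed in the gap
between \<open>\<pi>\<^sup>2 / 12\<close> and \<open>0.86\<close>: with a margin of one per cent each,
\<open>\<pi>\<^sup>2 * 1.01 / 12 < 0.99\<^sup>2 * 0.86\<close>.\<close>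

lemma length_threshold_asymptotics:
  fixes \<epsilon> :: real
  assumes "\<epsilon> > 0"
  shows "\<forall>\<^sub>F x in at_top. 2 * pi * sqrt (ln (\<epsilon> * ln x / 2 ^ 11) / (12 * x))
      \<le> 2 * arctan (sqrt (0.86 * ln (ln x) / x))"
proof -
  have 1: "\<forall>\<^sub>F x in at_top. ln (\<epsilon> * ln x / 2 ^ 11) \<le> 1.01 * ln (ln x)"
    using assms by real_asymp
  have 2: "\<forall>\<^sub>F x in at_top. 0.99 * sqrt (0.86 * ln (ln x) / x)
      \<le> arctan (sqrt (0.86 * ln (ln (x::real)) / x))"
    by real_asymp
  have 3: "\<forall>\<^sub>F x in at_top. ln (ln (x::real)) > 0" by real_asymp
  show ?thesis using 1 2 3 eventually_gt_at_top[of 0]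
  proof eventually_elim
    case (elim x)
    have "pi\<^sup>2 \<le> 3.1416\<^sup>2" using pi_approx by (intro power_mono) auto
    have "(pi * sqrt (ln (\<epsilon> * ln x / 2 ^ 11) / (12 * x))) \<le> pi * sqrt (1.01 * ln (ln x) / (12 * x))"
      using elim by (intro mult_left_mono real_sqrt_le_mono divide_right_mono) auto
    also have "\<dots> = sqrt (pi\<^sup>2 * (1.01 / 12) * (ln (ln x) / x))"
      by (simp add: real_sqrt_mult real_sqrt_divide)
    also have "\<dots> \<le> sqrt (0.99\<^sup>2 * 0.86 * (ln (ln x) / x))"
      using elim \<open>pi\<^sup>2 \<le> 3.1416\<^sup>2\<close> by (intro real_sqrt_le_mono mult_right_mono) (auto simp:
          power2_eq_square)
    also have "\<dots> = 0.99 * sqrt (0.86 * ln (ln x) / x)"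
      unfolding mult.assoc real_sqrt_mult[of "0.99\<^sup>2"] by simp
    also have "\<dots> \<le> arctan (sqrt (0.86 * ln (ln x) / x))" by (rule elim)
    finally show ?case by simp
  qed
qed

theorem theorem5p5:
  fixes \<epsilon> :: real
  assumes "\<epsilon> > 0"
  shows "\<exists>c>0. \<exists>d0. \<forall>d\<ge>d0.
           ennreal (c * real d powr (1 - \<epsilon>) / ln (ln (real d)))
             \<le> expected_long_components d
                 (2 * pi * sqrt (ln (\<epsilon> * ln (real d) / 2 ^ 11) / (12 * real d)))"
proof -
  obtain C where C: "C > 0" and lower: "\<And>d n t l. d \<ge> 2 \<Longrightarrow> t > 0 \<Longrightarrow> l \<ge> 4 \<Longrightarrow> l \<le> real d
      \<Longrightarrow> C * exp (0.4725 * l) < t \<Longrightarrow>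
    6 * real n * sqrt (0.9 * l / d) \<le> 1 \<Longrightarrow>
    ennreal ((real n)\<^sup>2 * (exp (- t\<^sup>2 - 4 * t) / 2)) \<le> expected_long_components d (2
        * arctan (sqrt (0.86 * l / d)))"
    using expected_long_components_lower_bound by blast
  \<comment> \<open>Each event then has probability \<open>d powr (- \<epsilon>/4 - o(1))\<close>, well above the factor \<open>d powr (- \<epsilon>)\<close>
      of the claim.\<close>
  define t where "t = (\<lambda>x. sqrt (\<epsilon> / 4 * ln x))"
  have ev: "\<forall>\<^sub>F x in at_top. x \<ge> 2 \<and> t x > 0 \<and> ln (ln x) \<ge> 4 \<and> ln (ln x) \<le> x
      \<and> C * exp (0.4725 * ln (ln x)) < t x \<and>
     sqrt x / (6 * ln (ln x)) \<ge> 1 \<and>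
     x powr (1 - \<epsilon>) / ln (ln x) \<le> (sqrt x / (12 * ln (ln x)))\<^sup>2 * (exp (- (\<epsilon> / 4 * ln x) - 4
         * t x) / 2) \<and>
     2 * pi * sqrt (ln (\<epsilon> * ln x / 2 ^ 11) / (12 * x)) \<le> 2 * arctan (sqrt (0.86 * ln (ln x) / x))"
  proof (intro eventually_conj)
    show "\<forall>\<^sub>F x::real in at_top. x \<ge> 2" by (rule eventually_ge_at_top)
    show "\<forall>\<^sub>F x in at_top. t x > 0" unfolding t_def using assms by real_asymp
    show "\<forall>\<^sub>F x::real in at_top. ln (ln x) \<ge> 4" by real_asymp
    show "\<forall>\<^sub>F x::real in at_top. ln (ln x) \<le> x" by real_asymp
    show "\<forall>\<^sub>F x in at_top. C * exp (0.4725 * ln (ln x)) < t x" unfolding t_def using assms C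
        by real_asymp
    show "\<forall>\<^sub>F x::real in at_top. sqrt x / (6 * ln (ln x)) \<ge> 1" by real_asymp
    show "\<forall>\<^sub>F x in at_top. x powr (1 - \<epsilon>) / ln (ln x)
        \<le> (sqrt x / (12 * ln (ln x)))\<^sup>2 * (exp (- (\<epsilon> / 4 * ln x) - 4 * t x) / 2)"
      unfolding t_def using assms by real_asymp
    show "\<forall>\<^sub>F x in at_top. 2 * pi * sqrt (ln (\<epsilon> * ln x / 2 ^ 11) / (12 * x))
        \<le> 2 * arctan (sqrt (0.86 * ln (ln x) / x))"
      by (rule length_threshold_asymptotics[OF assms])
  qed
  from eventually_compose_filterlim[OF this filterlim_real_sequentially] obtain d0 where
    d0: "\<And>d. d \<ge> d0 \<Longrightarrow> real d \<ge> 2 \<and> t d > 0 \<and> ln (ln (real d)) \<ge> 4 \<and> ln (ln (real d)) \<le> d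
        \<and> C * exp (0.4725 * ln (ln (real d))) < t d \<and>
     sqrt d / (6 * ln (ln (real d))) \<ge> 1 \<and>
     d powr (1 - \<epsilon>) / ln (ln (real d)) \<le> (sqrt d / (12 * ln (ln (real d))))\<^sup>2 * (exp (- (\<epsilon> / 4
         * ln d) - 4 * t d) / 2) \<and>
     2 * pi * sqrt (ln (\<epsilon> * ln d / 2 ^ 11) / (12 * real d)) \<le> 2 * arctan (sqrt (0.86
         * ln (ln (real d)) / d))"
    unfolding eventually_sequentially by blast
  have "ennreal (1 * real d powr (1 - \<epsilon>) / ln (ln (real d)))
             \<le> expected_long_components d (2 * pi * sqrt (ln (\<epsilon> * ln (real d) / 2 ^ 11) / (12
                 * real d)))" if "d \<ge> d0" for d
  proof -
    define l where "l = ln (ln (real d))"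
    have h: "real d \<ge> 2" "t d > 0" "l \<ge> 4" "l \<le> d" "C * exp (0.4725 * l) < t d"
        "sqrt d / (6 * l) \<ge> 1"
      "d powr (1 - \<epsilon>) / l \<le> (sqrt d / (12 * l))\<^sup>2 * (exp (- (\<epsilon> / 4 * ln d) - 4 * t d) / 2)"
      "2 * pi * sqrt (ln (\<epsilon> * ln d / 2 ^ 11) / (12 * real d)) \<le> 2 * arctan (sqrt (0.86 * l / d))"
      using d0[OF that] unfolding l_def by blast+
    \<comment> \<open>Since \<open>sqrt (0.9 l) \<le> l\<close>, the disks of affine radius \<open>sqrt (0.9 l / d)\<close> around the grid
        points are disjoint for \<open>n \<le> y\<close>.\<close>
    define y where "y = sqrt d / (6 * l)"
    define n where "n = nat \<lfloor>y\<rfloor>"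
    have y: "y \<ge> 1" using h by (simp add: y_def)
    have "real n = of_int \<lfloor>y\<rfloor>" "\<lfloor>y\<rfloor> \<ge> 1" using y by (simp_all add: n_def)
    then have n: "real n \<le> y" "y / 2 \<le> real n" using floor_correct[of y] by linarith+
    have "sqrt (0.9 * l) \<le> sqrt (l\<^sup>2)"
      using h by (intro real_sqrt_le_mono) (auto simp: power2_eq_square)
    also have "\<dots> = l" using h by simp
    finally have le: "sqrt (0.9 * l) / sqrt d \<le> l / sqrt d" by (intro divide_right_mono) simp_all
    have "6 * real n * sqrt (0.9 * l / d) \<le> 6 * y * (l / sqrt d)"
      unfolding real_sqrt_divide
      by (rule mult_mono[OF _ le]) (use n y h in simp_all)
    also have "\<dots> = 1" using h by (simp add: y_def)
    finally have sep: "6 * real n * sqrt (0.9 * l / d) \<le> 1" .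
    have t2: "(t d)\<^sup>2 = \<epsilon> / 4 * ln d" using assms h(1) by (simp add: t_def)
    have "d powr (1 - \<epsilon>) / l \<le> (y / 2)\<^sup>2 * (exp (- (t d)\<^sup>2 - 4 * t d) / 2)"
      using h(7) by (simp add: y_def t2)
    also have "\<dots> \<le> (real n)\<^sup>2 * (exp (- (t d)\<^sup>2 - 4 * t d) / 2)"
      using n y by (intro mult_right_mono power_mono) auto
    finally have "ennreal (1 * real d powr (1 - \<epsilon>) / l)
        \<le> ennreal ((real n)\<^sup>2 * (exp (- (t d)\<^sup>2 - 4 * t d) / 2))"
      by (intro ennreal_leI) simp
    also have "\<dots> \<le> expected_long_components d (2 * arctan (sqrt (0.86 * l / d)))"
      using h by (intro lower sep) auto
    also have "\<dots> \<le> expected_long_components d (2 * pi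
        * sqrt (ln (\<epsilon> * ln (real d) / 2 ^ 11) / (12 * real d)))"
      using h(8) by (rule expected_long_components_antimono)
    finally show ?thesis unfolding l_def .
  qed
  then show ?thesis by (intro exI[of _ 1] conjI exI[of _ d0]) auto
qed

end
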